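(* Let $k$ be an algebraically closed field of characteristic zero, $A=k[[x_1,\dots,x_n]]$, and $\pi\in A$ with $\pi(0)=0$. Then the Faltings–Knörrer functor $\theta$ establishes equivalences of categories $$\mathrm{MF}(\pi)\xrightarrow{\ \sim\ }\mathrm{MF}(xy-\pi),\qquad \mathrm{MF}^{\omega,\epsilon}(\pi)\xrightarrow{\ \sim\ }\mathrm{MF}^{\epsilon}(xy-\pi),\qquad \mathrm{MF}^{\epsilon}(\pi)\xrightarrow{\ \sim\ }\mathrm{MF}^{\omega,-\epsilon}(xy-\pi),$$ for $\epsilon\in\{+,-\}$.
   Context: Matrix factorizations. Let $S$ be a complete local noetherian $k$-algebra with residue field $k$, and $w$ in its maximal ideal. A matrix factorization (MF) of $w$ over $S$ is a $\mathbb Z/2$-graded free $S$-module of finite rank $M=M_0\oplus M_1$ with an odd $S$-linear map $Q=\begin{pmatrix}0&\psi\\ \varphi&0\end{pmatrix}$, $\varphi:M_0\to M_1$, $\psi:M_1\to M_0$, with $Q^2=w\cdot1$. We write $M=(\varphi,\psi)$. For MFs $M,M'$ of $w$, $\hom(M,M')$ is the graded module of all $S$-linear maps, with differential $D(f)=Q'f-(-1)^{|f|}fQ$, and $\mathrm{Ext}^\bullet(M,M')=\ker D/\operatorname{im}D$. The homotopy category $\mathrm{MF}(w)$ has the MFs of $w$ as objects and $\mathrm{Ext}^0(M,M')$ as morphisms. Here $\mathrm{MF}(\pi)$ is taken over $S=A$ and $\mathrm{MF}(xy-\pi)$ over $S=A[[x,y]]$. Duals and forms. $M^T$ is $M_0^*\xrightarrow{{}^t\psi}M_1^*\xrightarrow{{}^t\varphi}M_0^*$,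 and $M^*$ is $M_1^*\xrightarrow{-{}^t\varphi}M_0^*\xrightarrow{-{}^t\psi}M_1^*$. A quadratic (resp. symplectic) form on $M$ is an isomorphism of MFs $b:M\to M^*$, regarded as an odd map $M\to M^T$, with ${}^tb=-b$ (resp. ${}^tb=b$) and $b^{-1}\,{}^tQ\,b=-Q$. A twisted quadratic (resp. symplectic) form is an isomorphism of MFs $q:M\to M^T$ with ${}^tq=q$ (resp. ${}^tq=-q$) and $q^{-1}\,{}^tQ\,q=Q$. $\mathrm{MF}^{\pm}(w)$ (resp. $\mathrm{MF}^{\omega,\pm}(w)$) is the category of MFs of $w$ equipped with a quadratic ($+$) or symplectic ($-$) form (resp. twisted quadratic or twisted symplectic form); morphisms are the morphisms of the underlying MFs in $\mathrm{MF}(w)$. Functor $\theta$. For an MF $(P,Q)$ of $\pi$ over $A$, $\theta(P,Q)=(Q,-P)\otimes(x,y)$, where $(x,y)$ is the MF $k[[x,y]]\xrightarrow{x}k[[x,y]]\xrightarrow{y}k[[x,y]]$ of $xy$ and $\otimes$ is the $\mathbb Z/2$-graded tensor product with operator $Q\otimes1+1\otimes Q'$ (Koszul sign rule). Up to isomorphism, $\varphi=\begin{pmatrix}x&P\\ Q&y\end{pmatrix}$, $\psi=\begin{pmatrix}y&-P\\ -Q&x\end{pmatrix}$. A form or twisted form on $(P,Q)$ is transferred to $(Q,-P)$ (by interchanging its two components, with a change of sign of one component in the twisted case) and tensored, with the Koszul sign rule, with the essentially unique quadratic form on $(x,y)$, $\beta_0=1$, $\beta_1=-1$. This gives the structure on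 $\theta(P,Q)$. *)

theory Defs
  imports
    Jordan_Normal_Form.Matrix
    "HOL-Library.Poly_Mapping"
    "HOL-Library.Type_Length"
    "HOL-Computational_Algebra.Polynomial"
    "HOL-Computational_Algebra.Formal_Power_Series"
begin

section \<open>Power series in finitely many variables\<close>

text \<open>
  The type \<open>('n, 'a) mvps\<close> is $a[[x_1,\ldots,x_n]]$, where $n$ is \<open>LENGTH('n)\<close>. The class
  \<open>len0\<close>, rather than \<open>finite\<close>, is used for the index so that $n = 0$ is included. An exponent
  vector is a finitely supported function on the natural numbers whose support lies below $n$.
\<close>

typedef (overloaded) ('n::len0, 'a::zero) mvps =
  "{f :: (nat \<Rightarrow>\<^sub>0 nat) \<Rightarrow> 'a. \<forall>m. f m \<noteq> 0 \<longrightarrow> Poly_Mapping.keys m \<subseteq> {..<LENGTH('n)}}"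
  morphisms mvps_coeff Abs_mvps
  by (rule exI[of _ "\<lambda>_. 0"]) simp

setup_lifting type_definition_mvps

lemma mvps_eqI: "(\<And>m. mvps_coeff f m = mvps_coeff g m) \<Longrightarrow> f = g"
  by (simp add: mvps_coeff_inject[symmetric] fun_eq_iff)

lemma keys_add_nat:
  "Poly_Mapping.keys (a + b) = Poly_Mapping.keys a \<union> Poly_Mapping.keys (b :: nat \<Rightarrow>\<^sub>0 nat)"
  by (auto simp: in_keys_iff lookup_add)

lemma finite_splittings: "finite {(a, b). a + b = (m :: nat \<Rightarrow>\<^sub>0 nat)}"
proof -
  define F where "F = {g. (\<forall>i. i \<in> Poly_Mapping.keys m \<longrightarrow> g i \<in> {..Poly_Mapping.lookup m i})
    \<and> (\<forall>i. i \<notin> Poly_Mapping.keys m \<longrightarrow> g i = (0::nat))}"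
  define N where "N = Max (insert 0 (Poly_Mapping.lookup m ` Poly_Mapping.keys m))"
  have "F \<subseteq> {g. \<forall>i. (i \<in> Poly_Mapping.keys m \<longrightarrow> g i \<in> {..N}) \<and>
    (i \<notin> Poly_Mapping.keys m \<longrightarrow> g i = 0)}"
  proof
    fix g assume g: "g \<in> F"
    have "g i \<le> N" if "i \<in> Poly_Mapping.keys m" for i
    proof -
      have "g i \<le> Poly_Mapping.lookup m i" using g that by (simp add: F_def)
      also have "\<dots> \<le> N" unfolding N_def using that by (intro Max_ge) auto
      finally show ?thesis .
    qed
    with g show "g \<in> {g. \<forall>i. (i \<in> Poly_Mapping.keys m \<longrightarrow> g i \<in> {..N}) \<and>
        (i \<notin> Poly_Mapping.keys m \<longrightarrow> g i = 0)}"
      by (simp add: F_def)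
  qed
  moreover have "finite \<dots>"
    by (rule finite_set_of_finite_funs) auto
  ultimately have finF: "finite F"
    by (rule finite_subset)
  have inF: "Poly_Mapping.lookup a \<in> F \<and> Poly_Mapping.lookup b \<in> F" if "a + b = m" for a b
    using that unfolding F_def by (auto simp: lookup_add in_keys_iff)
  let ?l = "map_prod Poly_Mapping.lookup Poly_Mapping.lookup"
  have "inj_on ?l {(a, b). a + b = m}"
    by (auto simp: inj_on_def lookup_inject)
  moreover have "finite (?l ` {(a, b). a + b = m})"
    by (rule finite_subset[of _ "F \<times> F"]) (use inF finF in auto)
  ultimately show ?thesis
    by (rule finite_imageD[rotated])
qed

lemma convolution_support:
  fixes f g :: "(nat \<Rightarrow>\<^sub>0 nat) \<Rightarrow> 'b::comm_ring_1"
  assumes f: "\<And>m. f m \<noteq> 0 \<Longrightarrow> Poly_Mapping.keys m \<subseteq> V"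
    and g: "\<And>m. g m \<noteq> 0 \<Longrightarrow> Poly_Mapping.keys m \<subseteq> V"
    and nz: "(\<Sum>(a, b)\<in>{(a, b). a + b = m}. f a * g b) \<noteq> 0"
  shows "Poly_Mapping.keys m \<subseteq> V"
proof -
  from nz obtain p where p: "p \<in> {(a, b). a + b = m}" "(case p of (a, b) \<Rightarrow> f a * g b) \<noteq> 0"
    by (rule sum.not_neutral_contains_not_neutral)
  obtain a b where "p = (a, b)" by (cases p)
  with p have ab: "a + b = m" "f a * g b \<noteq> 0" by auto
  from ab(2) have "f a \<noteq> 0" "g b \<noteq> 0" by auto
  with f g have "Poly_Mapping.keys a \<union> Poly_Mapping.keys b \<subseteq> V" by blast
  then show ?thesis
    using ab(1) by (auto simp: keys_add_nat)
qed

instantiation mvps :: (len0, comm_ring_1) comm_ring_1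
begin

lift_definition zero_mvps :: "('a, 'b) mvps" is "\<lambda>_. 0" by simp

lift_definition one_mvps :: "('a, 'b) mvps" is "\<lambda>m. if m = 0 then 1 else 0"
  by (auto split: if_splits)

lift_definition plus_mvps :: "('a, 'b) mvps \<Rightarrow> ('a, 'b) mvps \<Rightarrow> ('a, 'b) mvps"
  is "\<lambda>f g m. f m + g m"
  by (metis add_0)

lift_definition uminus_mvps :: "('a, 'b) mvps \<Rightarrow> ('a, 'b) mvps" is "\<lambda>f m. - f m"
  by simp

lift_definition minus_mvps :: "('a, 'b) mvps \<Rightarrow> ('a, 'b) mvps \<Rightarrow> ('a, 'b) mvps"
  is "\<lambda>f g m. f m - g m"
  by (metis diff_0_right)

lift_definition times_mvps :: "('a, 'b) mvps \<Rightarrow> ('a, 'b) mvps \<Rightarrow> ('a, 'b) mvps"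
  is "\<lambda>f g m. \<Sum>(a, b)\<in>{(a, b). a + b = m}. f a * g b"
  by (rule convolution_support)

instance
proof
  fix f g h :: "('a, 'b) mvps"
  show "f * g * h = f * (g * h)"
  proof (rule mvps_eqI)
    fix m
    let ?f = "mvps_coeff f" and ?g = "mvps_coeff g" and ?h = "mvps_coeff h"
    let ?S = "\<lambda>m. {(a, b). a + b = (m :: nat \<Rightarrow>\<^sub>0 nat)}"
    have "mvps_coeff (f * g * h) m
        = (\<Sum>p\<in>?S m. \<Sum>q\<in>?S (fst p). ?f (fst q) * ?g (snd q) * ?h (snd p))"
      by (simp add: times_mvps.rep_eq case_prod_beta sum_distrib_right)
    also have "\<dots> = (\<Sum>(p, q)\<in>Sigma (?S m) (\<lambda>p. ?S (fst p)). ?f (fst q) * ?g (snd q) * ?h (snd p))"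
      by (rule sum.Sigma) (auto intro: finite_splittings)
    also have "\<dots> = (\<Sum>(p, q)\<in>Sigma (?S m) (\<lambda>p. ?S (snd p)). ?f (fst p) * (?g (fst q) * ?h (snd q)))"
      by (rule sum.reindex_bij_witness
          [where i = "\<lambda>(p, q). ((fst p + fst q, snd q), (fst p, fst q))"
            and j = "\<lambda>(p, q). ((fst q, snd q + snd p), (snd q, snd p))"])
        (auto simp: ac_simps)
    also have "\<dots> = (\<Sum>p\<in>?S m. \<Sum>q\<in>?S (snd p). ?f (fst p) * (?g (fst q) * ?h (snd q)))"
      by (rule sum.Sigma[symmetric]) (auto intro: finite_splittings)
    also have "\<dots> = mvps_coeff (f * (g * h)) m"
      by (simp add: times_mvps.rep_eq case_prod_beta sum_distrib_left)
    finally show "mvps_coeff (f * g * h) m = mvps_coeff (f * (g * h)) m" .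
  qed
  show "f * g = g * f"
  proof (rule mvps_eqI)
    fix m
    show "mvps_coeff (f * g) m = mvps_coeff (g * f) m"
      unfolding times_mvps.rep_eq
      by (rule sum.reindex_bij_witness[where i = prod.swap and j = prod.swap])
        (auto simp: ac_simps)
  qed
  show "1 * f = f"
  proof (rule mvps_eqI)
    fix m
    have "mvps_coeff (1 * f) m = (\<Sum>p\<in>{(a, b). a + b = m}. if p = (0, m) then mvps_coeff f m else 0)"
      unfolding times_mvps.rep_eq one_mvps.rep_eq
      by (rule sum.cong) (auto split: if_splits)
    also have "\<dots> = mvps_coeff f m"
      by (subst sum.delta) (auto intro: finite_splittings)
    finally show "mvps_coeff (1 * f) m = mvps_coeff f m" .
  qed
  show "(f + g) * h = f * h + g * h"
    by (rule mvps_eqI)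
      (simp add: times_mvps.rep_eq plus_mvps.rep_eq case_prod_beta distrib_right sum.distrib)
  show "f + g + h = f + (g + h)" by transfer (simp add: add.assoc)
  show "f + g = g + f" by transfer (simp add: add.commute)
  show "0 + f = f" by transfer simp
  show "- f + f = 0" by transfer simp
  show "f - g = f + - g" by transfer simp
  show "(0 :: ('a, 'b) mvps) \<noteq> 1"
  proof
    assume "(0 :: ('a, 'b) mvps) = 1"
    then have "mvps_coeff (0 :: ('a, 'b) mvps) 0 = mvps_coeff (1 :: ('a, 'b) mvps) 0" by simp
    then show False by (simp add: zero_mvps.rep_eq one_mvps.rep_eq)
  qed
qed

end

section \<open>Categories and equivalences\<close>

text \<open>
  Hom-sets need not be disjoint, so identities, composition and the action of a functor on
  morphisms take the objects involved as arguments: \<open>Comp C X Y Z g f\<close> is \<open>g \<circ> f\<close> for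
  \<open>f : X \<rightarrow> Y\<close> and \<open>g : Y \<rightarrow> Z\<close>.
\<close>

record ('o, 'm) cat =
  Obj :: "'o set"
  Hom :: "'o \<Rightarrow> 'o \<Rightarrow> 'm set"
  Ident :: "'o \<Rightarrow> 'm"
  Comp :: "'o \<Rightarrow> 'o \<Rightarrow> 'o \<Rightarrow> 'm \<Rightarrow> 'm \<Rightarrow> 'm"

locale category =
  fixes C :: "('o, 'm) cat"
  assumes ident_in: "X \<in> Obj C \<Longrightarrow> Ident C X \<in> Hom C X X"
    and comp_in: "\<lbrakk>X \<in> Obj C; Y \<in> Obj C; Z \<in> Obj C; f \<in> Hom C X Y; g \<in> Hom C Y Z\<rbrakk>
      \<Longrightarrow> Comp C X Y Z g f \<in> Hom C X Z"
    and comp_ident_right: "\<lbrakk>X \<in> Obj C; Y \<in> Obj C; f \<in> Hom C X Y\<rbrakk>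
      \<Longrightarrow> Comp C X X Y f (Ident C X) = f"
    and comp_ident_left: "\<lbrakk>X \<in> Obj C; Y \<in> Obj C; f \<in> Hom C X Y\<rbrakk>
      \<Longrightarrow> Comp C X Y Y (Ident C Y) f = f"
    and comp_assoc: "\<lbrakk>W \<in> Obj C; X \<in> Obj C; Y \<in> Obj C; Z \<in> Obj C;
        f \<in> Hom C W X; g \<in> Hom C X Y; h \<in> Hom C Y Z\<rbrakk>
      \<Longrightarrow> Comp C W Y Z h (Comp C W X Y g f) = Comp C W X Z (Comp C X Y Z h g) f"

definition isomorphism :: "('o, 'm) cat \<Rightarrow> 'o \<Rightarrow> 'o \<Rightarrow> 'm \<Rightarrow> bool" where
  "isomorphism C X Y f \<longleftrightarrow> f \<in> Hom C X Y \<and>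
    (\<exists>g\<in>Hom C Y X. Comp C X Y X g f = Ident C X \<and> Comp C Y X Y f g = Ident C Y)"

record ('o1, 'm1, 'o2, 'm2) fnctr =
  on_obj :: "'o1 \<Rightarrow> 'o2"
  on_mor :: "'o1 \<Rightarrow> 'o1 \<Rightarrow> 'm1 \<Rightarrow> 'm2"

locale is_functor = source: category C + target: category D
  for C :: "('o1, 'm1) cat" and D :: "('o2, 'm2) cat" +
  fixes F :: "('o1, 'm1, 'o2, 'm2) fnctr"
  assumes on_obj_in: "X \<in> Obj C \<Longrightarrow> on_obj F X \<in> Obj D"
    and on_mor_in: "\<lbrakk>X \<in> Obj C; Y \<in> Obj C; f \<in> Hom C X Y\<rbrakk>
      \<Longrightarrow> on_mor F X Y f \<in> Hom D (on_obj F X) (on_obj F Y)"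
    and on_mor_ident: "X \<in> Obj C \<Longrightarrow> on_mor F X X (Ident C X) = Ident D (on_obj F X)"
    and on_mor_comp: "\<lbrakk>X \<in> Obj C; Y \<in> Obj C; Z \<in> Obj C; f \<in> Hom C X Y; g \<in> Hom C Y Z\<rbrakk>
      \<Longrightarrow> on_mor F X Z (Comp C X Y Z g f)
        = Comp D (on_obj F X) (on_obj F Y) (on_obj F Z) (on_mor F Y Z g) (on_mor F X Y f)"

definition id_functor :: "('o, 'm, 'o, 'm) fnctr" where
  "id_functor = \<lparr>on_obj = (\<lambda>X. X), on_mor = (\<lambda>X Y f. f)\<rparr>"

definition comp_functor ::
    "('o2, 'm2, 'o3, 'm3) fnctr \<Rightarrow> ('o1, 'm1, 'o2, 'm2) fnctr \<Rightarrow> ('o1, 'm1, 'o3, 'm3) fnctr" where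
  "comp_functor G F = \<lparr>on_obj = (\<lambda>X. on_obj G (on_obj F X)),
     on_mor = (\<lambda>X Y f. on_mor G (on_obj F X) (on_obj F Y) (on_mor F X Y f))\<rparr>"

definition naturally_isomorphic :: "('o1, 'm1) cat \<Rightarrow> ('o2, 'm2) cat \<Rightarrow>
    ('o1, 'm1, 'o2, 'm2) fnctr \<Rightarrow> ('o1, 'm1, 'o2, 'm2) fnctr \<Rightarrow> bool" where
  "naturally_isomorphic C D F G \<longleftrightarrow> (\<exists>\<eta>.
     (\<forall>X\<in>Obj C. isomorphism D (on_obj F X) (on_obj G X) (\<eta> X)) \<and>
     (\<forall>X\<in>Obj C. \<forall>Y\<in>Obj C. \<forall>f\<in>Hom C X Y.
        Comp D (on_obj F X) (on_obj F Y) (on_obj G Y) (\<eta> Y) (on_mor F X Y f)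
        = Comp D (on_obj F X) (on_obj G X) (on_obj G Y) (on_mor G X Y f) (\<eta> X)))"

definition equivalence_of_categories ::
    "('o1, 'm1) cat \<Rightarrow> ('o2, 'm2) cat \<Rightarrow> ('o1, 'm1, 'o2, 'm2) fnctr \<Rightarrow> bool" where
  "equivalence_of_categories C D F \<longleftrightarrow> is_functor C D F \<and>
     (\<exists>G. is_functor D C G \<and>
       naturally_isomorphic C C id_functor (comp_functor G F) \<and>
       naturally_isomorphic D D (comp_functor F G) id_functor)"

section \<open>Matrix factorizations\<close>

text \<open>
  A $\mathbb{Z}/2$-graded free module of finite rank is given by a list of parities (\<open>True\<close> is odd)
  of a homogeneous basis, the order of which is arbitrary: \<open>M\<^sub>0\<close> is spanned by the even and \<open>M\<^sub>1\<close> by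
  the odd basis vectors. Linear maps are matrices acting on column vectors, and dual modules carry
  the dual bases. \<open>MF par Q\<close> stands for the graded module with the operator
  $Q$; \<open>\<phi>\<close> and \<open>\<psi>\<close> are the parts of $Q$ on the even and the odd columns.
\<close>

datatype 'a mf = MF (par: "bool list") (opr: "'a mat")

abbreviation rank :: "'a mf \<Rightarrow> nat" where
  "rank M \<equiv> length (par M)"

definition graded_maps :: "bool \<Rightarrow> 'a::zero mf \<Rightarrow> 'a mf \<Rightarrow> 'a mat set" where
  "graded_maps p M M' = {f \<in> carrier_mat (rank M') (rank M).
     \<forall>i < rank M'. \<forall>j < rank M. f $$ (i, j) \<noteq> 0 \<longrightarrow> (par M' ! i \<noteq> par M ! j) = p}"

definition is_mf :: "'a::comm_ring_1 \<Rightarrow> 'a mf \<Rightarrow> bool" where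
  "is_mf w M \<longleftrightarrow> opr M \<in> graded_maps True M M \<and> opr M * opr M = w \<cdot>\<^sub>m 1\<^sub>m (rank M)"

definition hom_diff :: "bool \<Rightarrow> 'a::comm_ring_1 mf \<Rightarrow> 'a mf \<Rightarrow> 'a mat \<Rightarrow> 'a mat" where
  "hom_diff p M M' f = opr M' * f - (if p then - 1 else 1) \<cdot>\<^sub>m (f * opr M)"

definition cocycles :: "bool \<Rightarrow> 'a::comm_ring_1 mf \<Rightarrow> 'a mf \<Rightarrow> 'a mat set" where
  "cocycles p M M' = {f \<in> graded_maps p M M'. hom_diff p M M' f = 0\<^sub>m (rank M') (rank M)}"

definition homotopic :: "bool \<Rightarrow> 'a::comm_ring_1 mf \<Rightarrow> 'a mf \<Rightarrow> ('a mat \<times> 'a mat) set" where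
  "homotopic p M M' = {(f, g). f \<in> cocycles p M M' \<and> g \<in> cocycles p M M' \<and>
     (\<exists>h\<in>graded_maps (\<not> p) M M'. f - g = hom_diff (\<not> p) M M' h)}"

definition Ext :: "bool \<Rightarrow> 'a::comm_ring_1 mf \<Rightarrow> 'a mf \<Rightarrow> 'a mat set set" where
  "Ext p M M' = cocycles p M M' // homotopic p M M'"

abbreviation mor_class :: "'a::comm_ring_1 mf \<Rightarrow> 'a mf \<Rightarrow> 'a mat \<Rightarrow> 'a mat set" where
  "mor_class M M' f \<equiv> homotopic False M M' `` {f}"

definition MF_cat :: "'a::comm_ring_1 \<Rightarrow> ('a mf, 'a mat set) cat" where
  "MF_cat w = \<lparr>Obj = {M. is_mf w M},
     Hom = Ext False,
     Ident = (\<lambda>M. mor_class M M (1\<^sub>m (rank M))),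
     Comp = (\<lambda>L M N G F. \<Union>g\<in>G. \<Union>f\<in>F. mor_class L N (g * f))\<rparr>"

section \<open>Duals and forms\<close>

definition mf_transpose :: "'a mf \<Rightarrow> 'a mf" where
  "mf_transpose M = MF (par M) (transpose_mat (opr M))"

definition mf_dual :: "'a::comm_ring_1 mf \<Rightarrow> 'a mf" where
  "mf_dual M = MF (map Not (par M)) (- transpose_mat (opr M))"

text \<open>Isomorphisms of matrix factorizations are strict, that is, not merely up to homotopy.\<close>

definition mf_iso :: "'a::comm_ring_1 mf \<Rightarrow> 'a mf \<Rightarrow> 'a mat \<Rightarrow> bool" where
  "mf_iso M M' f \<longleftrightarrow> f \<in> cocycles False M M' \<and>
     (\<exists>g\<in>cocycles False M' M. g * f = 1\<^sub>m (rank M) \<and> f * g = 1\<^sub>m (rank M'))"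

text \<open>
  The sign \<open>\<epsilon>\<close> is \<open>1\<close> for quadratic and \<open>- 1\<close> for symplectic forms. As \<open>mf_dual M\<close> and
  \<open>mf_transpose M\<close> have the same underlying module with opposite gradings, an even map to the
  former and the same map regarded as an odd map to the latter have the same matrix.
\<close>

definition is_form :: "int \<Rightarrow> 'a::comm_ring_1 mf \<Rightarrow> 'a mat \<Rightarrow> bool" where
  "is_form \<epsilon> M b \<longleftrightarrow> mf_iso M (mf_dual M) b \<and>
     transpose_mat b = - (of_int \<epsilon> \<cdot>\<^sub>m b) \<and>
     (\<exists>c\<in>carrier_mat (rank M) (rank M). c * b = 1\<^sub>m (rank M) \<and> b * c = 1\<^sub>m (rank M) \<and>
        c * transpose_mat (opr M) * b = - opr M)"

definition is_twisted_form :: "int \<Rightarrow> 'a::comm_ring_1 mf \<Rightarrow> 'a mat \<Rightarrow> bool" where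
  "is_twisted_form \<epsilon> M q \<longleftrightarrow> mf_iso M (mf_transpose M) q \<and>
     transpose_mat q = of_int \<epsilon> \<cdot>\<^sub>m q \<and>
     (\<exists>c\<in>carrier_mat (rank M) (rank M). c * q = 1\<^sub>m (rank M) \<and> q * c = 1\<^sub>m (rank M) \<and>
        c * transpose_mat (opr M) * q = opr M)"

definition with_structure :: "('o, 'm) cat \<Rightarrow> ('o \<Rightarrow> 's \<Rightarrow> bool) \<Rightarrow> ('o \<times> 's, 'm) cat" where
  "with_structure C S = \<lparr>Obj = {(X, s). X \<in> Obj C \<and> S X s},
     Hom = (\<lambda>X Y. Hom C (fst X) (fst Y)),
     Ident = (\<lambda>X. Ident C (fst X)),
     Comp = (\<lambda>X Y Z. Comp C (fst X) (fst Y) (fst Z))\<rparr>"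

definition MF_form_cat :: "int \<Rightarrow> 'a::comm_ring_1 \<Rightarrow> ('a mf \<times> 'a mat, 'a mat set) cat" where
  "MF_form_cat \<epsilon> w = with_structure (MF_cat w) (is_form \<epsilon>)"

definition MF_twisted_form_cat ::
    "int \<Rightarrow> 'a::comm_ring_1 \<Rightarrow> ('a mf \<times> 'a mat, 'a mat set) cat" where
  "MF_twisted_form_cat \<epsilon> w = with_structure (MF_cat w) (is_twisted_form \<epsilon>)"

section \<open>Tensor products\<close>

text \<open>
  The basis vector $v_i \otimes e_j$ of a tensor product has number \<open>j * rank V + i\<close>.
  For \<open>g\<close> of parity \<open>p\<close>, \<open>koszul_tensor p vs f g\<close> is
  \<open>f \<otimes> g : v \<otimes> e \<mapsto> (-1)\<^bsup>p |v|\<^esup> f v \<otimes> g e\<close>, where \<open>vs\<close> lists the parities of the source of \<open>f\<close>.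
\<close>

definition tensor_par :: "bool list \<Rightarrow> bool list \<Rightarrow> bool list" where
  "tensor_par vs es = concat (map (\<lambda>e. map (\<lambda>v. v \<noteq> e) vs) es)"

definition koszul_tensor ::
    "bool \<Rightarrow> bool list \<Rightarrow> 'a::comm_ring_1 mat \<Rightarrow> 'a mat \<Rightarrow> 'a mat" where
  "koszul_tensor p vs f g = mat (dim_row f * dim_row g) (dim_col f * dim_col g) (\<lambda>(i, j).
     (if p \<and> vs ! (j mod dim_col f) then - 1 else 1) *
     f $$ (i mod dim_row f, j mod dim_col f) * g $$ (i div dim_row f, j div dim_col f))"

definition mf_tensor :: "'a::comm_ring_1 mf \<Rightarrow> 'a mf \<Rightarrow> 'a mf" where
  "mf_tensor M N = MF (tensor_par (par M) (par N))
     (koszul_tensor False (par M) (opr M) (1\<^sub>m (rank N)) +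
      koszul_tensor True (par M) (1\<^sub>m (rank M)) (opr N))"

section \<open>The functor \<open>\<theta>\<close>\<close>

text \<open>$A[[x, y]]$ is realised as $A[[x]][[y]]$.\<close>

definition const_xy :: "'a::comm_ring_1 \<Rightarrow> 'a fps fps" where
  "const_xy a = fps_const (fps_const a)"

definition var_x :: "'a::comm_ring_1 fps fps" where
  "var_x = fps_const fps_X"

definition var_y :: "'a::comm_ring_1 fps fps" where
  "var_y = fps_X"

definition negate_even_cols :: "bool list \<Rightarrow> 'a::comm_ring_1 mat \<Rightarrow> 'a mat" where
  "negate_even_cols vs f = mat (dim_row f) (dim_col f)
     (\<lambda>(i, j). if vs ! j then f $$ (i, j) else - f $$ (i, j))"

text \<open>
  The passage from $(P, Q)$ to $(Q, -P)$ exchanges the two homogeneous components of the module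
  and changes the sign of the operator on the formerly even one.
\<close>

definition mf_swap :: "'a::comm_ring_1 mf \<Rightarrow> 'a mf" where
  "mf_swap M = MF (map Not (par M)) (negate_even_cols (par M) (opr M))"

definition mf_xy :: "'a::comm_ring_1 fps fps mf" where
  "mf_xy = MF [False, True] (mat_of_rows_list 2 [[0, var_y], [var_x, 0]])"

text \<open>
  The form with $\beta_0 = 1 : E_0 \to E_1^*$ and $\beta_1 = -1 : E_1 \to E_0^*$ on
  $E = (x, y)$.
\<close>

definition beta_xy :: "'a::comm_ring_1 fps fps mat" where
  "beta_xy = mat_of_rows_list 2 [[0, - 1], [1, 0]]"

definition mf_map :: "('a \<Rightarrow> 'b) \<Rightarrow> 'a mf \<Rightarrow> 'b mf" where
  "mf_map h M = MF (par M) (map_mat h (opr M))"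

definition theta_mf :: "'a::comm_ring_1 mf \<Rightarrow> 'a fps fps mf" where
  "theta_mf M = mf_tensor (mf_map const_xy (mf_swap M)) mf_xy"

definition theta_map :: "'a::comm_ring_1 mf \<Rightarrow> 'a mat \<Rightarrow> 'a fps fps mat" where
  "theta_map M f = koszul_tensor False (par (mf_swap M)) (map_mat const_xy f) (1\<^sub>m 2)"

text \<open>Interchanging the components of a form on $M$ leaves its matrix unchanged.\<close>

definition theta_form :: "'a::comm_ring_1 mf \<Rightarrow> 'a mat \<Rightarrow> 'a fps fps mat" where
  "theta_form M b = koszul_tensor True (par (mf_swap M)) (map_mat const_xy b) beta_xy"

definition theta_twisted_form :: "'a::comm_ring_1 mf \<Rightarrow> 'a mat \<Rightarrow> 'a fps fps mat" where
  "theta_twisted_form M q = koszul_tensor True (par (mf_swap M))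
     (map_mat const_xy (negate_even_cols (par M) q)) beta_xy"

definition theta_mor ::
    "'a::comm_ring_1 mf \<Rightarrow> 'a mf \<Rightarrow> 'a mat set \<Rightarrow> 'a fps fps mat set" where
  "theta_mor M M' F = (\<Union>f\<in>F. mor_class (theta_mf M) (theta_mf M') (theta_map M f))"

definition theta :: "('a::comm_ring_1 mf, 'a mat set, 'a fps fps mf, 'a fps fps mat set) fnctr" where
  "theta = \<lparr>on_obj = theta_mf, on_mor = theta_mor\<rparr>"

definition lift_functor :: "('o1, 'm1, 'o2, 'm2) fnctr \<Rightarrow> ('o1 \<Rightarrow> 's1 \<Rightarrow> 's2) \<Rightarrow>
    ('o1 \<times> 's1, 'm1, 'o2 \<times> 's2, 'm2) fnctr" where
  "lift_functor F t = \<lparr>on_obj = (\<lambda>X. (on_obj F (fst X), t (fst X) (snd X))),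
     on_mor = (\<lambda>X Y. on_mor F (fst X) (fst Y))\<rparr>"

end

theory Submission
  imports Defs Jordan_Normal_Form.Determinant
begin

text \<open>
  Let $E = (x, y)$, so that $\theta(M)$ is $M \otimes E$ up to a twist by signs. The proof has four parts.

  Full faithfulness (\<open>theta_faithful\<close>, \<open>theta_full\<close>). A map $\theta(M) \to \theta(M')$ is a matrix
  with two rows and two columns of blocks over $A[[x, y]]$. The constant term of its upper left block
  is a map $M \to M'$, and since $x, y$ is a regular sequence and $A[[x, y]] = A \oplus (x, y)$, this
  constant term determines a closed map up to homotopy.

  Retracts (\<open>theta_retract\<close>). Let $N$ be a factorization of $x y - \pi$ with operator $Q$. Differentiating
  $Q^2 = x y - \pi$ shows that the derivatives $a = \partial_x Q$ and $b = \partial_y Q$ at the origin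
  satisfy $a^2 = b^2 = 0$ and $a b + b a = 1$ up to homotopy on the factorization $N/(x, y)$ of $- \pi$
  over $A$. This Clifford algebra splits $N/(x, y)$ into two halves, and $\theta$ of one of them should be
  $N$. Explicit formulas, with divided differences in place of some of the derivatives, indeed exhibit
  $N$ as a retract of $\theta(N/(x, y))$ up to homotopy.

  Splitting (\<open>theta_essentially_surjective\<close>). By full faithfulness the retract corresponds to a homotopy
  idempotent in $\mathrm{MF}(\pi)$. Every factorization over the local ring $A$ is homotopy equivalent to a
  minimal one, whose operator has entries in the maximal ideal (\<open>minimal_model\<close>). On a minimal factorization
  the defect $g^2 - g$ of a homotopy idempotent is topologically nilpotent, so that a power series in it,
  which converges by completeness, turns $g$ into a strict idempotent (\<open>idempotent_lift\<close>). This one splits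
  off a direct summand, because projective modules over local rings are free (\<open>split_idempotent\<close>).

  Forms (\<open>gform_descends\<close>). As the form $\beta$ on $E$ is odd, tensoring with it exchanges the two dualities
  $M \mapsto M^T$ and $M \mapsto M^*$, and changes or preserves the symmetry of forms
  (\<open>theta_gform_is_gform\<close>). Morphisms ignore the forms, so it remains to see that $M$ carries a form of the
  right type whenever $\theta(M)$ is homotopy equivalent to some $N$ with a form. The form on $N$ yields an
  isomorphism of $M$ with its dual in the homotopy category which is symmetric up to homotopy; for
  minimal $M$ its symmetrization is an honest form.
\<close>

section \<open>Matrices\<close>

text \<open>
  Matrix identities are proved by normalising both sides with the ring laws and comparing entries;
  the entries of products have to stay opaque for this.
\<close>

declare index_mult_mat(1) [simp del]

text \<open>
  Side conditions that are equations between dimensions, rather than memberships in carrier sets,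
  make the ring laws usable as rewrite rules: no intermediate dimension has to be guessed.
\<close>

lemma mat_assoc:
  fixes A :: "'a::comm_ring_1 mat"
  assumes "dim_col A = dim_row B" "dim_col B = dim_row C"
  shows "A * B * C = A * (B * C)"
  by (rule assoc_mult_mat[of A "dim_row A" "dim_col A" B "dim_col B" C "dim_col C"]) (use assms in auto)

lemma mat_distl:
  fixes A :: "'a::comm_ring_1 mat"
  assumes "dim_col A = dim_row B" "dim_row C = dim_row B" "dim_col C = dim_col B"
  shows "A * (B + C) = A * B + A * C"
  by (rule mult_add_distrib_mat[of A "dim_row A" "dim_col A" B "dim_col B" C]) (use assms in auto)

lemma mat_distr:
  fixes A :: "'a::comm_ring_1 mat"
  assumes "dim_col A = dim_row C" "dim_row A = dim_row B" "dim_col A = dim_col B"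
  shows "(A + B) * C = A * C + B * C"
  by (rule add_mult_distrib_mat[of A "dim_row A" "dim_col A" B C "dim_col C"]) (use assms in auto)

lemma mat_diffl:
  fixes A :: "'a::comm_ring_1 mat"
  assumes "dim_col A = dim_row B" "dim_row C = dim_row B" "dim_col C = dim_col B"
  shows "A * (B - C) = A * B - A * C"
  by (rule mult_minus_distrib_mat[of A "dim_row A" "dim_col A" B "dim_col B" C]) (use assms in auto)

lemma mat_diffr:
  fixes A :: "'a::comm_ring_1 mat"
  assumes "dim_col A = dim_row C" "dim_row A = dim_row B" "dim_col A = dim_col B"
  shows "(A - B) * C = A * C - B * C"
  by (rule minus_mult_distrib_mat[of A "dim_row A" "dim_col A" B C "dim_col C"]) (use assms in auto)

lemma mat_smultl:
  fixes A :: "'a::comm_ring_1 mat"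
  assumes "dim_col A = dim_row B"
  shows "(k \<cdot>\<^sub>m A) * B = k \<cdot>\<^sub>m (A * B)"
  by (rule mult_smult_assoc_mat[of A "dim_row A" "dim_col A" B "dim_col B"]) (use assms in auto)

lemma mat_smultr:
  fixes A :: "'a::comm_ring_1 mat"
  assumes "dim_col A = dim_row B"
  shows "A * (k \<cdot>\<^sub>m B) = k \<cdot>\<^sub>m (A * B)"
  by (rule mult_smult_distrib[of A "dim_row A" "dim_col A" B "dim_col B"]) (use assms in auto)

lemma mat_smult_smult: "a \<cdot>\<^sub>m (b \<cdot>\<^sub>m (A :: 'a::comm_ring_1 mat)) = (a * b) \<cdot>\<^sub>m A"
  by (rule eq_matI) (auto simp: mult.assoc)

lemmas mat_ring = mat_assoc mat_distl mat_distr mat_diffl mat_diffr mat_smultl mat_smultr mat_smult_smult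

lemma four_mult:
  fixes A1 :: "'a::comm_ring_1 mat"
  assumes "dim_row B1 = dim_row A1" "dim_col C1 = dim_col A1" "dim_row D1 = dim_row C1" "dim_col D1 = dim_col B1"
    and "dim_row B2 = dim_row A2" "dim_col C2 = dim_col A2" "dim_row D2 = dim_row C2" "dim_col D2 = dim_col B2"
    and "dim_col A1 = dim_row A2" "dim_col B1 = dim_row C2"
  shows "four_block_mat A1 B1 C1 D1 * four_block_mat A2 B2 C2 D2
    = four_block_mat (A1 * A2 + B1 * C2) (A1 * B2 + B1 * D2) (C1 * A2 + D1 * C2) (C1 * B2 + D1 * D2)"
  by (rule mult_four_block_mat[of _ "dim_row A1" "dim_col A1" _ "dim_col B1" _ "dim_row C1" _ _ "dim_col A2" _ "dim_col B2"])
    (use assms in auto)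

lemma four_add:
  fixes A1 :: "'a::comm_ring_1 mat"
  assumes "dim_row B1 = dim_row A1" "dim_col C1 = dim_col A1" "dim_row D1 = dim_row C1" "dim_col D1 = dim_col B1"
    and "dim_row B2 = dim_row A2" "dim_col C2 = dim_col A2" "dim_row D2 = dim_row C2" "dim_col D2 = dim_col B2"
    and "dim_row A1 = dim_row A2" "dim_col A1 = dim_col A2" "dim_row D1 = dim_row D2" "dim_col D1 = dim_col D2"
  shows "four_block_mat A1 B1 C1 D1 + four_block_mat A2 B2 C2 D2
    = four_block_mat (A1 + A2) (B1 + B2) (C1 + C2) (D1 + D2)"
  by (rule add_four_block_mat[of _ "dim_row A1" "dim_col A1" _ "dim_col B1" _ "dim_row C1"])
    (use assms in auto)

lemma four_transpose:
  assumes "dim_row B1 = dim_row A1" "dim_col C1 = dim_col A1" "dim_row D1 = dim_row C1" "dim_col D1 = dim_col B1"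
  shows "transpose_mat (four_block_mat A1 B1 C1 D1)
    = four_block_mat (transpose_mat A1) (transpose_mat C1) (transpose_mat B1) (transpose_mat D1)"
  by (rule transpose_four_block_mat[of _ "dim_row A1" "dim_col A1" _ "dim_col B1" _ "dim_row C1"])
    (use assms in auto)

lemma four_uminus:
  fixes A1 :: "'a::comm_ring_1 mat"
  assumes "dim_row B1 = dim_row A1" "dim_col C1 = dim_col A1" "dim_row D1 = dim_row C1" "dim_col D1 = dim_col B1"
  shows "- four_block_mat A1 B1 C1 D1 = four_block_mat (- A1) (- B1) (- C1) (- D1)"
  by (rule eq_matI) (use assms in auto)

lemma four_minus:
  fixes A1 :: "'a::comm_ring_1 mat"
  assumes "dim_row B1 = dim_row A1" "dim_col C1 = dim_col A1" "dim_row D1 = dim_row C1" "dim_col D1 = dim_col B1"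
    and "dim_row B2 = dim_row A2" "dim_col C2 = dim_col A2" "dim_row D2 = dim_row C2" "dim_col D2 = dim_col B2"
    and "dim_row A1 = dim_row A2" "dim_col A1 = dim_col A2" "dim_row D1 = dim_row D2" "dim_col D1 = dim_col D2"
  shows "four_block_mat A1 B1 C1 D1 - four_block_mat A2 B2 C2 D2
    = four_block_mat (A1 - A2) (B1 - B2) (C1 - C2) (D1 - D2)"
  by (rule eq_matI) (use assms in auto)

lemma four_smult:
  fixes A1 :: "'a::comm_ring_1 mat"
  assumes "dim_row B1 = dim_row A1" "dim_col C1 = dim_col A1" "dim_row D1 = dim_row C1" "dim_col D1 = dim_col B1"
  shows "k \<cdot>\<^sub>m four_block_mat A1 B1 C1 D1 = four_block_mat (k \<cdot>\<^sub>m A1) (k \<cdot>\<^sub>m B1) (k \<cdot>\<^sub>m C1) (k \<cdot>\<^sub>m D1)"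
  by (rule eq_matI) (use assms in auto)

lemmas four_simps = four_mult four_add four_uminus four_minus four_smult four_transpose

lemma four_eqD:
  assumes "four_block_mat A1 B1 C1 D1 = four_block_mat A2 B2 C2 D2"
    and "dim_row B1 = dim_row A1" "dim_col C1 = dim_col A1" "dim_row D1 = dim_row C1" "dim_col D1 = dim_col B1"
    and "dim_row B2 = dim_row A2" "dim_col C2 = dim_col A2" "dim_row D2 = dim_row C2" "dim_col D2 = dim_col B2"
    and "dim_row A1 = dim_row A2" "dim_col A1 = dim_col A2" "dim_row D1 = dim_row D2" "dim_col D1 = dim_col D2"
  shows "A1 = A2" "B1 = B2" "C1 = C2" "D1 = D2"
proof -
  have e: "four_block_mat A1 B1 C1 D1 $$ (i, j) = four_block_mat A2 B2 C2 D2 $$ (i, j)" for i j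
    using assms(1) by simp
  show "A1 = A2"
  proof (rule eq_matI)
    fix i j assume "i < dim_row A2" "j < dim_col A2"
    then show "A1 $$ (i, j) = A2 $$ (i, j)" using e[of i j] assms(2-) by simp
  qed (use assms(2-) in auto)
  show "B1 = B2"
  proof (rule eq_matI)
    fix i j assume "i < dim_row B2" "j < dim_col B2"
    then show "B1 $$ (i, j) = B2 $$ (i, j)" using e[of i "j + dim_col A1"] assms(2-) by simp
  qed (use assms(2-) in auto)
  show "C1 = C2"
  proof (rule eq_matI)
    fix i j assume "i < dim_row C2" "j < dim_col C2"
    then show "C1 $$ (i, j) = C2 $$ (i, j)" using e[of "i + dim_row A1" "j"] assms(2-) by simp
  qed (use assms(2-) in auto)
  show "D1 = D2"
  proof (rule eq_matI)
    fix i j assume "i < dim_row D2" "j < dim_col D2"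
    then show "D1 $$ (i, j) = D2 $$ (i, j)" using e[of "i + dim_row A1" "j + dim_col A1"] assms(2-) by simp
  qed (use assms(2-) in auto)
qed

section \<open>Graded maps and homotopies\<close>

lemma graded_dim [simp]:
  assumes "f \<in> graded_maps p M M'"
  shows "dim_row f = rank M'" "dim_col f = rank M"
  using assms by (auto simp: graded_maps_def)

lemma graded_carrier: "f \<in> graded_maps p M M' \<Longrightarrow> f \<in> carrier_mat (rank M') (rank M)"
  by (simp add: graded_maps_def)

lemma gradedI:
  assumes "dim_row f = rank M'" "dim_col f = rank M"
    and "\<And>i j. i < rank M' \<Longrightarrow> j < rank M \<Longrightarrow> f $$ (i, j) \<noteq> 0 \<Longrightarrow> (par M' ! i \<noteq> par M ! j) = p"
  shows "f \<in> graded_maps p M M'"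
  using assms by (auto simp: graded_maps_def)

lemma gradedD:
  assumes "f \<in> graded_maps p M M'" "i < rank M'" "j < rank M" "f $$ (i, j) \<noteq> 0"
  shows "(par M' ! i \<noteq> par M ! j) = p"
  using assms by (auto simp: graded_maps_def)

lemma graded_mult:
  fixes f g :: "'a::comm_ring_1 mat"
  assumes f: "f \<in> graded_maps p M M'" and g: "g \<in> graded_maps q M' M''"
  shows "g * f \<in> graded_maps (p \<noteq> q) M M''"
proof (rule gradedI)
  fix i j assume ij: "i < rank M''" "j < rank M" and nz: "(g * f) $$ (i, j) \<noteq> 0"
  have "(g * f) $$ (i, j) = (\<Sum>k\<in>{0..<rank M'}. g $$ (i, k) * f $$ (k, j))"
    using f g ij by (simp add: index_mult_mat scalar_prod_def)
  with nz obtain k where k: "k < rank M'" "g $$ (i, k) * f $$ (k, j) \<noteq> 0"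
    by (metis (no_types, lifting) atLeastLessThan_iff sum.not_neutral_contains_not_neutral)
  then have "g $$ (i, k) \<noteq> 0" "f $$ (k, j) \<noteq> 0" by auto
  with gradedD[OF g ij(1) k(1)] gradedD[OF f k(1) ij(2)]
  show "(par M'' ! i \<noteq> par M ! j) = (p \<noteq> q)" by auto
qed (use f g in auto)

lemma graded_mult_even: "f \<in> graded_maps False M M' \<Longrightarrow> g \<in> graded_maps q M' M'' \<Longrightarrow> (g * f :: 'a::comm_ring_1 mat) \<in> graded_maps q M M''"
  using graded_mult[of f False M M' g q M''] by simp

lemma graded_mult_odd: "f \<in> graded_maps True M M' \<Longrightarrow> g \<in> graded_maps q M' M'' \<Longrightarrow> (g * f :: 'a::comm_ring_1 mat) \<in> graded_maps (\<not> q) M M''"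
  using graded_mult[of f True M M' g q M''] by simp

lemma graded_add:
  fixes f g :: "'a::comm_ring_1 mat"
  assumes f: "f \<in> graded_maps p M M'" and g: "g \<in> graded_maps p M M'"
  shows "f + g \<in> graded_maps p M M'"
proof (rule gradedI)
  fix i j assume ij: "i < rank M'" "j < rank M" and nz: "(f + g) $$ (i, j) \<noteq> 0"
  then have "f $$ (i, j) \<noteq> 0 \<or> g $$ (i, j) \<noteq> 0" using f g by auto
  then show "(par M' ! i \<noteq> par M ! j) = p" using gradedD[OF f ij] gradedD[OF g ij] by blast
qed (use f g in auto)

lemma graded_uminus:
  fixes f :: "'a::comm_ring_1 mat"
  assumes f: "f \<in> graded_maps p M M'"
  shows "- f \<in> graded_maps p M M'"
proof (rule gradedI)
  fix i j assume ij: "i < rank M'" "j < rank M" and nz: "(- f) $$ (i, j) \<noteq> 0"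
  then have "f $$ (i, j) \<noteq> 0" using f by auto
  then show "(par M' ! i \<noteq> par M ! j) = p" using gradedD[OF f ij] by blast
qed (use f in auto)

lemma graded_minus:
  fixes f g :: "'a::comm_ring_1 mat"
  assumes f: "f \<in> graded_maps p M M'" and g: "g \<in> graded_maps p M M'"
  shows "f - g \<in> graded_maps p M M'"
proof -
  have "f - g = f + - g" using f g by (auto intro!: eq_matI)
  then show ?thesis using graded_add[OF f graded_uminus[OF g]] by simp
qed

lemma graded_smult:
  fixes f :: "'a::comm_ring_1 mat"
  assumes f: "f \<in> graded_maps p M M'"
  shows "c \<cdot>\<^sub>m f \<in> graded_maps p M M'"
proof (rule gradedI)
  fix i j assume ij: "i < rank M'" "j < rank M" and nz: "(c \<cdot>\<^sub>m f) $$ (i, j) \<noteq> 0"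
  then have "f $$ (i, j) \<noteq> 0" using f by auto
  then show "(par M' ! i \<noteq> par M ! j) = p" using gradedD[OF f ij] by blast
qed (use f in auto)

lemma graded_zero: "0\<^sub>m (rank M') (rank M) \<in> graded_maps p M M'"
  by (rule gradedI) auto

lemma graded_one: "1\<^sub>m (rank M) \<in> graded_maps False M M"
  by (rule gradedI) (auto split: if_splits)

lemma is_mfD:
  assumes "is_mf w M"
  shows "opr M \<in> graded_maps True M M" "opr M * opr M = w \<cdot>\<^sub>m 1\<^sub>m (rank M)"
    "dim_row (opr M) = rank M" "dim_col (opr M) = rank M"
  using assms by (auto simp: is_mf_def graded_maps_def)

abbreviation htp :: "'a::comm_ring_1 mf \<Rightarrow> 'a mf \<Rightarrow> 'a mat \<Rightarrow> 'a mat \<Rightarrow> bool" where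
  "htp M M' f g \<equiv> (f, g) \<in> homotopic False M M'"

abbreviation chain_maps :: "'a::comm_ring_1 mf \<Rightarrow> 'a mf \<Rightarrow> 'a mat set" where
  "chain_maps \<equiv> cocycles False"

lemma minus_mat_eq_0_iff:
  fixes A :: "'a::comm_ring_1 mat"
  assumes "dim_row A = dim_row B" "dim_col A = dim_col B" "dim_row A = m" "dim_col A = n"
  shows "A - B = 0\<^sub>m m n \<longleftrightarrow> A = B"
proof
  assume e: "A - B = 0\<^sub>m m n"
  show "A = B"
  proof (rule eq_matI)
    fix i j assume ij: "i < dim_row B" "j < dim_col B"
    have "(A - B) $$ (i, j) = 0" using e ij assms by simp
    then show "A $$ (i, j) = B $$ (i, j)" using ij by simp
  qed (use assms in auto)
qed (use assms in \<open>auto intro!: eq_matI\<close>)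

lemma one_smult_mat [simp]: "1 \<cdot>\<^sub>m (A :: 'a::comm_ring_1 mat) = A"
  by (rule eq_matI) auto

lemma minus_one_smult_mat [simp]: "(- 1) \<cdot>\<^sub>m (A :: 'a::comm_ring_1 mat) = - A"
  by (rule eq_matI) auto

lemma chain_iff:
  assumes "is_mf w M" "is_mf w' M'"
  shows "f \<in> chain_maps M M' \<longleftrightarrow> f \<in> graded_maps False M M' \<and> opr M' * f = f * opr M"
  using is_mfD[OF assms(1)] is_mfD[OF assms(2)]
  by (auto simp: cocycles_def hom_diff_def minus_mat_eq_0_iff)

lemma chainD:
  assumes "f \<in> chain_maps M M'"
  shows "f \<in> graded_maps False M M'" "dim_row f = rank M'" "dim_col f = rank M"
  using assms by (auto simp: cocycles_def)

lemma mat_diff_eq_iff: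
  fixes A B C :: "'a::comm_ring_1 mat"
  assumes "dim_row A = dim_row B" "dim_col A = dim_col B" "dim_row C = dim_row B" "dim_col C = dim_col B"
  shows "A - B = C \<longleftrightarrow> A = B + C"
proof
  assume e: "A - B = C"
  show "A = B + C" by (rule eq_matI) (use e assms in auto)
next
  assume e: "A = B + C"
  show "A - B = C" by (rule eq_matI) (use e assms in auto)
qed

lemma htp_iff:
  assumes "is_mf w M" "is_mf w' M'"
  shows "htp M M' f g \<longleftrightarrow> f \<in> chain_maps M M' \<and> g \<in> chain_maps M M' \<and>
    (\<exists>h\<in>graded_maps True M M'. f = g + (opr M' * h + h * opr M))"
proof -
  have "f - g = hom_diff True M M' h \<longleftrightarrow> f = g + (opr M' * h + h * opr M)"
    if "f \<in> chain_maps M M'" "g \<in> chain_maps M M'" "h \<in> graded_maps True M M'" for h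
  proof -
    have "hom_diff True M M' h = opr M' * h + h * opr M"
      unfolding hom_diff_def
      by (rule eq_matI) (use that is_mfD[OF assms(1)] is_mfD[OF assms(2)] in \<open>auto\<close>)
    then show ?thesis
      using that is_mfD[OF assms(1)] is_mfD[OF assms(2)]
      by (subst mat_diff_eq_iff) (auto simp: chainD)
  qed
  then show ?thesis by (auto simp: homotopic_def)
qed

lemma htpD: "htp M M' f g \<Longrightarrow> f \<in> chain_maps M M'" "htp M M' f g \<Longrightarrow> g \<in> chain_maps M M'"
  by (auto simp: homotopic_def)

lemma chain_mult:
  assumes "is_mf w M" "is_mf w M'" "is_mf w M''"
    and f: "f \<in> chain_maps M M'" and g: "g \<in> chain_maps M' M''"
  shows "g * f \<in> chain_maps M M''"
proof -
  note mf = is_mfD[OF assms(1)] is_mfD[OF assms(2)] is_mfD[OF assms(3)]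
  note c = chainD[OF f] chainD[OF g]
  have fe: "opr M' * f = f * opr M" and ge: "opr M'' * g = g * opr M'"
    using f g assms by (auto simp: chain_iff)
  have "opr M'' * (g * f) = (opr M'' * g) * f" using mf c by (simp add: mat_assoc)
  also have "\<dots> = g * (opr M' * f)" using mf c by (simp add: ge mat_assoc)
  also have "\<dots> = g * f * opr M" using mf c by (simp add: fe mat_assoc)
  finally show ?thesis
    using graded_mult_even[OF c(1) c(4)] by (simp add: chain_iff[OF assms(1,3)])
qed

lemma chain_inverse:
  assumes mfs: "is_mf w M" "is_mf w' M'" and q: "q \<in> chain_maps M M'" and c: "c \<in> graded_maps False M' M"
    and cq: "c * q = 1\<^sub>m (rank M)" and qc: "q * c = 1\<^sub>m (rank M')"
  shows "c \<in> chain_maps M' M"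
proof -
  note mf = is_mfD[OF mfs(1)] is_mfD[OF mfs(2)] and d = chainD[OF q] graded_dim[OF c]
  have e: "opr M' * q = q * opr M" using q mfs by (simp add: chain_iff)
  have "c * opr M' = c * ((opr M' * q) * c)" using mf d by (simp add: mat_assoc qc)
  also have "\<dots> = (c * q) * (opr M * c)" unfolding e using mf d by (simp add: mat_assoc)
  also have "\<dots> = opr M * c" unfolding cq using mf d by simp
  finally show ?thesis using c by (simp add: chain_iff[OF mfs(2,1)])
qed

lemma chain_one: "is_mf w M \<Longrightarrow> 1\<^sub>m (rank M) \<in> chain_maps M M"
  using is_mfD[of w M] by (simp add: chain_iff graded_one)

lemma chain_add:
  assumes "is_mf w M" "is_mf w' M'" and f: "f \<in> chain_maps M M'" and g: "g \<in> chain_maps M M'"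
  shows "f + g \<in> chain_maps M M'"
proof -
  have "opr M' * f = f * opr M" "opr M' * g = g * opr M" using assms by (auto simp: chain_iff)
  then show ?thesis
    using is_mfD[OF assms(1)] is_mfD[OF assms(2)] chainD[OF f] chainD[OF g] graded_add[of f False M M' g]
    by (simp add: chain_iff[OF assms(1,2)] mat_ring)
qed

lemma chain_smult:
  assumes "is_mf w M" "is_mf w' M'" and f: "f \<in> chain_maps M M'"
  shows "c \<cdot>\<^sub>m f \<in> chain_maps M M'"
proof -
  have "opr M' * f = f * opr M" using assms by (auto simp: chain_iff)
  then show ?thesis
    using is_mfD[OF assms(1)] is_mfD[OF assms(2)] chainD[OF f] graded_smult[of f False M M' c]
    by (simp add: chain_iff[OF assms(1,2)] mat_ring)
qed

lemma chain_minus: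
  assumes "is_mf w M" "is_mf w' M'" and f: "f \<in> chain_maps M M'" and g: "g \<in> chain_maps M M'"
  shows "f - g \<in> chain_maps M M'"
proof -
  have "opr M' * f = f * opr M" "opr M' * g = g * opr M" using assms by (auto simp: chain_iff)
  then show ?thesis
    using is_mfD[OF assms(1)] is_mfD[OF assms(2)] chainD[OF f] chainD[OF g] graded_minus[of f False M M' g]
    by (simp add: chain_iff[OF assms(1,2)] mat_ring)
qed

lemma htpI:
  assumes "is_mf w M" "is_mf w' M'" and "f \<in> chain_maps M M'" "g \<in> chain_maps M M'"
    and "h \<in> graded_maps True M M'" "f = g + (opr M' * h + h * opr M)"
  shows "htp M M' f g"
  using assms by (auto simp: htp_iff)

lemma htpE:
  assumes "is_mf w M" "is_mf w' M'" "htp M M' f g"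
  obtains h where "h \<in> graded_maps True M M'" "f = g + (opr M' * h + h * opr M)"
  using assms by (auto simp: htp_iff)

lemma htp_refl:
  assumes "is_mf w M" "is_mf w' M'" "f \<in> chain_maps M M'"
  shows "htp M M' f f"
  by (rule htpI[OF assms(1,2,3,3) graded_zero])
    (use assms is_mfD[OF assms(1)] is_mfD[OF assms(2)] chainD[OF assms(3)] in \<open>auto intro!: eq_matI\<close>)

lemma htp_sym:
  assumes "is_mf w M" "is_mf w' M'" "htp M M' f g"
  shows "htp M M' g f"
proof -
  note mf = is_mfD[OF assms(1)] is_mfD[OF assms(2)]
  note d = chainD[OF htpD(1)[OF assms(3)]] chainD[OF htpD(2)[OF assms(3)]]
  obtain h where h: "h \<in> graded_maps True M M'" "f = g + (opr M' * h + h * opr M)"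
    using htpE[OF assms] .
  show ?thesis
  proof (rule htpI[OF assms(1,2) htpD(2)[OF assms(3)] htpD(1)[OF assms(3)] graded_uminus[OF h(1)]])
    show "g = f + (opr M' * - h + - h * opr M)"
      unfolding h(2) by (rule eq_matI) (use mf h(1) d in \<open>auto\<close>)
  qed
qed

lemma htp_trans:
  assumes "is_mf w M" "is_mf w' M'" "htp M M' f g" "htp M M' g k"
  shows "htp M M' f k"
proof -
  note mf = is_mfD[OF assms(1)] is_mfD[OF assms(2)]
  note d = chainD[OF htpD(1)[OF assms(3)]] chainD[OF htpD(2)[OF assms(3)]] chainD[OF htpD(2)[OF assms(4)]]
  obtain h where h: "h \<in> graded_maps True M M'" "f = g + (opr M' * h + h * opr M)"
    using htpE[OF assms(1,2,3)] .
  obtain h' where h': "h' \<in> graded_maps True M M'" "g = k + (opr M' * h' + h' * opr M)"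
    using htpE[OF assms(1,2,4)] .
  show ?thesis
  proof (rule htpI[OF assms(1,2) htpD(1)[OF assms(3)] htpD(2)[OF assms(4)] graded_add[OF h(1) h'(1)]])
    show "f = k + (opr M' * (h + h') + (h + h') * opr M)"
      unfolding h(2) unfolding h'(2)
      by (rule eq_matI) (use mf h(1) h'(1) d in \<open>auto simp: mat_ring\<close>)
  qed
qed

lemma htp_mult_left:
  assumes mfs: "is_mf w M" "is_mf w M'" "is_mf w M''" and f: "htp M M' f f'" and g: "g \<in> chain_maps M' M''"
  shows "htp M M'' (g * f) (g * f')"
proof -
  note mf = is_mfD[OF mfs(1)] is_mfD[OF mfs(2)] is_mfD[OF mfs(3)]
  note d = chainD[OF htpD(1)[OF f]] chainD[OF htpD(2)[OF f]] chainD[OF g]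
  have ge: "opr M'' * g = g * opr M'" using g mfs by (auto simp: chain_iff)
  obtain h where h: "h \<in> graded_maps True M M'" "f = f' + (opr M' * h + h * opr M)"
    using htpE[OF mfs(1,2) f] .
  show ?thesis
  proof (rule htpI[OF mfs(1,3) chain_mult[OF mfs htpD(1)[OF f] g] chain_mult[OF mfs htpD(2)[OF f] g]])
    show "g * h \<in> graded_maps True M M''" using graded_mult_odd[OF h(1) d(7)] by simp
    have "opr M'' * (g * h) = (opr M'' * g) * h" using mf h(1) d by (simp add: mat_assoc)
    also have "\<dots> = g * (opr M' * h)" using mf h(1) d by (simp add: ge mat_assoc)
    finally have e: "opr M'' * (g * h) = g * (opr M' * h)" .
    show "g * f = g * f' + (opr M'' * (g * h) + g * h * opr M)"
      unfolding e h(2) using mf h(1) d by (simp add: mat_ring)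
  qed
qed

lemma htp_mult_right:
  assumes mfs: "is_mf w M" "is_mf w M'" "is_mf w M''" and f: "f \<in> chain_maps M M'" and g: "htp M' M'' g g'"
  shows "htp M M'' (g * f) (g' * f)"
proof -
  note mf = is_mfD[OF mfs(1)] is_mfD[OF mfs(2)] is_mfD[OF mfs(3)]
  note d = chainD[OF htpD(1)[OF g]] chainD[OF htpD(2)[OF g]] chainD[OF f]
  have fe: "opr M' * f = f * opr M" using f mfs by (auto simp: chain_iff)
  obtain h where h: "h \<in> graded_maps True M' M''" "g = g' + (opr M'' * h + h * opr M')"
    using htpE[OF mfs(2,3) g] .
  show ?thesis
  proof (rule htpI[OF mfs(1,3) chain_mult[OF mfs f htpD(1)[OF g]] chain_mult[OF mfs f htpD(2)[OF g]]])
    show "h * f \<in> graded_maps True M M''" using graded_mult_even[OF d(7) h(1)] by simp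
    show "g * f = g' * f + (opr M'' * (h * f) + h * f * opr M)"
      unfolding h(2) using mf h(1) d by (simp add: mat_ring fe)
  qed
qed

lemma htp_mult:
  assumes mfs: "is_mf w M" "is_mf w M'" "is_mf w M''" and f: "htp M M' f f'" and g: "htp M' M'' g g'"
  shows "htp M M'' (g * f) (g' * f')"
  by (rule htp_trans[OF mfs(1,3) htp_mult_left[OF mfs f htpD(1)[OF g]] htp_mult_right[OF mfs htpD(2)[OF f] g]])

lemma htp_add:
  assumes mfs: "is_mf w M" "is_mf w' M'" and f: "htp M M' f f'" and g: "htp M M' g g'"
  shows "htp M M' (f + g) (f' + g')"
proof -
  note mf = is_mfD[OF mfs(1)] is_mfD[OF mfs(2)]
  note d = chainD[OF htpD(1)[OF f]] chainD[OF htpD(2)[OF f]] chainD[OF htpD(1)[OF g]] chainD[OF htpD(2)[OF g]]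
  obtain h where h: "h \<in> graded_maps True M M'" "f = f' + (opr M' * h + h * opr M)"
    using htpE[OF mfs f] .
  obtain h' where h': "h' \<in> graded_maps True M M'" "g = g' + (opr M' * h' + h' * opr M)"
    using htpE[OF mfs g] .
  show ?thesis
  proof (rule htpI[OF mfs _ _ graded_add[OF h(1) h'(1)]])
    show "f + g = f' + g' + (opr M' * (h + h') + (h + h') * opr M)"
      unfolding h(2) h'(2)
      by (rule eq_matI) (use mf h(1) h'(1) d in \<open>auto simp: mat_ring\<close>)
  qed (use mfs f g htpD in \<open>auto intro!: chain_add\<close>)
qed

lemma htp_smult:
  assumes mfs: "is_mf w M" "is_mf w' M'" and f: "htp M M' f f'"
  shows "htp M M' (c \<cdot>\<^sub>m f) (c \<cdot>\<^sub>m f')"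
proof -
  note mf = is_mfD[OF mfs(1)] is_mfD[OF mfs(2)]
  note d = chainD[OF htpD(1)[OF f]] chainD[OF htpD(2)[OF f]]
  obtain h where h: "h \<in> graded_maps True M M'" "f = f' + (opr M' * h + h * opr M)"
    using htpE[OF mfs f] .
  show ?thesis
  proof (rule htpI[OF mfs _ _ graded_smult[OF h(1)]])
    show "c \<cdot>\<^sub>m f = c \<cdot>\<^sub>m f' + (opr M' * (c \<cdot>\<^sub>m h) + c \<cdot>\<^sub>m h * opr M)"
      unfolding h(2)
      by (rule eq_matI) (use mf h(1) d in \<open>auto simp: mat_ring distrib_left\<close>)
  qed (use mfs f htpD in \<open>auto intro!: chain_smult\<close>)
qed

section \<open>The homotopy category\<close>

lemma equiv_homotopic:
  assumes "is_mf w M" "is_mf w' M'"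
  shows "equiv (chain_maps M M') (homotopic False M M')"
proof (rule equivI)
  show "homotopic False M M' \<subseteq> chain_maps M M' \<times> chain_maps M M'"
    by (auto simp: homotopic_def)
  show "refl_on (chain_maps M M') (homotopic False M M')"
    using htp_refl[OF assms] by (auto simp: refl_on_def)
  show "sym (homotopic False M M')" using htp_sym[OF assms] by (auto intro!: symI)
  show "trans (homotopic False M M')" using htp_trans[OF assms] by (auto intro!: transI)
qed

lemma mor_class_eq_iff:
  assumes "is_mf w M" "is_mf w' M'" "f \<in> chain_maps M M'" "g \<in> chain_maps M M'"
  shows "mor_class M M' f = mor_class M M' g \<longleftrightarrow> htp M M' f g"
  using eq_equiv_class_iff[OF equiv_homotopic[OF assms(1,2)] assms(3,4)] .

lemma Ext_iff: "F \<in> Ext False M M' \<longleftrightarrow> (\<exists>f\<in>chain_maps M M'. F = mor_class M M' f)"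
  by (auto simp: Ext_def quotient_def)

lemma mor_class_mem:
  assumes "is_mf w M" "is_mf w' M'" "f \<in> chain_maps M M'"
  shows "f \<in> mor_class M M' f"
  using htp_refl[OF assms] by simp

lemma class_comp:
  assumes mfs: "is_mf w L" "is_mf w M" "is_mf w N" and f: "f \<in> chain_maps L M" and g: "g \<in> chain_maps M N"
  shows "Comp (MF_cat w) L M N (mor_class M N g) (mor_class L M f) = mor_class L N (g * f)"
proof -
  have "mor_class L N (g' * f') = mor_class L N (g * f)" if "htp M N g g'" "htp L M f f'" for f' g'
    using htp_sym[OF mfs(1,3) htp_mult[OF mfs that(2,1)]] htp_mult[OF mfs that(2,1)]
    by (subst mor_class_eq_iff[OF mfs(1,3)]) (auto dest: htpD)
  then have "(\<Union>g'\<in>mor_class M N g. \<Union>f'\<in>mor_class L M f. mor_class L N (g' * f')) = mor_class L N (g * f)"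
    using mor_class_mem[OF mfs(1,2) f] mor_class_mem[OF mfs(2,3) g] by blast
  then show ?thesis by (simp add: MF_cat_def)
qed

lemma MF_cat_simps:
  "M \<in> Obj (MF_cat w) \<longleftrightarrow> is_mf w M"
  "Hom (MF_cat w) M N = Ext False M N"
  "Ident (MF_cat w) M = mor_class M M (1\<^sub>m (rank M))"
  by (auto simp: MF_cat_def)

lemma category_MF: "category (MF_cat w)"
proof
  fix X assume "X \<in> Obj (MF_cat w)"
  then show "Ident (MF_cat w) X \<in> Hom (MF_cat w) X X"
    using chain_one by (auto simp: MF_cat_simps Ext_iff)
next
  fix X Y Z f g
  assume mfs: "X \<in> Obj (MF_cat w)" "Y \<in> Obj (MF_cat w)" "Z \<in> Obj (MF_cat w)"
    and "f \<in> Hom (MF_cat w) X Y" "g \<in> Hom (MF_cat w) Y Z"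
  then obtain f' g' where *: "f' \<in> chain_maps X Y" "f = mor_class X Y f'"
    "g' \<in> chain_maps Y Z" "g = mor_class Y Z g'"
    by (auto simp: MF_cat_simps Ext_iff)
  note m = mfs[unfolded MF_cat_simps]
  show "Comp (MF_cat w) X Y Z g f \<in> Hom (MF_cat w) X Z"
    unfolding *(2,4) class_comp[OF m *(1,3)] MF_cat_simps Ext_iff using chain_mult[OF m *(1,3)] by blast
next
  fix X Y f
  assume mfs: "X \<in> Obj (MF_cat w)" "Y \<in> Obj (MF_cat w)" and "f \<in> Hom (MF_cat w) X Y"
  then obtain f' where *: "f' \<in> chain_maps X Y" "f = mor_class X Y f'"
    by (auto simp: MF_cat_simps Ext_iff)
  note m = mfs[unfolded MF_cat_simps]
  show "Comp (MF_cat w) X X Y f (Ident (MF_cat w) X) = f"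
    "Comp (MF_cat w) X Y Y (Ident (MF_cat w) Y) f = f"
    unfolding *(2) MF_cat_simps class_comp[OF m(1,1,2) chain_one[OF m(1)] *(1)]
      class_comp[OF m(1,2,2) *(1) chain_one[OF m(2)]]
    using chainD[OF *(1)] by simp_all
next
  fix W X Y Z f g h
  assume mfs: "W \<in> Obj (MF_cat w)" "X \<in> Obj (MF_cat w)" "Y \<in> Obj (MF_cat w)" "Z \<in> Obj (MF_cat w)"
    and "f \<in> Hom (MF_cat w) W X" "g \<in> Hom (MF_cat w) X Y" "h \<in> Hom (MF_cat w) Y Z"
  then obtain f' g' h' where *: "f' \<in> chain_maps W X" "f = mor_class W X f'"
    "g' \<in> chain_maps X Y" "g = mor_class X Y g'" "h' \<in> chain_maps Y Z" "h = mor_class Y Z h'"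
    by (auto simp: MF_cat_simps Ext_iff)
  note m = mfs[unfolded MF_cat_simps]
  note c = chain_mult[OF m(1,2,3) *(1,3)] chain_mult[OF m(2,3,4) *(3,5)]
  show "Comp (MF_cat w) W Y Z h (Comp (MF_cat w) W X Y g f)
    = Comp (MF_cat w) W X Z (Comp (MF_cat w) X Y Z h g) f"
    unfolding *(2,4,6) class_comp[OF m(1,2,3) *(1,3)] class_comp[OF m(2,3,4) *(3,5)]
      class_comp[OF m(1,3,4) c(1) *(5)] class_comp[OF m(1,2,4) *(1) c(2)]
    using chainD[OF *(1)] chainD[OF *(3)] chainD[OF *(5)] by (simp add: mat_assoc)
qed

text \<open>The data of an isomorphism in the homotopy category.\<close>

definition htp_equiv :: "'a::comm_ring_1 mf \<Rightarrow> 'a mf \<Rightarrow> 'a mat \<Rightarrow> 'a mat \<Rightarrow> bool" where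
  "htp_equiv M M' f g \<longleftrightarrow> f \<in> chain_maps M M' \<and> g \<in> chain_maps M' M \<and>
     htp M M (g * f) (1\<^sub>m (rank M)) \<and> htp M' M' (f * g) (1\<^sub>m (rank M'))"

lemma htp_equiv_sym: "htp_equiv M M' f g \<Longrightarrow> htp_equiv M' M g f"
  by (auto simp: htp_equiv_def)

lemma htp_equiv_trans:
  assumes mfs: "is_mf w M" "is_mf w M'" "is_mf w M''" and 1: "htp_equiv M M' f g" and 2: "htp_equiv M' M'' f' g'"
  shows "htp_equiv M M'' (f' * f) (g * g')"
proof -
  have *: "htp M M (g * g' * (f' * f)) (1\<^sub>m (rank M))"
    if mfs: "is_mf w M" "is_mf w M'" "is_mf w M''" and 1: "htp_equiv M M' f g" and 2: "htp_equiv M' M'' f' g'" for M M' M'' f f' g g'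
  proof -
    note c = 1[unfolded htp_equiv_def] 2[unfolded htp_equiv_def]
    note d = chainD[OF conjunct1[OF c(1)]] chainD[OF conjunct1[OF conjunct2[OF c(1)]]]
      chainD[OF conjunct1[OF c(2)]] chainD[OF conjunct1[OF conjunct2[OF c(2)]]]
    have "htp M M' (g' * f' * f) (1\<^sub>m (rank M') * f)"
      by (rule htp_mult_right[OF mfs(1,2,2)]) (use c in auto)
    then have "htp M M' (g' * f' * f) f" using d by simp
    then have "htp M M (g * (g' * f' * f)) (g * f)"
      by (intro htp_mult_left[OF mfs(1,2,1)]) (use c in auto)
    moreover have "g * (g' * f' * f) = g * g' * (f' * f)" using d by (simp add: mat_assoc)
    ultimately show ?thesis using htp_trans[OF mfs(1,1)] c by metis
  qed
  have "htp M'' M'' (f' * f * (g * g')) (1\<^sub>m (rank M''))"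
    by (rule *[OF mfs(3,2,1) htp_equiv_sym[OF 2] htp_equiv_sym[OF 1]])
  moreover note *[OF mfs 1 2]
  ultimately show ?thesis
    using 1 2 chain_mult[OF mfs, of f f'] chain_mult[OF mfs(3,2,1), of g' g] by (auto simp: htp_equiv_def)
qed

lemma isomorphism_MF_iff:
  assumes mfs: "is_mf w M" "is_mf w N"
  shows "isomorphism (MF_cat w) M N F \<longleftrightarrow> (\<exists>f g. htp_equiv M N f g \<and> F = mor_class M N f)"
proof
  assume "isomorphism (MF_cat w) M N F"
  then obtain f g where *: "f \<in> chain_maps M N" "F = mor_class M N f" "g \<in> chain_maps N M"
    "Comp (MF_cat w) M N M (mor_class N M g) (mor_class M N f) = mor_class M M (1\<^sub>m (rank M))"
    "Comp (MF_cat w) N M N (mor_class M N f) (mor_class N M g) = mor_class N N (1\<^sub>m (rank N))"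
    by (auto simp: isomorphism_def MF_cat_simps Ext_iff)
  have "htp_equiv M N f g"
    unfolding htp_equiv_def using *
    by (auto simp: class_comp mfs mor_class_eq_iff[OF mfs(1,1)] mor_class_eq_iff[OF mfs(2,2)]
      chain_one[OF mfs(1)] chain_one[OF mfs(2)] chain_mult[OF mfs mfs(1)] chain_mult[OF mfs(2,1,2)])
  with *(2) show "\<exists>f g. htp_equiv M N f g \<and> F = mor_class M N f" by auto
next
  assume "\<exists>f g. htp_equiv M N f g \<and> F = mor_class M N f"
  then obtain f g where *: "htp_equiv M N f g" "F = mor_class M N f" by auto
  show "isomorphism (MF_cat w) M N F"
    unfolding isomorphism_def
  proof (intro conjI bexI[of _ "mor_class N M g"])
    note c = *(1)[unfolded htp_equiv_def]
    show "F \<in> Hom (MF_cat w) M N" "mor_class N M g \<in> Hom (MF_cat w) N M"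
      using c *(2) by (auto simp: MF_cat_simps Ext_iff)
    show "Comp (MF_cat w) M N M (mor_class N M g) F = Ident (MF_cat w) M"
      "Comp (MF_cat w) N M N F (mor_class N M g) = Ident (MF_cat w) N"
      using c by (simp_all add: MF_cat_simps *(2) class_comp mfs mor_class_eq_iff[OF mfs(1,1)] mor_class_eq_iff[OF mfs(2,2)]
        chain_one[OF mfs(1)] chain_one[OF mfs(2)] chain_mult[OF mfs mfs(1)] chain_mult[OF mfs(2,1,2)])
  qed
qed

section \<open>Fully faithful and essentially surjective functors\<close>

lemma isomorphismI:
  assumes "f \<in> Hom C X Y" "g \<in> Hom C Y X" "Comp C X Y X g f = Ident C X" "Comp C Y X Y f g = Ident C Y"
  shows "isomorphism C X Y f"
  using assms by (auto simp: isomorphism_def)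

text \<open>
  A choice of objects \<open>G0 Z\<close> and of isomorphisms \<open>a Z : F (G0 Z) \<rightarrow> Z\<close> with inverses \<open>b Z\<close>
  determines the inverse functor: it sends \<open>k : Z \<rightarrow> W\<close> to the unique lift of \<open>b W \<circ> k \<circ> a Z\<close>.
\<close>

lemma equivalenceI:
  assumes F: "is_functor C D F"
    and inj: "\<And>X Y f g. X \<in> Obj C \<Longrightarrow> Y \<in> Obj C \<Longrightarrow> f \<in> Hom C X Y \<Longrightarrow> g \<in> Hom C X Y \<Longrightarrow>
      on_mor F X Y f = on_mor F X Y g \<Longrightarrow> f = g"
    and full: "\<And>X Y k. X \<in> Obj C \<Longrightarrow> Y \<in> Obj C \<Longrightarrow> k \<in> Hom D (on_obj F X) (on_obj F Y) \<Longrightarrow>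
      \<exists>f\<in>Hom C X Y. on_mor F X Y f = k"
    and surj: "\<And>Z. Z \<in> Obj D \<Longrightarrow> \<exists>X\<in>Obj C. \<exists>k. isomorphism D (on_obj F X) Z k"
  shows "equivalence_of_categories C D F"
proof -
  interpret is_functor C D F by fact
  have "\<forall>Z. \<exists>X a b. Z \<in> Obj D \<longrightarrow> X \<in> Obj C \<and> a \<in> Hom D (on_obj F X) Z \<and> b \<in> Hom D Z (on_obj F X) \<and>
     Comp D (on_obj F X) Z (on_obj F X) b a = Ident D (on_obj F X) \<and> Comp D Z (on_obj F X) Z a b = Ident D Z"
    using surj unfolding isomorphism_def by blast
  then obtain G0 a b where G0: "\<And>Z. Z \<in> Obj D \<Longrightarrow> G0 Z \<in> Obj C"
    and a: "\<And>Z. Z \<in> Obj D \<Longrightarrow> a Z \<in> Hom D (on_obj F (G0 Z)) Z"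
    and b: "\<And>Z. Z \<in> Obj D \<Longrightarrow> b Z \<in> Hom D Z (on_obj F (G0 Z))"
    and ba: "\<And>Z. Z \<in> Obj D \<Longrightarrow> Comp D (on_obj F (G0 Z)) Z (on_obj F (G0 Z)) (b Z) (a Z) = Ident D (on_obj F (G0 Z))"
    and ab: "\<And>Z. Z \<in> Obj D \<Longrightarrow> Comp D Z (on_obj F (G0 Z)) Z (a Z) (b Z) = Ident D Z"
    by metis
  define L where "L X Y k = (SOME f. f \<in> Hom C X Y \<and> on_mor F X Y f = k)" for X Y k
  have L: "L X Y k \<in> Hom C X Y" "on_mor F X Y (L X Y k) = k"
    if "X \<in> Obj C" "Y \<in> Obj C" "k \<in> Hom D (on_obj F X) (on_obj F Y)" for X Y k
    using someI_ex[of "\<lambda>f. f \<in> Hom C X Y \<and> on_mor F X Y f = k"] full[OF that] by (auto simp: L_def)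
  define K where "K Z W k = Comp D (on_obj F (G0 Z)) W (on_obj F (G0 W)) (b W) (Comp D (on_obj F (G0 Z)) Z W k (a Z))" for Z W k
  have FG: "on_obj F (G0 Z) \<in> Obj D" if "Z \<in> Obj D" for Z using that G0 on_obj_in by blast
  note tc = target.comp_in target.ident_in FG a b G0 on_obj_in on_mor_in source.ident_in source.comp_in
  have K: "K Z W k \<in> Hom D (on_obj F (G0 Z)) (on_obj F (G0 W))" if "Z \<in> Obj D" "W \<in> Obj D" "k \<in> Hom D Z W" for Z W k
    unfolding K_def by (intro tc that)
  have aK: "Comp D (on_obj F (G0 Z)) (on_obj F (G0 W)) W (a W) (K Z W k) = Comp D (on_obj F (G0 Z)) Z W k (a Z)"
    if "Z \<in> Obj D" "W \<in> Obj D" "k \<in> Hom D Z W" for Z W k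
  proof -
    have c: "Comp D (on_obj F (G0 Z)) Z W k (a Z) \<in> Hom D (on_obj F (G0 Z)) W" by (intro tc that)
    show ?thesis
      unfolding K_def using that c by (subst target.comp_assoc) (auto intro: tc simp: ab target.comp_ident_left FG)
  qed
  define G where "G = \<lparr>on_obj = G0, on_mor = (\<lambda>Z W k. L (G0 Z) (G0 W) (K Z W k))\<rparr>"
  have Gm: "on_mor G Z W k \<in> Hom C (G0 Z) (G0 W)" "on_mor F (G0 Z) (G0 W) (on_mor G Z W k) = K Z W k"
    if "Z \<in> Obj D" "W \<in> Obj D" "k \<in> Hom D Z W" for Z W k
    using L[OF G0[OF that(1)] G0[OF that(2)] K[OF that]] by (auto simp: G_def)
  have Go: "on_obj G = G0" by (simp add: G_def)
  have Gf: "is_functor D C G"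
  proof
    fix X assume "X \<in> Obj D"
    then show "on_obj G X \<in> Obj C" using G0 by (simp add: Go)
  next
    fix X Y f assume "X \<in> Obj D" "Y \<in> Obj D" "f \<in> Hom D X Y"
    then show "on_mor G X Y f \<in> Hom C (on_obj G X) (on_obj G Y)" using Gm by (simp add: Go)
  next
    fix X assume X: "X \<in> Obj D"
    have i: "Ident D X \<in> Hom D X X" using X by (rule target.ident_in)
    show "on_mor G X X (Ident D X) = Ident C (on_obj G X)" unfolding Go
    proof (rule inj[OF G0[OF X] G0[OF X] Gm(1)[OF X X i] source.ident_in[OF G0[OF X]]])
      show "on_mor F (G0 X) (G0 X) (on_mor G X X (Ident D X)) = on_mor F (G0 X) (G0 X) (Ident C (G0 X))"
        unfolding Gm(2)[OF X X i] K_def on_mor_ident[OF G0[OF X]]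
        using X by (simp add: target.comp_ident_left FG a ba)
    qed
  next
    fix X Y Z f g assume *: "X \<in> Obj D" "Y \<in> Obj D" "Z \<in> Obj D" "f \<in> Hom D X Y" "g \<in> Hom D Y Z"
    have gf: "Comp D X Y Z g f \<in> Hom D X Z" using * by (intro target.comp_in)
    show "on_mor G X Z (Comp D X Y Z g f) = Comp C (on_obj G X) (on_obj G Y) (on_obj G Z) (on_mor G Y Z g) (on_mor G X Y f)"
      unfolding Go
    proof (rule inj[OF G0[OF *(1)] G0[OF *(3)] Gm(1)[OF *(1,3) gf]])
      show "Comp C (G0 X) (G0 Y) (G0 Z) (on_mor G Y Z g) (on_mor G X Y f) \<in> Hom C (G0 X) (G0 Z)"
        using * by (intro source.comp_in G0 Gm)
      have "on_mor F (G0 X) (G0 Z) (Comp C (G0 X) (G0 Y) (G0 Z) (on_mor G Y Z g) (on_mor G X Y f))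
        = Comp D (on_obj F (G0 X)) (on_obj F (G0 Y)) (on_obj F (G0 Z)) (K Y Z g) (K X Y f)"
        using * by (simp add: on_mor_comp G0 Gm)
      also have "\<dots> = Comp D (on_obj F (G0 X)) Z (on_obj F (G0 Z)) (b Z)
          (Comp D (on_obj F (G0 X)) (on_obj F (G0 Y)) Z (Comp D (on_obj F (G0 Y)) Y Z g (a Y)) (K X Y f))"
        unfolding K_def[of Y Z g]
        by (rule target.comp_assoc[symmetric]) (use * in \<open>auto intro: tc K\<close>)
      also have "Comp D (on_obj F (G0 X)) (on_obj F (G0 Y)) Z (Comp D (on_obj F (G0 Y)) Y Z g (a Y)) (K X Y f)
         = Comp D (on_obj F (G0 X)) Y Z g (Comp D (on_obj F (G0 X)) (on_obj F (G0 Y)) Y (a Y) (K X Y f))"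
        by (rule target.comp_assoc[symmetric]) (use * in \<open>auto intro: tc K\<close>)
      also have "\<dots> = Comp D (on_obj F (G0 X)) X Z (Comp D X Y Z g f) (a X)"
        unfolding aK[OF *(1,2,4)]
        by (rule target.comp_assoc) (use * in \<open>auto intro: tc K\<close>)
      finally show "on_mor F (G0 X) (G0 Z) (on_mor G X Z (Comp D X Y Z g f))
        = on_mor F (G0 X) (G0 Z) (Comp C (G0 X) (G0 Y) (G0 Z) (on_mor G Y Z g) (on_mor G X Y f))"
        unfolding Gm(2)[OF *(1,3) gf] by (simp add: K_def)
    qed
  qed
  have FGiso: "naturally_isomorphic D D (comp_functor F G) id_functor"
    unfolding naturally_isomorphic_def
  proof (rule exI[of _ a], intro conjI ballI)
    fix X assume "X \<in> Obj D"
    then show "isomorphism D (on_obj (comp_functor F G) X) (on_obj id_functor X) (a X)"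
      using a b ab ba by (auto simp: comp_functor_def id_functor_def Go intro!: isomorphismI[where g = "b X"])
  next
    fix X Y f assume "X \<in> Obj D" "Y \<in> Obj D" "f \<in> Hom D X Y"
    then show "Comp D (on_obj (comp_functor F G) X) (on_obj (comp_functor F G) Y) (on_obj id_functor Y) (a Y)
          (on_mor (comp_functor F G) X Y f) =
        Comp D (on_obj (comp_functor F G) X) (on_obj id_functor X) (on_obj id_functor Y) (on_mor id_functor X Y f) (a X)"
      by (simp add: comp_functor_def id_functor_def Go Gm aK)
  qed
  define c where "c X = L X (G0 (on_obj F X)) (b (on_obj F X))" for X
  define d where "d X = L (G0 (on_obj F X)) X (a (on_obj F X))" for X
  have c: "c X \<in> Hom C X (G0 (on_obj F X))" "on_mor F X (G0 (on_obj F X)) (c X) = b (on_obj F X)" if "X \<in> Obj C" for X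
    using L[of X "G0 (on_obj F X)" "b (on_obj F X)"] that by (auto simp: c_def G0 on_obj_in b)
  have d: "d X \<in> Hom C (G0 (on_obj F X)) X" "on_mor F (G0 (on_obj F X)) X (d X) = a (on_obj F X)" if "X \<in> Obj C" for X
    using L[of "G0 (on_obj F X)" X "a (on_obj F X)"] that by (auto simp: d_def G0 on_obj_in a)
  have GFiso: "naturally_isomorphic C C id_functor (comp_functor G F)"
    unfolding naturally_isomorphic_def
  proof (rule exI[of _ c], intro conjI ballI)
    fix X assume X: "X \<in> Obj C"
    note o = on_obj_in[OF X] G0[OF on_obj_in[OF X]]
    have "Comp C X (G0 (on_obj F X)) X (d X) (c X) = Ident C X"
    proof (rule inj[OF X X])
      show "on_mor F X X (Comp C X (G0 (on_obj F X)) X (d X) (c X)) = on_mor F X X (Ident C X)"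
        using X o by (simp add: on_mor_comp c d on_mor_ident ab)
    qed (use X o c d in \<open>auto intro: source.comp_in source.ident_in\<close>)
    moreover have "Comp C (G0 (on_obj F X)) X (G0 (on_obj F X)) (c X) (d X) = Ident C (G0 (on_obj F X))"
    proof (rule inj[OF o(2) o(2)])
      show "on_mor F (G0 (on_obj F X)) (G0 (on_obj F X)) (Comp C (G0 (on_obj F X)) X (G0 (on_obj F X)) (c X) (d X))
        = on_mor F (G0 (on_obj F X)) (G0 (on_obj F X)) (Ident C (G0 (on_obj F X)))"
        using X o by (simp add: on_mor_comp c d on_mor_ident ba)
    qed (use X o c d in \<open>auto intro: source.comp_in source.ident_in\<close>)
    ultimately show "isomorphism C (on_obj id_functor X) (on_obj (comp_functor G F) X) (c X)"
      using X c d by (auto simp: comp_functor_def id_functor_def Go intro!: isomorphismI[where g = "d X"])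
  next
    fix X Y f assume *: "X \<in> Obj C" "Y \<in> Obj C" "f \<in> Hom C X Y"
    let ?X = "on_obj F X" and ?Y = "on_obj F Y" and ?k = "on_mor F X Y f"
    note o = on_obj_in[OF *(1)] G0[OF on_obj_in[OF *(1)]] on_obj_in[OF *(2)] G0[OF on_obj_in[OF *(2)]]
    note k = on_mor_in[OF *]
    have "Comp C X Y (G0 ?Y) (c Y) f = Comp C X (G0 ?X) (G0 ?Y) (on_mor G ?X ?Y ?k) (c X)"
    proof (rule inj[OF *(1) o(4)])
      have "on_mor F X (G0 ?Y) (Comp C X (G0 ?X) (G0 ?Y) (on_mor G ?X ?Y ?k) (c X))
        = Comp D ?X (on_obj F (G0 ?X)) (on_obj F (G0 ?Y)) (K ?X ?Y ?k) (b ?X)"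
        using * o k by (simp add: on_mor_comp c Gm)
      also have "\<dots> = Comp D ?X ?Y (on_obj F (G0 ?Y)) (b ?Y)
          (Comp D ?X (on_obj F (G0 ?X)) ?Y (Comp D (on_obj F (G0 ?X)) ?X ?Y ?k (a ?X)) (b ?X))"
        unfolding K_def by (rule target.comp_assoc[symmetric]) (use * o k in \<open>auto intro: tc\<close>)
      also have "Comp D ?X (on_obj F (G0 ?X)) ?Y (Comp D (on_obj F (G0 ?X)) ?X ?Y ?k (a ?X)) (b ?X)
        = Comp D ?X ?X ?Y ?k (Comp D ?X (on_obj F (G0 ?X)) ?X (a ?X) (b ?X))"
        by (rule target.comp_assoc[symmetric]) (use * o k in \<open>auto intro: tc\<close>)
      also have "\<dots> = ?k" using o k by (simp add: ab target.comp_ident_right)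
      finally show "on_mor F X (G0 ?Y) (Comp C X Y (G0 ?Y) (c Y) f)
        = on_mor F X (G0 ?Y) (Comp C X (G0 ?X) (G0 ?Y) (on_mor G ?X ?Y ?k) (c X))"
        using * o by (simp add: on_mor_comp c)
    qed (use * o k c Gm in \<open>auto intro: source.comp_in\<close>)
    then show "Comp C (on_obj id_functor X) (on_obj id_functor Y) (on_obj (comp_functor G F) Y) (c Y) (on_mor id_functor X Y f)
      = Comp C (on_obj id_functor X) (on_obj (comp_functor G F) X) (on_obj (comp_functor G F) Y) (on_mor (comp_functor G F) X Y f) (c X)"
      by (simp add: comp_functor_def id_functor_def Go)
  qed
  show ?thesis
    unfolding equivalence_of_categories_def using F Gf FGiso GFiso by blast
qed

section \<open>The operator of \<open>\<theta>(M)\<close> in block form\<close>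

text \<open>
  This diagonal matrix accounts both for the sign in the passage to $(Q, -P)$ and for the Koszul sign
  rule. Even maps commute and odd maps anticommute with it.
\<close>

definition sign_mat :: "bool list \<Rightarrow> 'a::comm_ring_1 mat" where
  "sign_mat ps = negate_even_cols ps (1\<^sub>m (length ps))"

lemma sign_mat_dim [simp]: "dim_row (sign_mat ps) = length ps" "dim_col (sign_mat ps) = length ps"
  by (auto simp: sign_mat_def negate_even_cols_def)

lemma sign_mat_index:
  "i < length ps \<Longrightarrow> j < length ps \<Longrightarrow> sign_mat ps $$ (i, j) = (if i = j then if ps ! i then 1 else - 1 else 0)"
  by (auto simp: sign_mat_def negate_even_cols_def)

lemma index_mult_sign_mat:
  fixes f :: "'a::comm_ring_1 mat"
  assumes "i < dim_row f" "j < length ps" "dim_col f = length ps"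
  shows "(f * sign_mat ps) $$ (i, j) = (if ps ! j then f $$ (i, j) else - f $$ (i, j))"
proof -
  have "(f * sign_mat ps) $$ (i, j) = (\<Sum>k\<in>{0..<length ps}. f $$ (i, k) * sign_mat ps $$ (k, j))"
    using assms by (simp add: index_mult_mat scalar_prod_def)
  also have "\<dots> = (\<Sum>k\<in>{0..<length ps}. if k = j then f $$ (i, j) * (if ps ! j then 1 else - 1) else 0)"
    by (rule sum.cong) (use assms in \<open>auto simp: sign_mat_index\<close>)
  also have "\<dots> = (if ps ! j then f $$ (i, j) else - f $$ (i, j))"
    using assms by (subst sum.delta) auto
  finally show ?thesis .
qed

lemma index_sign_mat_mult:
  fixes f :: "'a::comm_ring_1 mat"
  assumes "i < length ps" "j < dim_col f" "dim_row f = length ps"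
  shows "(sign_mat ps * f) $$ (i, j) = (if ps ! i then f $$ (i, j) else - f $$ (i, j))"
proof -
  have "(sign_mat ps * f) $$ (i, j) = (\<Sum>k\<in>{0..<length ps}. sign_mat ps $$ (i, k) * f $$ (k, j))"
    using assms by (simp add: index_mult_mat scalar_prod_def)
  also have "\<dots> = (\<Sum>k\<in>{0..<length ps}. if k = i then (if ps ! i then 1 else - 1) * f $$ (i, j) else 0)"
    by (rule sum.cong) (use assms in \<open>auto simp: sign_mat_index\<close>)
  also have "\<dots> = (if ps ! i then f $$ (i, j) else - f $$ (i, j))"
    using assms by (subst sum.delta) auto
  finally show ?thesis .
qed

lemma negate_even_cols_eq: "dim_col f = length ps \<Longrightarrow> negate_even_cols ps f = f * sign_mat ps"
  by (rule eq_matI) (auto simp: negate_even_cols_def index_mult_sign_mat)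

lemma sign_mat_sq [simp]: "sign_mat ps * sign_mat ps = 1\<^sub>m (length ps)"
  by (rule eq_matI) (auto simp: index_mult_sign_mat sign_mat_index)

lemma sign_mat_sq_left [simp]:
  "dim_row A = length ps \<Longrightarrow> sign_mat ps * (sign_mat ps * A) = (A :: 'a::comm_ring_1 mat)"
  by (simp add: mat_assoc[symmetric])

lemma sign_mat_transpose [simp]: "transpose_mat (sign_mat ps) = sign_mat ps"
  by (rule eq_matI) (auto simp: sign_mat_index)

lemma sign_mat_Not: "sign_mat (map Not ps) = - sign_mat ps"
  by (rule eq_matI) (auto simp: sign_mat_index)

lemma sign_mat_even:
  fixes f :: "'a::comm_ring_1 mat"
  assumes f: "f \<in> graded_maps False M M'"
  shows "sign_mat (par M') * f = f * sign_mat (par M)"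
proof (rule eq_matI)
  fix i j assume "i < dim_row (f * sign_mat (par M))" "j < dim_col (f * sign_mat (par M))"
  then show "(sign_mat (par M') * f) $$ (i, j) = (f * sign_mat (par M)) $$ (i, j)"
    using f gradedD[OF f, of i j]
    by (cases "f $$ (i, j) = 0") (auto simp: index_mult_sign_mat index_sign_mat_mult)
qed (use f in auto)

lemma sign_mat_odd:
  fixes f :: "'a::comm_ring_1 mat"
  assumes f: "f \<in> graded_maps True M M'"
  shows "sign_mat (par M') * f = - (f * sign_mat (par M))"
proof (rule eq_matI)
  fix i j assume "i < dim_row (- (f * sign_mat (par M)))" "j < dim_col (- (f * sign_mat (par M)))"
  then show "(sign_mat (par M') * f) $$ (i, j) = (- (f * sign_mat (par M))) $$ (i, j)"
    using f gradedD[OF f, of i j]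
    by (cases "f $$ (i, j) = 0") (auto simp: index_mult_sign_mat index_sign_mat_mult)
qed (use f in auto)

lemma sign_mat_graded: "sign_mat (par M) \<in> graded_maps False M M"
  by (rule gradedI) (auto simp: sign_mat_index split: if_splits)

subsection \<open>Constants in \<open>A[[x, y]]\<close>\<close>

lemma const_xy_hom:
  "const_xy 0 = 0" "const_xy 1 = 1" "const_xy (a + b) = const_xy a + const_xy b"
  "const_xy (a * b) = const_xy a * const_xy b" "const_xy (- a) = - const_xy a"
  "const_xy (a - b) = const_xy a - const_xy b"
  by (simp_all add: const_xy_def fps_const_add[symmetric] fps_const_mult[symmetric] fps_const_sub[symmetric] fps_const_neg[symmetric]
      del: fps_const_add fps_const_mult fps_const_sub fps_const_neg)

lemma const_xy_sum: "const_xy (\<Sum>k\<in>S. f k) = (\<Sum>k\<in>S. const_xy (f k))"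
  by (induction S rule: infinite_finite_induct) (auto simp: const_xy_hom)

abbreviation cm :: "'a::comm_ring_1 mat \<Rightarrow> 'a fps fps mat" where
  "cm \<equiv> map_mat const_xy"

lemma cm_mult: "dim_col A = dim_row B \<Longrightarrow> cm (A * B) = cm A * cm B"
  by (rule eq_matI) (auto simp: index_mult_mat scalar_prod_def const_xy_sum const_xy_hom)

lemma cm_simps:
  "cm (1\<^sub>m n) = 1\<^sub>m n" "cm (0\<^sub>m n m) = 0\<^sub>m n m" "cm (- A) = - cm A" "cm (c \<cdot>\<^sub>m A) = const_xy c \<cdot>\<^sub>m cm A"
  "cm (transpose_mat A) = transpose_mat (cm A)" "cm (sign_mat ps) = sign_mat ps"
  by (auto intro!: eq_matI simp: const_xy_hom sign_mat_index)

lemma cm_add: "dim_row A = dim_row B \<Longrightarrow> dim_col A = dim_col B \<Longrightarrow> cm (A + B) = cm A + cm B"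
  by (auto intro!: eq_matI simp: const_xy_hom)

lemma mf_map_simps [simp]: "par (mf_map h M) = par M" "opr (mf_map h M) = map_mat h (opr M)"
  by (auto simp: mf_map_def)

abbreviation mf_const :: "'a::comm_ring_1 mf \<Rightarrow> 'a fps fps mf" where
  "mf_const \<equiv> mf_map const_xy"

lemma cm_graded:
  assumes "f \<in> graded_maps p M M'"
  shows "cm f \<in> graded_maps p (mf_const M) (mf_const M')"
proof (rule gradedI)
  fix i j assume "i < rank (mf_const M')" "j < rank (mf_const M)" "cm f $$ (i, j) \<noteq> 0"
  moreover from this have "f $$ (i, j) \<noteq> 0" using assms by (auto simp: const_xy_hom)
  ultimately show "(par (mf_const M') ! i \<noteq> par (mf_const M) ! j) = p"
    using gradedD[OF assms, of i j] by auto
qed (use assms in auto)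

lemma koszul_two:
  fixes f :: "'a::comm_ring_1 mat"
  assumes "dim_col f = length ps" "g = mat_of_rows_list 2 [[g00, g01], [g10, g11]]"
  shows "koszul_tensor p (map Not ps) f g =
    (let f' = (if p then f * sign_mat ps else f) in
      four_block_mat (g00 \<cdot>\<^sub>m f') (g01 \<cdot>\<^sub>m f') (g10 \<cdot>\<^sub>m f') (g11 \<cdot>\<^sub>m f'))"
proof -
  have d: "dim_row g = 2" "dim_col g = 2" by (auto simp: assms(2) mat_of_rows_list_def)
  have g: "g $$ (0, 0) = g00" "g $$ (0, Suc 0) = g01" "g $$ (Suc 0, 0) = g10" "g $$ (Suc 0, Suc 0) = g11"
    by (auto simp: assms(2) mat_of_rows_list_def)
  have dm: "i div n = Suc 0 \<and> i mod n = i - n" if "n \<le> i" "i < 2 * n" for i n :: nat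
  proof -
    have "i = (i - n) + n" "i - n < n" using that by auto
    then show ?thesis by (metis One_nat_def add.left_neutral div_add_self2 div_less less_nat_zero_code mod_add_self2 mod_less not_gr_zero plus_1_eq_Suc add_0_right)
  qed
  show ?thesis unfolding Let_def
  proof (rule eq_matI)
    let ?f = "if p then f * sign_mat ps else f"
    fix i j assume "i < dim_row (four_block_mat (g00 \<cdot>\<^sub>m ?f) (g01 \<cdot>\<^sub>m ?f) (g10 \<cdot>\<^sub>m ?f) (g11 \<cdot>\<^sub>m ?f))"
      "j < dim_col (four_block_mat (g00 \<cdot>\<^sub>m ?f) (g01 \<cdot>\<^sub>m ?f) (g10 \<cdot>\<^sub>m ?f) (g11 \<cdot>\<^sub>m ?f))"
    then have ij: "i < 2 * dim_row f" "j < 2 * length ps" using assms by (auto split: if_splits)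
    consider "i < dim_row f" "j < length ps" | "i < dim_row f" "j \<ge> length ps" | "i \<ge> dim_row f" "j < length ps"
      | "i \<ge> dim_row f" "j \<ge> length ps" by linarith
    then show "koszul_tensor p (map Not ps) f g $$ (i, j)
      = four_block_mat (g00 \<cdot>\<^sub>m ?f) (g01 \<cdot>\<^sub>m ?f) (g10 \<cdot>\<^sub>m ?f) (g11 \<cdot>\<^sub>m ?f) $$ (i, j)"
      using ij dm[of "dim_row f" i] dm[of "length ps" j]
      by cases (auto simp: koszul_tensor_def assms(1) d g index_mult_sign_mat mult.commute)
  qed (auto simp: koszul_tensor_def d assms(1))
qed

lemma one_mat_two: "1\<^sub>m 2 = mat_of_rows_list 2 [[1, 0], [0, 1 :: 'a::comm_ring_1]]"
  by (rule eq_matI) (auto simp: mat_of_rows_list_def less_Suc_eq numeral_2_eq_2)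

lemma zero_smult_mat [simp]: "0 \<cdot>\<^sub>m (A :: 'a::comm_ring_1 mat) = 0\<^sub>m (dim_row A) (dim_col A)"
  by (rule eq_matI) auto

text \<open>In block form the operator of $(Q, -P)$ is the operator of $(P, Q)$ times the sign matrix.\<close>

definition swap_opr :: "'a::comm_ring_1 mf \<Rightarrow> 'a fps fps mat" where
  "swap_opr M = cm (opr M) * sign_mat (par M)"

lemma theta_par [simp]: "par (theta_mf M) = map Not (par M) @ par M"
  by (simp add: theta_mf_def mf_tensor_def tensor_par_def mf_map_def mf_swap_def mf_xy_def comp_def)

lemma theta_opr:
  assumes "dim_row (opr M) = rank M" "dim_col (opr M) = rank M"
  shows "opr (theta_mf M) = four_block_mat (swap_opr M) (var_y \<cdot>\<^sub>m sign_mat (par M)) (var_x \<cdot>\<^sub>m sign_mat (par M)) (swap_opr M)"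
proof -
  have e: "opr (theta_mf M) = koszul_tensor False (map Not (par M)) (swap_opr M) (1\<^sub>m 2) +
      koszul_tensor True (map Not (par M)) (1\<^sub>m (rank M)) (mat_of_rows_list 2 [[0, var_y], [var_x, 0]])"
    using assms by (simp add: theta_mf_def mf_tensor_def mf_swap_def mf_xy_def negate_even_cols_eq cm_mult cm_simps swap_opr_def numeral_2_eq_2)
  have d: "dim_col (swap_opr M) = rank M" "dim_row (swap_opr M) = rank M" using assms by (auto simp: swap_opr_def)
  show ?thesis unfolding e
    using d
    by (simp add: koszul_two[OF d(1) one_mat_two] koszul_two[OF _ refl] Let_def four_simps)
      (rule cong_four_block_mat; rule eq_matI; simp)
qed

lemma theta_map_eq:
  assumes "dim_col f = rank M"
  shows "theta_map M f = four_block_mat (cm f) (0\<^sub>m (dim_row f) (rank M)) (0\<^sub>m (dim_row f) (rank M)) (cm f)"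
  using assms by (simp add: theta_map_def mf_swap_def koszul_two[OF _ one_mat_two] Let_def)

lemma theta_form_eq:
  assumes "dim_col b = rank M" "dim_row b = rank M"
  shows "theta_form M b = four_block_mat (0\<^sub>m (rank M) (rank M)) (- (cm b * sign_mat (par M)))
    (cm b * sign_mat (par M)) (0\<^sub>m (rank M) (rank M))"
  using assms by (simp add: theta_form_def mf_swap_def koszul_two[OF _ beta_xy_def] Let_def)

lemma theta_twisted_form_eq:
  assumes "dim_col b = rank M" "dim_row b = rank M"
  shows "theta_twisted_form M b = four_block_mat (0\<^sub>m (rank M) (rank M)) (- cm b) (cm b) (0\<^sub>m (rank M) (rank M))"
  using assms by (simp add: theta_twisted_form_def mf_swap_def koszul_two[OF _ beta_xy_def] Let_def
      negate_even_cols_eq cm_mult cm_simps mat_assoc)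

subsection \<open>Expansion in \<open>x\<close> and \<open>y\<close>\<close>

text \<open>
  Every element of $A[[x, y]]$ is uniquely $c + x f + y g$ with $c$ constant and $f$ free of $y$. The
  following three functions extract $c$, $f$ and $g$.
\<close>

definition ev_xy :: "'a::comm_ring_1 fps fps \<Rightarrow> 'a" where
  "ev_xy f = fps_nth (fps_nth f 0) 0"

definition quot_x :: "'a::comm_ring_1 fps fps \<Rightarrow> 'a fps fps" where
  "quot_x f = fps_const (fps_shift 1 (fps_nth f 0))"

definition quot_y :: "'a::comm_ring_1 fps fps \<Rightarrow> 'a fps fps" where
  "quot_y f = fps_shift 1 f"

lemma ev_xy_hom:
  "ev_xy 0 = 0" "ev_xy 1 = 1" "ev_xy (a + b) = ev_xy a + ev_xy b" "ev_xy (a * b) = ev_xy a * ev_xy b"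
  "ev_xy (- a) = - ev_xy a" "ev_xy (a - b) = ev_xy a - ev_xy b"
  "ev_xy var_x = 0" "ev_xy var_y = 0" "ev_xy (const_xy c) = c"
  by (auto simp: ev_xy_def var_x_def var_y_def const_xy_def)

lemma ev_xy_sum: "ev_xy (\<Sum>k\<in>S. f k) = (\<Sum>k\<in>S. ev_xy (f k))"
  by (induction S rule: infinite_finite_induct) (auto simp: ev_xy_hom)

lemma var_x_nth: "fps_nth (var_x * f) n = fps_X * fps_nth f n"
  by (simp add: var_x_def)

lemma var_y_nth: "fps_nth (var_y * f) n = (if n = 0 then 0 else fps_nth f (n - 1))"
  by (simp add: var_y_def)

lemma X_cancel: "fps_X * f = fps_X * g \<Longrightarrow> f = (g :: 'a::comm_ring_1 fps)"
proof (rule fps_ext)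
  fix n assume e: "fps_X * f = fps_X * g"
  show "fps_nth f n = fps_nth g n" using arg_cong[OF e, of "\<lambda>f. fps_nth f (Suc n)"] by simp
qed

lemma X_quot: "f = fps_const (fps_nth f 0) + fps_X * fps_shift 1 (f :: 'a::comm_ring_1 fps)"
  by (rule fps_ext) simp

lemma var_y_cancel: "var_y * f = var_y * g \<Longrightarrow> f = g"
  unfolding var_y_def by (rule X_cancel)

lemma var_x_cancel: "var_x * f = var_x * g \<Longrightarrow> f = g"
  by (rule fps_ext) (metis var_x_nth X_cancel)

lemma xy_decomp: "f = const_xy (ev_xy f) + var_x * quot_x f + var_y * quot_y f"
proof -
  have "f = fps_const (fps_nth f 0) + var_y * quot_y f"
    unfolding var_y_def quot_y_def by (rule X_quot)
  also have "fps_nth f 0 = fps_const (ev_xy f) + fps_X * fps_shift 1 (fps_nth f 0)"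
    unfolding ev_xy_def by (rule X_quot)
  also have "fps_const \<dots> = const_xy (ev_xy f) + var_x * quot_x f"
    by (simp only: fps_const_add[symmetric] fps_const_mult[symmetric] const_xy_def var_x_def quot_x_def)
  finally show ?thesis .
qed

text \<open>The sequence $(y, x)$ is regular: every relation between $x$ and $y$ is a Koszul relation.\<close>

lemma xy_independent:
  assumes "var_y * f = var_x * g"
  shows "g = var_y * quot_y g" "f = var_x * quot_y g"
proof -
  have "fps_X * fps_nth g 0 = fps_X * 0"
    using arg_cong[OF assms, of "\<lambda>f. fps_nth f 0"] by (simp add: var_x_nth var_y_nth del: fps_mult_nth_0)
  then have "fps_nth g 0 = 0" by (rule X_cancel)
  then show g: "g = var_y * quot_y g"
    using X_quot[of g] by (simp add: var_y_def quot_y_def)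
  have "var_y * f = var_y * (var_x * quot_y g)" using assms g by (metis mult.left_commute)
  then show "f = var_x * quot_y g" by (rule var_y_cancel)
qed

lemma mat_var_y_cancel: "var_y \<cdot>\<^sub>m A = var_y \<cdot>\<^sub>m B \<Longrightarrow> A = B"
proof (rule eq_matI)
  assume e: "var_y \<cdot>\<^sub>m A = var_y \<cdot>\<^sub>m B"
  show d: "dim_row A = dim_row B" "dim_col A = dim_col B"
    using arg_cong[OF e, of dim_row] arg_cong[OF e, of dim_col] by auto
  fix i j assume "i < dim_row B" "j < dim_col B"
  then show "A $$ (i, j) = B $$ (i, j)"
    using arg_cong[OF e, of "\<lambda>M. M $$ (i, j)"] d by (auto intro: var_y_cancel)
qed

lemma mat_var_x_cancel: "var_x \<cdot>\<^sub>m A = var_x \<cdot>\<^sub>m B \<Longrightarrow> A = B"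
proof (rule eq_matI)
  assume e: "var_x \<cdot>\<^sub>m A = var_x \<cdot>\<^sub>m B"
  show d: "dim_row A = dim_row B" "dim_col A = dim_col B"
    using arg_cong[OF e, of dim_row] arg_cong[OF e, of dim_col] by auto
  fix i j assume "i < dim_row B" "j < dim_col B"
  then show "A $$ (i, j) = B $$ (i, j)"
    using arg_cong[OF e, of "\<lambda>M. M $$ (i, j)"] d by (auto intro: var_x_cancel)
qed

lemma mat_xy_decomp:
  "A = cm (map_mat ev_xy A) + (var_x \<cdot>\<^sub>m map_mat quot_x A + var_y \<cdot>\<^sub>m map_mat quot_y A)"
  by (rule eq_matI) (auto simp: add.assoc[symmetric] xy_decomp[symmetric])

lemma mat_xy_independent:
  assumes e: "var_y \<cdot>\<^sub>m A = var_x \<cdot>\<^sub>m B"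
  shows "B = var_y \<cdot>\<^sub>m map_mat quot_y B" "A = var_x \<cdot>\<^sub>m map_mat quot_y B"
proof -
  have d: "dim_row A = dim_row B" "dim_col A = dim_col B"
    using arg_cong[OF e, of dim_row] arg_cong[OF e, of dim_col] by auto
  have *: "var_y * A $$ (i, j) = var_x * B $$ (i, j)" if "i < dim_row B" "j < dim_col B" for i j
    using arg_cong[OF e, of "\<lambda>M. M $$ (i, j)"] d that by auto
  show "B = var_y \<cdot>\<^sub>m map_mat quot_y B" "A = var_x \<cdot>\<^sub>m map_mat quot_y B"
    using d xy_independent[OF *] by (auto intro!: eq_matI)
qed

abbreviation em :: "'a::comm_ring_1 fps fps mat \<Rightarrow> 'a mat" where
  "em \<equiv> map_mat ev_xy"

lemma em_mult: "dim_col A = dim_row B \<Longrightarrow> em (A * B) = em A * em B"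
  by (rule eq_matI) (auto simp: index_mult_mat scalar_prod_def ev_xy_sum ev_xy_hom)

lemma em_add: "dim_row A = dim_row B \<Longrightarrow> dim_col A = dim_col B \<Longrightarrow> em (A + B) = em A + em B"
  by (auto intro!: eq_matI simp: ev_xy_hom)

lemma em_simps:
  "em (1\<^sub>m n) = 1\<^sub>m n" "em (0\<^sub>m n m) = 0\<^sub>m n m" "em (- A) = - em A"
  "em (var_x \<cdot>\<^sub>m A) = 0\<^sub>m (dim_row A) (dim_col A)" "em (var_y \<cdot>\<^sub>m A) = 0\<^sub>m (dim_row A) (dim_col A)"
  "em (transpose_mat A) = transpose_mat (em A)" "em (sign_mat ps) = sign_mat ps" "em (cm B) = B"
  by (auto intro!: eq_matI simp: ev_xy_hom sign_mat_index)

lemma map_mat_graded: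
  assumes f: "f \<in> graded_maps p M M'" and "h 0 = 0" and "par M = par N" "par M' = par N'"
  shows "map_mat h f \<in> graded_maps p N N'"
proof (rule gradedI)
  fix i j assume "i < rank N'" "j < rank N" "map_mat h f $$ (i, j) \<noteq> 0"
  moreover from this have "f $$ (i, j) \<noteq> 0" using assms by auto
  ultimately show "(par N' ! i \<noteq> par N ! j) = p"
    using gradedD[OF assms(1), of i j] assms(3,4) by auto
qed (use assms in auto)

lemma quot_zero: "quot_x 0 = 0" "quot_y 0 = 0"
  by (auto simp: quot_x_def quot_y_def)

subsection \<open>Chain maps between objects \<open>\<theta>(M)\<close>\<close>

lemma swap_opr_dim [simp]: "is_mf w M \<Longrightarrow> dim_row (swap_opr M) = rank M" "dim_col (swap_opr M) = rank M"
  using is_mfD(3)[of w M] by (auto simp: swap_opr_def)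

lemma swap_opr_simps:
  assumes "is_mf w M"
  shows "sign_mat (par M) * swap_opr M = - (swap_opr M * sign_mat (par M))"
    and "swap_opr M * swap_opr M = (- const_xy w) \<cdot>\<^sub>m 1\<^sub>m (rank M)"
    and "swap_opr M \<in> graded_maps True (mf_const M) (mf_const M)"
    and "em (swap_opr M) = opr M * sign_mat (par M)"
proof -
  note mf = is_mfD[OF assms]
  have o: "sign_mat (par M) * cm (opr M) = - (cm (opr M) * sign_mat (par M))"
    using sign_mat_odd[OF cm_graded[OF mf(1)]] by simp
  show 1: "sign_mat (par M) * swap_opr M = - (swap_opr M * sign_mat (par M))"
    using mf o by (simp add: swap_opr_def mat_assoc[symmetric])
  have "swap_opr M * swap_opr M = cm (opr M) * (sign_mat (par M) * swap_opr M)"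
    using mf(3,4) by (simp add: swap_opr_def mat_assoc)
  also have "\<dots> = - (cm (opr M * opr M))"
    using mf(3,4) unfolding 1 by (simp add: swap_opr_def mat_assoc cm_mult)
  also have "\<dots> = (- const_xy w) \<cdot>\<^sub>m 1\<^sub>m (rank M)"
    unfolding mf(2) by (auto simp: cm_simps intro!: eq_matI)
  finally show "swap_opr M * swap_opr M = (- const_xy w) \<cdot>\<^sub>m 1\<^sub>m (rank M)" .
  show "swap_opr M \<in> graded_maps True (mf_const M) (mf_const M)"
    unfolding swap_opr_def
    using graded_mult_even[OF sign_mat_graded[of "mf_const M"] cm_graded[OF mf(1)]] by simp
  show "em (swap_opr M) = opr M * sign_mat (par M)"
    using mf by (simp add: swap_opr_def em_mult em_simps)
qed

lemma theta_opr':
  assumes "is_mf w M"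
  shows "opr (theta_mf M) = four_block_mat (swap_opr M) (var_y \<cdot>\<^sub>m sign_mat (par M)) (var_x \<cdot>\<^sub>m sign_mat (par M)) (swap_opr M)"
  by (rule theta_opr) (use is_mfD[OF assms] in auto)

lemma theta_graded_iff:
  assumes d: "dim_row a = rank M'" "dim_col a = rank M" "dim_row b = rank M'" "dim_col b = rank M"
    "dim_row c = rank M'" "dim_col c = rank M" "dim_row d = rank M'" "dim_col d = rank M"
  shows "four_block_mat a b c d \<in> graded_maps p (theta_mf M) (theta_mf M') \<longleftrightarrow>
    a \<in> graded_maps p (mf_const M) (mf_const M') \<and> b \<in> graded_maps (\<not> p) (mf_const M) (mf_const M') \<and>
    c \<in> graded_maps (\<not> p) (mf_const M) (mf_const M') \<and> d \<in> graded_maps p (mf_const M) (mf_const M')"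
proof
  assume *: "four_block_mat a b c d \<in> graded_maps p (theta_mf M) (theta_mf M')"
  have "(a $$ (i, j) \<noteq> 0 \<longrightarrow> (par M' ! i \<noteq> par M ! j) = p) \<and> (b $$ (i, j) \<noteq> 0 \<longrightarrow> (par M' ! i \<noteq> par M ! j) = (\<not> p)) \<and>
      (c $$ (i, j) \<noteq> 0 \<longrightarrow> (par M' ! i \<noteq> par M ! j) = (\<not> p)) \<and> (d $$ (i, j) \<noteq> 0 \<longrightarrow> (par M' ! i \<noteq> par M ! j) = p)"
    if "i < rank M'" "j < rank M" for i j
    using that gradedD[OF *, of i j] gradedD[OF *, of i "j + rank M"] gradedD[OF *, of "i + rank M'" j]
      gradedD[OF *, of "i + rank M'" "j + rank M"] d by (auto simp: nth_append)
  then show "a \<in> graded_maps p (mf_const M) (mf_const M') \<and> b \<in> graded_maps (\<not> p) (mf_const M) (mf_const M') \<and>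
    c \<in> graded_maps (\<not> p) (mf_const M) (mf_const M') \<and> d \<in> graded_maps p (mf_const M) (mf_const M')"
    using d unfolding graded_maps_def mf_map_simps by (intro conjI CollectI allI impI carrier_matI) metis+
next
  assume *: "a \<in> graded_maps p (mf_const M) (mf_const M') \<and> b \<in> graded_maps (\<not> p) (mf_const M) (mf_const M') \<and>
    c \<in> graded_maps (\<not> p) (mf_const M) (mf_const M') \<and> d \<in> graded_maps p (mf_const M) (mf_const M')"
  show "four_block_mat a b c d \<in> graded_maps p (theta_mf M) (theta_mf M')"
  proof (rule gradedI)
    fix i j assume ij: "i < rank (theta_mf M')" "j < rank (theta_mf M)" "four_block_mat a b c d $$ (i, j) \<noteq> 0"
    consider "i < rank M'" "j < rank M" | "i < rank M'" "j \<ge> rank M" | "i \<ge> rank M'" "j < rank M"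
      | "i \<ge> rank M'" "j \<ge> rank M" by linarith
    then show "(par (theta_mf M') ! i \<noteq> par (theta_mf M) ! j) = p"
    proof cases
      case 1 with ij gradedD[of a p "mf_const M" "mf_const M'" i j] * d show ?thesis by (auto simp: nth_append)
    next
      case 2 with ij gradedD[of b "\<not> p" "mf_const M" "mf_const M'" i "j - rank M"] * d show ?thesis by (auto simp: nth_append)
    next
      case 3 with ij gradedD[of c "\<not> p" "mf_const M" "mf_const M'" "i - rank M'" j] * d show ?thesis by (auto simp: nth_append)
    next
      case 4 with ij gradedD[of d p "mf_const M" "mf_const M'" "i - rank M'" "j - rank M"] * d show ?thesis by (auto simp: nth_append)
    qed
  qed (use d in auto)
qed

theorem theta_is_mf:
  assumes "is_mf w M"
  shows "is_mf (var_x * var_y - const_xy w) (theta_mf M)"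
proof -
  let ?T = "sign_mat (par M) :: 'a fps fps mat" and ?W = "swap_opr M"
  have "opr (theta_mf M) \<in> graded_maps True (theta_mf M) (theta_mf M)"
    unfolding theta_opr'[OF assms]
    using assms swap_opr_simps[OF assms] sign_mat_graded[of "mf_const M"]
    by (subst theta_graded_iff) (auto intro!: graded_smult)
  moreover have "opr (theta_mf M) * opr (theta_mf M) = (var_x * var_y - const_xy w) \<cdot>\<^sub>m 1\<^sub>m (rank (theta_mf M))"
  proof -
    have *: "?W * ?W + var_y \<cdot>\<^sub>m ?T * (var_x \<cdot>\<^sub>m ?T) = (var_x * var_y - const_xy w) \<cdot>\<^sub>m 1\<^sub>m (rank M)"
      "var_x \<cdot>\<^sub>m ?T * (var_y \<cdot>\<^sub>m ?T) + ?W * ?W = (var_x * var_y - const_xy w) \<cdot>\<^sub>m 1\<^sub>m (rank M)"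
      "?W * (var_y \<cdot>\<^sub>m ?T) + var_y \<cdot>\<^sub>m ?T * ?W = 0\<^sub>m (rank M) (rank M)"
      "var_x \<cdot>\<^sub>m ?T * ?W + ?W * (var_x \<cdot>\<^sub>m ?T) = 0\<^sub>m (rank M) (rank M)"
      using assms swap_opr_simps[OF assms]
      by (auto simp: mat_smultl mat_smultr mat_smult_smult algebra_simps intro!: eq_matI)
    show ?thesis
      unfolding theta_opr'[OF assms]
      using assms by (simp add: four_mult *) (rule eq_matI; auto)
  qed
  ultimately show ?thesis by (simp add: is_mf_def)
qed

lemma theta_chain_iff:
  assumes mfs: "is_mf w M" "is_mf w M'"
    and d: "dim_row a = rank M'" "dim_col a = rank M" "dim_row b = rank M'" "dim_col b = rank M"
    "dim_row c = rank M'" "dim_col c = rank M" "dim_row d = rank M'" "dim_col d = rank M"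
  shows "four_block_mat a b c d \<in> chain_maps (theta_mf M) (theta_mf M') \<longleftrightarrow>
    (a \<in> graded_maps False (mf_const M) (mf_const M') \<and> b \<in> graded_maps True (mf_const M) (mf_const M') \<and>
     c \<in> graded_maps True (mf_const M) (mf_const M') \<and> d \<in> graded_maps False (mf_const M) (mf_const M')) \<and>
    swap_opr M' * a + var_y \<cdot>\<^sub>m (sign_mat (par M') * c) = a * swap_opr M + var_x \<cdot>\<^sub>m (b * sign_mat (par M)) \<and>
    swap_opr M' * b + var_y \<cdot>\<^sub>m (sign_mat (par M') * d) = var_y \<cdot>\<^sub>m (a * sign_mat (par M)) + b * swap_opr M \<and>
    var_x \<cdot>\<^sub>m (sign_mat (par M') * a) + swap_opr M' * c = c * swap_opr M + var_x \<cdot>\<^sub>m (d * sign_mat (par M)) \<and>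
    var_x \<cdot>\<^sub>m (sign_mat (par M') * b) + swap_opr M' * d = var_y \<cdot>\<^sub>m (c * sign_mat (par M)) + d * swap_opr M"
    (is "?f \<in> _ \<longleftrightarrow> ?G \<and> ?E")
proof -
  have "opr (theta_mf M') * ?f = ?f * opr (theta_mf M) \<longleftrightarrow> ?E"
    unfolding theta_opr'[OF mfs(1)] theta_opr'[OF mfs(2)]
    using mfs d
    by (auto simp: four_mult mat_smultl mat_smultr dest: four_eqD)
  then show ?thesis
    unfolding chain_iff[OF theta_is_mf[OF mfs(1)] theta_is_mf[OF mfs(2)]] theta_graded_iff[OF d] by simp
qed

lemma add_zero_mat [simp]:
  fixes A :: "'a::comm_ring_1 mat"
  assumes "dim_row A = m" "dim_col A = n"
  shows "A + 0\<^sub>m m n = A" "0\<^sub>m m n + A = A"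
  using assms by (auto intro!: eq_matI)

section \<open>\<open>\<theta>\<close> is a functor\<close>

lemma theta_map_dim [simp]:
  "dim_row (theta_map M f) = 2 * dim_row f" "dim_col (theta_map M f) = 2 * dim_col f"
  by (auto simp: theta_map_def koszul_tensor_def)

lemma theta_rank [simp]: "rank (theta_mf M) = 2 * rank M"
  by simp

lemma theta_map_mult:
  assumes "dim_col f = rank M" "dim_row f = rank M'" "dim_col g = rank M'"
  shows "theta_map M (g * f) = theta_map M' g * theta_map M f"
  using assms by (simp add: theta_map_eq four_mult cm_mult)

lemma theta_map_one: "theta_map M (1\<^sub>m (rank M)) = 1\<^sub>m (rank (theta_mf M))"
  by (simp add: theta_map_eq cm_simps)

lemma theta_map_chain:
  assumes mfs: "is_mf w M" "is_mf w M'" and f: "f \<in> chain_maps M M'"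
  shows "theta_map M f \<in> chain_maps (theta_mf M) (theta_mf M')"
proof -
  let ?T = "sign_mat (par M)" and ?T' = "sign_mat (par M')"
  note mf = is_mfD[OF mfs(1)] is_mfD[OF mfs(2)]
  note fd = chainD[OF f]
  have fe: "opr M' * f = f * opr M" using f mfs by (auto simp: chain_iff)
  have T: "?T' * cm f = cm f * ?T" using sign_mat_even[OF cm_graded[OF fd(1)]] by simp
  have "swap_opr M' * cm f = cm (opr M' * f) * ?T" using mf fd T by (simp add: swap_opr_def mat_assoc cm_mult)
  also have "\<dots> = cm f * swap_opr M" using mf fd unfolding fe by (simp add: swap_opr_def mat_assoc cm_mult)
  finally have W: "swap_opr M' * cm f = cm f * swap_opr M" .
  show ?thesis
    unfolding theta_map_eq[OF fd(3)]
    using mfs fd T W graded_zero[of "mf_const M'" "mf_const M"]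
    by (subst theta_chain_iff[OF mfs]) (auto simp: cm_graded mat_smultr)
qed

lemma theta_htp:
  assumes mfs: "is_mf w M" "is_mf w M'" and f: "htp M M' f g"
  shows "htp (theta_mf M) (theta_mf M') (theta_map M f) (theta_map M g)"
proof -
  let ?T = "sign_mat (par M) :: 'a fps fps mat" and ?T' = "sign_mat (par M') :: 'a fps fps mat"
  note mf = is_mfD[OF mfs(1)] is_mfD[OF mfs(2)]
  note fd = chainD[OF htpD(1)[OF f]] chainD[OF htpD(2)[OF f]]
  obtain h where h: "h \<in> graded_maps True M M'" "f = g + (opr M' * h + h * opr M)"
    using htpE[OF mfs f] .
  \<comment> \<open>since $\theta$ uses $Q T$ instead of $Q$, the homotopy has to be twisted by the sign matrix as well\<close>
  define k where "k = ?T' * cm h"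
  have kd: "dim_row k = rank M'" "dim_col k = rank M" using h by (auto simp: k_def)
  have kT: "k = - (cm h * ?T)"
    unfolding k_def using sign_mat_odd[OF cm_graded[OF h(1)]] by simp
  have kg: "k \<in> graded_maps True (mf_const M) (mf_const M')"
    unfolding k_def using graded_mult_odd[OF cm_graded[OF h(1)] sign_mat_graded[of "mf_const M'"]] by simp
  have Tk: "?T' * k = - (k * ?T)" using sign_mat_odd[OF kg] by simp
  have W1: "swap_opr M' * k = cm (opr M' * h)"
    using mf h by (simp add: swap_opr_def k_def mat_assoc cm_mult)
  have oT: "?T * cm (opr M) = - (cm (opr M) * ?T)"
    using sign_mat_odd[OF cm_graded[OF mf(1)]] by simp
  have "k * swap_opr M = - (cm h * (?T * (cm (opr M) * ?T)))"
    unfolding kT using mf h by (simp add: swap_opr_def mat_assoc)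
  also have "?T * (cm (opr M) * ?T) = (?T * cm (opr M)) * ?T" using mf by (simp add: mat_assoc)
  also have "\<dots> = - cm (opr M)" unfolding oT using mf by (simp add: mat_assoc)
  finally have W2: "k * swap_opr M = cm (h * opr M)" using mf h by (simp add: cm_mult)
  let ?h = "four_block_mat k (0\<^sub>m (rank M') (rank M)) (0\<^sub>m (rank M') (rank M)) k"
  show ?thesis
  proof (rule htpI[OF theta_is_mf[OF mfs(1)] theta_is_mf[OF mfs(2)]])
    show "theta_map M f \<in> chain_maps (theta_mf M) (theta_mf M')" "theta_map M g \<in> chain_maps (theta_mf M) (theta_mf M')"
      using theta_map_chain[OF mfs] htpD[OF f] by auto
    show "?h \<in> graded_maps True (theta_mf M) (theta_mf M')"
      using kd kg graded_zero[of "mf_const M'" "mf_const M"] by (subst theta_graded_iff) auto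
    have f': "cm f = cm g + (cm (opr M' * h) + cm (h * opr M))"
      unfolding h(2) using mf h fd by (simp add: cm_add)
    have Tk0: "var_y \<cdot>\<^sub>m (?T' * k) + var_y \<cdot>\<^sub>m (k * ?T) = 0\<^sub>m (rank M') (rank M)"
      "var_x \<cdot>\<^sub>m (?T' * k) + var_x \<cdot>\<^sub>m (k * ?T) = 0\<^sub>m (rank M') (rank M)"
      unfolding Tk using kd by (auto intro!: eq_matI)
    show "theta_map M f = theta_map M g + (opr (theta_mf M') * ?h + ?h * opr (theta_mf M))"
      unfolding theta_opr'[OF mfs(1)] theta_opr'[OF mfs(2)] theta_map_eq[OF fd(3)] theta_map_eq[OF fd(6)]
      using mfs mf kd fd h(1) Tk0
      by (simp add: four_mult four_add W1 W2 mat_smultl mat_smultr f')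
  qed
qed

lemma theta_mor_class:
  assumes mfs: "is_mf w M" "is_mf w M'" and f: "f \<in> chain_maps M M'"
  shows "theta_mor M M' (mor_class M M' f) = mor_class (theta_mf M) (theta_mf M') (theta_map M f)"
proof -
  have "mor_class (theta_mf M) (theta_mf M') (theta_map M g) = mor_class (theta_mf M) (theta_mf M') (theta_map M f)"
    if "htp M M' f g" for g
    using theta_htp[OF mfs htp_sym[OF mfs that]] theta_map_chain[OF mfs] htpD[OF that]
    by (subst mor_class_eq_iff[OF theta_is_mf[OF mfs(1)] theta_is_mf[OF mfs(2)]]) auto
  then show ?thesis unfolding theta_mor_def using mor_class_mem[OF mfs f] by blast
qed

lemma theta_functor: "is_functor (MF_cat w) (MF_cat (var_x * var_y - const_xy w)) theta"
proof (intro is_functor.intro is_functor_axioms.intro category_MF)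
  fix X assume "X \<in> Obj (MF_cat w)"
  then show "on_obj theta X \<in> Obj (MF_cat (var_x * var_y - const_xy w))"
    by (simp add: theta_def MF_cat_simps theta_is_mf)
next
  fix X Y f assume "X \<in> Obj (MF_cat w)" "Y \<in> Obj (MF_cat w)" "f \<in> Hom (MF_cat w) X Y"
  then show "on_mor theta X Y f \<in> Hom (MF_cat (var_x * var_y - const_xy w)) (on_obj theta X) (on_obj theta Y)"
    using theta_map_chain[of w X Y] by (auto simp: theta_def MF_cat_simps Ext_iff theta_mor_class)
next
  fix X assume "X \<in> Obj (MF_cat w)"
  then show "on_mor theta X X (Ident (MF_cat w) X) = Ident (MF_cat (var_x * var_y - const_xy w)) (on_obj theta X)"
    using chain_one[of w X] theta_map_one[of X] by (simp add: theta_def MF_cat_simps theta_mor_class)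
next
  fix X Y Z f g
  assume mfs: "X \<in> Obj (MF_cat w)" "Y \<in> Obj (MF_cat w)" "Z \<in> Obj (MF_cat w)"
    and "f \<in> Hom (MF_cat w) X Y" "g \<in> Hom (MF_cat w) Y Z"
  then obtain f' g' where *: "f' \<in> chain_maps X Y" "f = mor_class X Y f'"
    "g' \<in> chain_maps Y Z" "g = mor_class Y Z g'"
    by (auto simp: MF_cat_simps Ext_iff)
  note m = mfs[unfolded MF_cat_simps]
  note t = theta_is_mf[OF m(1)] theta_is_mf[OF m(2)] theta_is_mf[OF m(3)]
  show "on_mor theta X Z (Comp (MF_cat w) X Y Z g f) =
       Comp (MF_cat (var_x * var_y - const_xy w)) (on_obj theta X) (on_obj theta Y) (on_obj theta Z)
        (on_mor theta Y Z g) (on_mor theta X Y f)"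
    unfolding *(2,4) class_comp[OF m *(1,3)]
    using chainD[OF *(1)] chainD[OF *(3)]
    by (simp add: theta_def theta_mor_class[OF m(1,3) chain_mult[OF m *(1,3)]] theta_mor_class[OF m(1,2) *(1)]
        theta_mor_class[OF m(2,3) *(3)] class_comp[OF t theta_map_chain[OF m(1,2) *(1)] theta_map_chain[OF m(2,3) *(3)]]
        theta_map_mult[of _ _ Y])
qed

section \<open>\<open>\<theta>\<close> is fully faithful\<close>

lemma four_split:
  assumes "dim_row A = 2 * m" "dim_col A = 2 * n"
  obtains a b c d where "A = four_block_mat a b c d"
    "dim_row a = m" "dim_col a = n" "dim_row b = m" "dim_col b = n"
    "dim_row c = m" "dim_col c = n" "dim_row d = m" "dim_col d = n"
proof
  show "A = four_block_mat (mat m n (\<lambda>(i, j). A $$ (i, j))) (mat m n (\<lambda>(i, j). A $$ (i, j + n)))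
     (mat m n (\<lambda>(i, j). A $$ (i + m, j))) (mat m n (\<lambda>(i, j). A $$ (i + m, j + n)))"
    by (rule eq_matI) (use assms in auto)
qed auto

text \<open>
  The upper left block at $x = y = 0$ of a homotopy between $\theta(f)$ and $\theta(g)$ is, up to the sign
  matrix, a homotopy between $f$ and $g$.
\<close>

lemma theta_faithful:
  assumes mfs: "is_mf w M" "is_mf w M'" and f: "f \<in> chain_maps M M'" "g \<in> chain_maps M M'"
    and e: "htp (theta_mf M) (theta_mf M') (theta_map M f) (theta_map M g)"
  shows "htp M M' f g"
proof -
  let ?T = "sign_mat (par M) :: 'a mat" and ?T' = "sign_mat (par M') :: 'a mat"
  note mf = is_mfD[OF mfs(1)] is_mfD[OF mfs(2)]
  note fd = chainD[OF f(1)] chainD[OF f(2)]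
  obtain H where H: "H \<in> graded_maps True (theta_mf M) (theta_mf M')"
    "theta_map M f = theta_map M g + (opr (theta_mf M') * H + H * opr (theta_mf M))"
    using htpE[OF theta_is_mf[OF mfs(1)] theta_is_mf[OF mfs(2)] e] .
  have Hd: "dim_row H = 2 * rank M'" "dim_col H = 2 * rank M" using graded_dim[OF H(1)] by auto
  obtain h1 h2 h3 h4 where H4: "H = four_block_mat h1 h2 h3 h4"
    and d: "dim_row h1 = rank M'" "dim_col h1 = rank M" "dim_row h2 = rank M'" "dim_col h2 = rank M"
    "dim_row h3 = rank M'" "dim_col h3 = rank M" "dim_row h4 = rank M'" "dim_col h4 = rank M"
    using four_split[OF Hd] .
  define k where "k = em h1"
  have kg: "k \<in> graded_maps True M M'"
    unfolding k_def using H(1) unfolding H4 theta_graded_iff[OF d]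
    by (auto intro!: map_mat_graded simp: ev_xy_hom)
  have kd: "dim_row k = rank M'" "dim_col k = rank M" using kg by auto
  have "cm f = cm g + ((swap_opr M' * h1 + var_y \<cdot>\<^sub>m (sign_mat (par M') * h3)) + (h1 * swap_opr M + var_x \<cdot>\<^sub>m (h2 * sign_mat (par M))))"
    using H(2) unfolding theta_opr'[OF mfs(1)] theta_opr'[OF mfs(2)] theta_map_eq[OF fd(3)] theta_map_eq[OF fd(6)] H4
    using mfs mf d fd
    by (auto simp: four_mult four_add mat_smultl mat_smultr dest!: four_eqD(1))
  from arg_cong[OF this, of em]
  have "f = g + ((opr M' * ?T' * k) + (k * (opr M * ?T)))"
    using mfs mf d fd
    by (simp add: em_add em_mult em_simps swap_opr_simps(4)[OF mfs(1)] swap_opr_simps(4)[OF mfs(2)] k_def)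
  also have "opr M' * ?T' * k = opr M' * (?T' * k)" using mf kd by (simp add: mat_assoc)
  also have "k * (opr M * ?T) = - (k * (?T * opr M))" using mf kd sign_mat_odd[OF mf(1)] by simp
  also have "\<dots> = (?T' * k) * opr M" using mf kd sign_mat_odd[OF kg] by (simp add: mat_assoc[symmetric])
  finally show ?thesis
    using graded_mult_odd[OF kg sign_mat_graded[of M']] by (intro htpI[OF mfs f, of "?T' * k"]) auto
qed

text \<open>
  For a chain map with upper left block zero the first block equation reads $y T' c = x b T$. As
  $(x, y)$ is regular, $b T = y e$ and $T' c = x e$ for one and the same $e$, and $T' e T$, placed in
  the lower right block, is a null-homotopy.
\<close>

lemma theta_null:
  assumes mfs: "is_mf w M" "is_mf w M'"
    and d: "dim_row b = rank M'" "dim_col b = rank M"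
    "dim_row c = rank M'" "dim_col c = rank M" "dim_row d = rank M'" "dim_col d = rank M"
    and f: "four_block_mat (0\<^sub>m (rank M') (rank M)) b c d \<in> chain_maps (theta_mf M) (theta_mf M')" (is "?f \<in> _")
  shows "htp (theta_mf M) (theta_mf M') ?f (0\<^sub>m (2 * rank M') (2 * rank M))"
proof -
  let ?T = "sign_mat (par M) :: 'a fps fps mat" and ?T' = "sign_mat (par M') :: 'a fps fps mat"
  note mf = is_mfD[OF mfs(1)] is_mfD[OF mfs(2)]
  note sw = swap_opr_simps[OF mfs(1)] swap_opr_simps[OF mfs(2)]
  note F = f[unfolded theta_chain_iff[OF mfs _ _ d, of "0\<^sub>m (rank M') (rank M)", simplified]]
  have E1: "var_y \<cdot>\<^sub>m (?T' * c) = var_x \<cdot>\<^sub>m (b * ?T)"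
    and E2: "swap_opr M' * b + var_y \<cdot>\<^sub>m (?T' * d) = b * swap_opr M"
    and bg: "b \<in> graded_maps True (mf_const M) (mf_const M')"
    using F mfs d by auto
  define e where "e = map_mat quot_y (b * ?T)"
  have ed: "dim_row e = rank M'" "dim_col e = rank M" using d by (auto simp: e_def)
  have bT: "b * ?T = var_y \<cdot>\<^sub>m e" and Tc: "?T' * c = var_x \<cdot>\<^sub>m e"
    using mat_xy_independent[OF E1] by (auto simp: e_def)
  have eg: "e \<in> graded_maps True (mf_const M) (mf_const M')"
    unfolding e_def using graded_mult_even[OF sign_mat_graded[of "mf_const M"] bg]
    by (intro map_mat_graded[where M = "mf_const M" and M' = "mf_const M'"]) (auto simp: quot_zero)
  define h where "h = ?T' * e * ?T"
  have hd: "dim_row h = rank M'" "dim_col h = rank M" using ed by (auto simp: h_def)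
  have hg: "h \<in> graded_maps True (mf_const M) (mf_const M')"
    unfolding h_def using graded_mult_even[OF sign_mat_graded[of "mf_const M"] graded_mult_odd[OF eg sign_mat_graded[of "mf_const M'"]]] by simp
  have "b = b * ?T * ?T" using d by (simp add: mat_assoc)
  also have "\<dots> = var_y \<cdot>\<^sub>m (?T' * h)" unfolding bT h_def using ed by (simp add: mat_assoc mat_smultl)
  finally have b: "b = var_y \<cdot>\<^sub>m (?T' * h)" .
  have "c = ?T' * (?T' * c)" using d by simp
  also have "\<dots> = var_x \<cdot>\<^sub>m (h * ?T)" unfolding Tc h_def using ed by (simp add: mat_assoc mat_smultr)
  finally have c: "c = var_x \<cdot>\<^sub>m (h * ?T)" .
  have "var_y \<cdot>\<^sub>m (?T' * d) = var_y \<cdot>\<^sub>m (?T' * (swap_opr M' * h + h * swap_opr M))"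
  proof -
    have x: "?T' * (swap_opr M' * h) = - (swap_opr M' * (?T' * h))"
      using mfs hd sw(5) by (simp add: mat_assoc[symmetric])
    have "var_y \<cdot>\<^sub>m (?T' * d) = b * swap_opr M - swap_opr M' * b"
      unfolding E2[symmetric] by (rule eq_matI) (use mfs d in \<open>auto\<close>)
    also have "\<dots> = var_y \<cdot>\<^sub>m (?T' * (swap_opr M' * h + h * swap_opr M))"
      unfolding b using mfs hd x
      by (auto intro!: eq_matI simp: mat_ring algebra_simps)
    finally show ?thesis .
  qed
  then have "?T' * (?T' * d) = ?T' * (?T' * (swap_opr M' * h + h * swap_opr M))"
    using mat_var_y_cancel by metis
  then have dd: "d = swap_opr M' * h + h * swap_opr M" using d mfs hd by simp
  have z: "0\<^sub>m (2 * rank M') (2 * rank M) \<in> chain_maps (theta_mf M) (theta_mf M')"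
    using graded_zero[of "theta_mf M'" "theta_mf M"] is_mfD[OF theta_is_mf[OF mfs(1)]] is_mfD[OF theta_is_mf[OF mfs(2)]]
    by (auto simp: chain_iff[OF theta_is_mf[OF mfs(1)] theta_is_mf[OF mfs(2)]] mult_2)
  let ?h = "four_block_mat (0\<^sub>m (rank M') (rank M)) (0\<^sub>m (rank M') (rank M)) (0\<^sub>m (rank M') (rank M)) h"
  show ?thesis
  proof (rule htpI[OF theta_is_mf[OF mfs(1)] theta_is_mf[OF mfs(2)] f z])
    show "?h \<in> graded_maps True (theta_mf M) (theta_mf M')"
      using hd hg graded_zero[of "mf_const M'" "mf_const M"] by (subst theta_graded_iff) auto
    have "opr (theta_mf M') * ?h + ?h * opr (theta_mf M) = ?f"
      unfolding theta_opr'[OF mfs(1)] theta_opr'[OF mfs(2)]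
      using mfs mf hd d by (simp add: four_mult four_add mat_smultl mat_smultr b[symmetric] c[symmetric] dd[symmetric])
    moreover have "dim_row ?f = 2 * rank M'" "dim_col ?f = 2 * rank M" using d by auto
    ultimately show "?f = 0\<^sub>m (2 * rank M') (2 * rank M) + (opr (theta_mf M') * ?h + ?h * opr (theta_mf M))"
      by (simp add: left_add_zero_mat[OF carrier_matI])
  qed
qed

text \<open>
  The constant term $g$ of the upper left block is the preimage. Once $\theta(g)$ is subtracted, that block
  has the form $x a_1 + y a_2$, and a homotopy with off-diagonal blocks $a_1$ and $a_2$, up to signs, removes it.
\<close>

lemma theta_full:
  assumes mfs: "is_mf w M" "is_mf w M'" and F: "F \<in> chain_maps (theta_mf M) (theta_mf M')"
  obtains g where "g \<in> chain_maps M M'" "htp (theta_mf M) (theta_mf M') F (theta_map M g)"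
proof -
  let ?T = "sign_mat (par M) :: 'a fps fps mat" and ?T' = "sign_mat (par M') :: 'a fps fps mat"
  note mf = is_mfD[OF mfs(1)] is_mfD[OF mfs(2)]
  note sw = swap_opr_simps[OF mfs(1)] swap_opr_simps[OF mfs(2)]
  note ms = theta_is_mf[OF mfs(1)] theta_is_mf[OF mfs(2)]
  have Fd: "dim_row F = 2 * rank M'" "dim_col F = 2 * rank M" using chainD(2,3)[OF F] by auto
  obtain a b c d where F4: "F = four_block_mat a b c d"
    and dm: "dim_row a = rank M'" "dim_col a = rank M" "dim_row b = rank M'" "dim_col b = rank M"
    "dim_row c = rank M'" "dim_col c = rank M" "dim_row d = rank M'" "dim_col d = rank M"
    using four_split[OF Fd] .
  note Fe = F[unfolded F4 theta_chain_iff[OF mfs dm]]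
  define g where "g = em a"
  have gg: "g \<in> graded_maps False M M'"
    unfolding g_def using Fe by (auto intro!: map_mat_graded simp: ev_xy_hom)
  have gd: "dim_row g = rank M'" "dim_col g = rank M" using gg by auto
  have "em (swap_opr M' * a + var_y \<cdot>\<^sub>m (?T' * c)) = em (a * swap_opr M + var_x \<cdot>\<^sub>m (b * ?T))"
    using Fe by simp
  then have "opr M' * sign_mat (par M') * g = g * (opr M * sign_mat (par M))"
    using mfs mf dm by (simp add: em_add em_mult em_simps sw(4,8) g_def)
  then have "opr M' * g * sign_mat (par M) = g * opr M * sign_mat (par M)"
    using mf gd sign_mat_even[OF gg] by (simp add: mat_assoc)
  then have "opr M' * g * sign_mat (par M) * sign_mat (par M) = g * opr M * sign_mat (par M) * sign_mat (par M)"
    by simp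
  then have "opr M' * g = g * opr M" using mf gd by (simp add: mat_assoc)
  then have g: "g \<in> chain_maps M M'" using gg mfs by (simp add: chain_iff)
  note tg = theta_map_chain[OF mfs g]
  \<comment> \<open>after subtracting \<open>\<theta>(g)\<close> the upper left block lies in the ideal $(x, y)$\<close>
  define h2 where "h2 = map_mat quot_x a * ?T"
  define h3 where "h3 = ?T' * map_mat quot_y a"
  have hd: "dim_row h2 = rank M'" "dim_col h2 = rank M" "dim_row h3 = rank M'" "dim_col h3 = rank M"
    using dm by (auto simp: h2_def h3_def)
  have hg: "h2 \<in> graded_maps False (mf_const M) (mf_const M')" "h3 \<in> graded_maps False (mf_const M) (mf_const M')"
  proof -
    have "map_mat quot_x a \<in> graded_maps False (mf_const M) (mf_const M')" "map_mat quot_y a \<in> graded_maps False (mf_const M) (mf_const M')"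
      using Fe by (auto intro!: map_mat_graded[where M = "mf_const M" and M' = "mf_const M'"] simp: quot_zero)
    then show "h2 \<in> graded_maps False (mf_const M) (mf_const M')" "h3 \<in> graded_maps False (mf_const M) (mf_const M')"
      unfolding h2_def h3_def
      using graded_mult_even[OF sign_mat_graded[of "mf_const M"]] graded_mult_even[OF _ sign_mat_graded[of "mf_const M'"]] by auto
  qed
  let ?Z = "0\<^sub>m (rank M') (rank M) :: 'a fps fps mat"
  let ?H = "four_block_mat ?Z h2 h3 ?Z"
  let ?D = "opr (theta_mf M') * ?H + ?H * opr (theta_mf M)"
  have Hg: "?H \<in> graded_maps True (theta_mf M) (theta_mf M')"
    using hd hg graded_zero[of "mf_const M'" "mf_const M"] by (subst theta_graded_iff) auto
  define b' where "b' = b - (swap_opr M' * h2 + h2 * swap_opr M)"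
  define c' where "c' = c - (swap_opr M' * h3 + h3 * swap_opr M)"
  define d' where "d' = d - cm g - (var_x \<cdot>\<^sub>m (?T' * h2) + var_y \<cdot>\<^sub>m (h3 * ?T))"
  have d'd: "dim_row b' = rank M'" "dim_col b' = rank M"
    "dim_row c' = rank M'" "dim_col c' = rank M" "dim_row d' = rank M'" "dim_col d' = rank M"
    using mfs dm hd gd by (auto simp: b'_def c'_def d'_def)
  have ae: "a = cm g + (var_x \<cdot>\<^sub>m (h2 * ?T) + var_y \<cdot>\<^sub>m (?T' * h3))"
    unfolding h2_def h3_def g_def using dm by (simp add: mat_assoc mat_xy_decomp[symmetric])
  let ?F' = "four_block_mat ?Z b' c' d'"
  have split: "F = theta_map M g + (?F' + ?D)"
  proof -
    have D: "?D = four_block_mat (var_x \<cdot>\<^sub>m (h2 * ?T) + var_y \<cdot>\<^sub>m (?T' * h3)) (swap_opr M' * h2 + h2 * swap_opr M)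
      (swap_opr M' * h3 + h3 * swap_opr M) (var_x \<cdot>\<^sub>m (?T' * h2) + var_y \<cdot>\<^sub>m (h3 * ?T))"
      unfolding theta_opr'[OF mfs(1)] theta_opr'[OF mfs(2)]
      using mfs mf hd
      by (simp add: four_mult four_add mat_smultl mat_smultr)
        (rule cong_four_block_mat; rule eq_matI; simp add: add.commute)
    show ?thesis
      unfolding D F4 theta_map_eq[OF gd(2)] gd(1)
      using d'd dm gd hd mfs
      apply (simp add: four_add)
      apply (rule cong_four_block_mat)
      subgoal by (subst ae) simp
      subgoal by (rule eq_matI) (auto simp: b'_def)
      subgoal by (rule eq_matI) (auto simp: c'_def)
      subgoal by (rule eq_matI) (auto simp: d'_def)
      done
  qed
  note od = is_mfD[OF ms(1)] is_mfD[OF ms(2)]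
  have Hd: "dim_row ?H = 2 * rank M'" "dim_col ?H = 2 * rank M" using hd by auto
  have "?D \<in> chain_maps (theta_mf M) (theta_mf M')"
  proof -
    have g: "?D \<in> graded_maps False (theta_mf M) (theta_mf M')"
      using graded_mult_odd[OF Hg od(5)] graded_mult_odd[OF od(1) Hg] by (intro graded_add) auto
    have "opr (theta_mf M') * (opr (theta_mf M') * ?H) = ?H * (opr (theta_mf M) * opr (theta_mf M))"
      using od Hd unfolding od(2) by (simp add: mat_assoc[symmetric] od(6) mat_smultl mat_smultr)
    then have "opr (theta_mf M') * ?D = ?D * opr (theta_mf M)"
      using od Hd by (simp add: mat_assoc mat_distl mat_distr)
         (auto intro!: eq_matI simp: add.commute)
    with g show ?thesis by (simp add: chain_iff[OF ms])
  qed
  then have FD: "F - theta_map M g - ?D \<in> chain_maps (theta_mf M) (theta_mf M')"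
    by (intro chain_minus[OF ms] F tg)
  moreover have "F - theta_map M g - ?D = ?F'"
    unfolding split by (rule eq_matI) (use d'd gd od Hd in \<open>auto simp del: index_mat_four_block(1)\<close>)
  ultimately have F'c: "?F' \<in> chain_maps (theta_mf M) (theta_mf M')" by simp
  have "htp (theta_mf M) (theta_mf M') ?F' (0\<^sub>m (2 * rank M') (2 * rank M))"
    by (rule theta_null[OF mfs d'd F'c])
  then obtain K where K: "K \<in> graded_maps True (theta_mf M) (theta_mf M')"
    "?F' = 0\<^sub>m (2 * rank M') (2 * rank M) + (opr (theta_mf M') * K + K * opr (theta_mf M))"
    using htpE[OF ms] by metis
  have "htp (theta_mf M) (theta_mf M') F (theta_map M g)"
  proof (rule htpI[OF ms F tg graded_add[OF K(1) Hg]])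
    show "F = theta_map M g + (opr (theta_mf M') * (K + ?H) + (K + ?H) * opr (theta_mf M))"
      unfolding split K(2)
      by (rule eq_matI) (use K(1) gd od Hd in \<open>auto simp: mat_distl mat_distr simp del: index_mat_four_block(1)\<close>)
  qed
  with g show ?thesis by (rule that)
qed

section \<open>Every matrix factorization is a homotopy retract of some \<open>\<theta>(M)\<close>\<close>

lemma mat_diff_from_sum:
  fixes A B C :: "'a::comm_ring_1 mat"
  assumes "A + B = C" "dim_row A = dim_row B" "dim_col A = dim_col B"
  shows "A = C - B"
  by (rule eq_matI) (use assms in auto)

text \<open>
  In the application $Q$ is the operator of a factorization $N$ of $x y - \pi$, the matrices $Q_1$ and
  $Q_0$ are its values at $y = 0$ and at $x = y = 0$, the matrices $F, G, H, J$ are divided differences,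
  and $s$ is the derivative of $Q$ with respect to $x$.
  
  Two steps are composed. First, $N$ is a retract of $(N/y) \otimes E$, where $E = (x, y)$: as $s$ is
  a contraction of $y$ on $N$, the pair $(F, 1)$ is a chain map with right inverse $(s, 1 - F s)$.
  Secondly, $H$ contracts $x$ on $N/y$, and this makes $u = 1 - H G$ a chain map from $N/(x, y)$ to
  $N/y$. The composite $F u r + u i_1$ of the resulting maps $N \to (N/(x, y)) \otimes E \to N$ differs
  from the identity by a term that is a boundary because $F H = - (Q J + J Q_1)$.
\<close>

lemma retract_identities:
  fixes Q Q\<^sub>1 Q\<^sub>0 F G H J s :: "'a::comm_ring_1 mat" and x y :: 'a
  assumes dims [simp]: "dim_row Q = n" "dim_col Q = n" "dim_row Q\<^sub>1 = n" "dim_col Q\<^sub>1 = n"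
      "dim_row Q\<^sub>0 = n" "dim_col Q\<^sub>0 = n" "dim_row F = n" "dim_col F = n" "dim_row G = n" "dim_col G = n"
      "dim_row H = n" "dim_col H = n" "dim_row J = n" "dim_col J = n" "dim_row s = n" "dim_col s = n"
    and Q: "Q = Q\<^sub>1 + y \<cdot>\<^sub>m F" and Q1: "Q\<^sub>1 = Q\<^sub>0 + x \<cdot>\<^sub>m G" and F: "F = H + y \<cdot>\<^sub>m J"
    and e1: "Q\<^sub>1 * G + G * Q\<^sub>0 = 0\<^sub>m n n"
    and e2: "Q * F + F * Q\<^sub>1 = x \<cdot>\<^sub>m 1\<^sub>m n"
    and e3: "Q\<^sub>1 * H + H * Q\<^sub>1 = x \<cdot>\<^sub>m 1\<^sub>m n"
    and e4: "F * H + (Q * J + J * Q\<^sub>1) = 0\<^sub>m n n"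
    and e5: "s * Q + Q * s = y \<cdot>\<^sub>m 1\<^sub>m n"
  defines "u \<equiv> 1\<^sub>m n - H * G" and "i1 \<equiv> 1\<^sub>m n - F * s"
  defines "r \<equiv> s + G * i1" and "k \<equiv> - (J * (G * (G * i1)) + J * (G * s))"
  shows "Q * u = u * Q\<^sub>0 + y \<cdot>\<^sub>m (F * u)"
    and "Q * (F * u) = x \<cdot>\<^sub>m u - F * u * Q\<^sub>0"
    and "Q\<^sub>0 * r + r * Q = y \<cdot>\<^sub>m i1"
    and "x \<cdot>\<^sub>m r + Q\<^sub>0 * i1 = i1 * Q"
    and "1\<^sub>m n = F * u * r + u * i1 + (Q * k + k * Q)"
proof -
  note mr = mat_ring
  have ud [simp]: "dim_row u = n" "dim_col u = n" "dim_row i1 = n" "dim_col i1 = n"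
    "dim_row r = n" "dim_col r = n" "dim_row k = n" "dim_col k = n"
    by (auto simp: u_def i1_def r_def k_def)
  have GQ0: "G * Q\<^sub>0 = - (Q\<^sub>1 * G)"
  proof -
    have "G * Q\<^sub>0 + Q\<^sub>1 * G = 0\<^sub>m n n" using e1 by (subst comm_add_mat[of _ n n]) auto
    from mat_diff_from_sum[OF this] show ?thesis by (auto intro!: eq_matI)
  qed
  have QF: "Q * F = x \<cdot>\<^sub>m 1\<^sub>m n - F * Q\<^sub>1" by (rule mat_diff_from_sum[OF e2]) auto
  have Q1H: "Q\<^sub>1 * H = x \<cdot>\<^sub>m 1\<^sub>m n - H * Q\<^sub>1" by (rule mat_diff_from_sum[OF e3]) auto
  have FH: "F * H = - (Q * J + J * Q\<^sub>1)"
    using mat_diff_from_sum[OF e4] by (auto intro!: eq_matI)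
  have sQ: "s * Q = y \<cdot>\<^sub>m 1\<^sub>m n - Q * s" by (rule mat_diff_from_sum[OF e5]) auto
  have Q1G: "Q\<^sub>1 * G = Q\<^sub>0 * G + x \<cdot>\<^sub>m (G * G)" and GQ1: "G * Q\<^sub>1 = G * Q\<^sub>0 + x \<cdot>\<^sub>m (G * G)"
    by (simp_all add: Q1 mr)
  have Q0G: "Q\<^sub>0 * G = - (G * Q\<^sub>1)"
    using GQ0 unfolding GQ1 Q1G by (auto intro!: eq_matI)
  have Qf: "Q * F = Q\<^sub>1 * F + y \<cdot>\<^sub>m (F * F)" and fQ: "F * Q = F * Q\<^sub>1 + y \<cdot>\<^sub>m (F * F)"
    by (subst Q, simp add: mr)+
  have FQ: "F * Q = x \<cdot>\<^sub>m 1\<^sub>m n - Q\<^sub>1 * F"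
  proof (rule eq_matI)
    fix i j assume ij: "i < dim_row (x \<cdot>\<^sub>m 1\<^sub>m n - Q\<^sub>1 * F)" "j < dim_col (x \<cdot>\<^sub>m 1\<^sub>m n - Q\<^sub>1 * F)"
    have "(Q\<^sub>1 * F + y \<cdot>\<^sub>m (F * F)) $$ (i, j) = (x \<cdot>\<^sub>m 1\<^sub>m n - F * Q\<^sub>1) $$ (i, j)"
      using QF Qf by simp
    then show "(F * Q) $$ (i, j) = (x \<cdot>\<^sub>m 1\<^sub>m n - Q\<^sub>1 * F) $$ (i, j)"
      unfolding fQ using ij by (auto simp: algebra_simps)
  qed auto
  show A: "Q * u = u * Q\<^sub>0 + y \<cdot>\<^sub>m (F * u)"
  proof -
    have "Q * u = Q\<^sub>1 * u + y \<cdot>\<^sub>m (F * u)" by (subst Q) (simp add: mr)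
    also have "Q\<^sub>1 * u = Q\<^sub>1 - (Q\<^sub>1 * H) * G" by (simp add: u_def mr)
    also have "\<dots> = Q\<^sub>0 - H * (G * Q\<^sub>0)" unfolding Q1H GQ0
      by (rule eq_matI) (auto simp: mr Q1)
    also have "\<dots> = u * Q\<^sub>0" by (simp add: u_def mr)
    finally show ?thesis .
  qed
  show "Q * (F * u) = x \<cdot>\<^sub>m u - F * u * Q\<^sub>0"
  proof -
    have Q1u: "Q\<^sub>1 * u = u * Q\<^sub>0"
    proof -
      have "Q * u = Q\<^sub>1 * u + y \<cdot>\<^sub>m (F * u)" by (subst Q) (simp add: mr)
      with A have "u * Q\<^sub>0 + y \<cdot>\<^sub>m (F * u) = Q\<^sub>1 * u + y \<cdot>\<^sub>m (F * u)" by simp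
      from mat_diff_from_sum[OF this] show ?thesis by (auto intro!: eq_matI)
    qed
    have "Q * (F * u) = (Q * F) * u" by (simp add: mr)
    also have "\<dots> = x \<cdot>\<^sub>m u - F * (Q\<^sub>1 * u)" unfolding QF by (simp add: mr)
    finally show ?thesis unfolding Q1u by (simp add: mr)
  qed
  have i1Q: "i1 * Q = Q\<^sub>1 * i1 + x \<cdot>\<^sub>m s"
  proof -
    have "i1 * Q = Q - F * (s * Q)" by (simp add: i1_def mr)
    also have "\<dots> = Q - y \<cdot>\<^sub>m F + F * Q * s" unfolding sQ
      by (rule eq_matI) (auto simp: mr)
    also have "Q - y \<cdot>\<^sub>m F = Q\<^sub>1" by (subst Q) (auto intro!: eq_matI)
    finally show ?thesis unfolding FQ i1_def
      by (auto intro!: eq_matI simp: mr)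
  qed
  have Q1i: "Q\<^sub>1 * i1 = Q\<^sub>0 * i1 + x \<cdot>\<^sub>m (G * i1)" by (subst Q1) (simp add: mr)
  show "x \<cdot>\<^sub>m r + Q\<^sub>0 * i1 = i1 * Q"
    unfolding i1Q Q1i r_def by (auto intro!: eq_matI simp: algebra_simps)
  have yi: "y \<cdot>\<^sub>m i1 = s * Q + Q\<^sub>1 * s"
  proof -
    have "Q * s = Q\<^sub>1 * s + y \<cdot>\<^sub>m (F * s)" by (subst Q) (simp add: mr)
    then show ?thesis unfolding sQ i1_def
      by (auto intro!: eq_matI simp: algebra_simps)
  qed
  have Q1s: "Q\<^sub>1 * s = Q\<^sub>0 * s + x \<cdot>\<^sub>m (G * s)" by (subst Q1) (simp add: mr)
  show "Q\<^sub>0 * r + r * Q = y \<cdot>\<^sub>m i1"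
  proof -
    have "Q\<^sub>0 * r + r * Q = Q\<^sub>0 * s + (Q\<^sub>0 * G) * i1 + (s * Q + G * (i1 * Q))"
      by (simp add: r_def mr)
    also have "\<dots> = s * Q + (Q\<^sub>0 * s + x \<cdot>\<^sub>m (G * s))" unfolding Q0G i1Q
      by (rule eq_matI) (auto simp: mr)
    finally show ?thesis unfolding yi Q1s .
  qed
  show "1\<^sub>m n = F * u * r + u * i1 + (Q * k + k * Q)"
  proof -
    \<comment> \<open>the difference between the identity and $F u r + u i_1$\<close>
    let ?e = "(H - F * u) * (G * i1) + F * (H * (G * s))"
    have 1: "1\<^sub>m n = F * u * r + u * i1 + ?e"
      unfolding u_def r_def
      by (rule eq_matI) (auto simp: mr i1_def)
    have a: "(H - F * u) * (G * i1) = - (y \<cdot>\<^sub>m (J * (G * i1))) + (F * H) * (G * (G * i1))"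
    proof -
      have "H - F * u = F * (H * G) - y \<cdot>\<^sub>m J"
      proof (rule eq_matI)
        fix i j assume ij: "i < dim_row (F * (H * G) - y \<cdot>\<^sub>m J)" "j < dim_col (F * (H * G) - y \<cdot>\<^sub>m J)"
        then have "F $$ (i, j) = H $$ (i, j) + y * J $$ (i, j)"
          using arg_cong[OF F, of "\<lambda>M. M $$ (i, j)"] by simp
        then show "(H - F * u) $$ (i, j) = (F * (H * G) - y \<cdot>\<^sub>m J) $$ (i, j)"
          unfolding u_def using ij by (auto simp: mr)
      qed auto
      then show ?thesis by (auto intro!: eq_matI simp: mr)
    qed
    have b: "(F * H) * (G * (G * i1)) = - (Q * (J * (G * (G * i1)))) + J * (G * (Q\<^sub>0 * (G * i1)))"
    proof -
      have "(F * H) * (G * (G * i1)) = - (Q * (J * (G * (G * i1)))) - J * ((Q\<^sub>1 * G) * (G * i1))"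
        unfolding FH by (auto intro!: eq_matI simp: mr)
      moreover have "Q\<^sub>1 * G = - (G * Q\<^sub>0)" unfolding GQ0 by simp
      ultimately show ?thesis by (auto intro!: eq_matI simp: mr)
    qed
    have b': "G * (Q\<^sub>0 * (G * i1)) = - (G * (G * (Q\<^sub>1 * i1)))"
    proof -
      have "G * (Q\<^sub>0 * (G * i1)) = G * ((Q\<^sub>0 * G) * i1)" by (simp add: mr)
      then show ?thesis unfolding Q0G by (simp add: mr)
    qed
    have c: "F * (H * (G * s)) = - (Q * (J * (G * s))) + J * (G * (Q\<^sub>0 * s))"
    proof -
      have "F * (H * (G * s)) = (F * H) * (G * s)" by (simp add: mr)
      also have "\<dots> = - (Q * (J * (G * s))) - J * ((Q\<^sub>1 * G) * s)"
        unfolding FH by (auto intro!: eq_matI simp: mr)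
      also have "Q\<^sub>1 * G = - (G * Q\<^sub>0)" unfolding GQ0 by simp
      finally show ?thesis by (auto intro!: eq_matI simp: mr)
    qed
    have yG: "y \<cdot>\<^sub>m (J * (G * i1)) = J * (G * (s * Q)) + (J * (G * (Q\<^sub>0 * s)) + x \<cdot>\<^sub>m (J * (G * (G * s))))"
    proof -
      have "y \<cdot>\<^sub>m (J * (G * i1)) = J * (G * (y \<cdot>\<^sub>m i1))" by (simp add: mr)
      then show ?thesis unfolding yi Q1s by (simp add: mr)
    qed
    have "Q * k + k * Q = - (Q * (J * (G * (G * i1)))) - Q * (J * (G * s)) - J * (G * (G * (i1 * Q))) - J * (G * (s * Q))"
      unfolding k_def by (auto intro!: eq_matI simp: mr)
    also have "\<dots> = ?e"
      unfolding a b b' c yG i1Q by (auto intro!: eq_matI simp: mr algebra_simps)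
    finally show ?thesis using 1 by simp
  qed
qed

definition at_y0 :: "'a::comm_ring_1 fps fps \<Rightarrow> 'a fps fps" where
  "at_y0 f = fps_const (fps_nth f 0)"

definition deriv_x :: "'a::comm_ring_1 fps fps \<Rightarrow> 'a fps fps" where
  "deriv_x f = Abs_fps (\<lambda>n. fps_deriv (fps_nth f n))"

lemma at_y0_hom:
  "at_y0 0 = 0" "at_y0 1 = 1" "at_y0 (a + b) = at_y0 a + at_y0 b" "at_y0 (a * b) = at_y0 a * at_y0 b"
  "at_y0 (a - b) = at_y0 a - at_y0 b" "at_y0 (at_y0 a) = at_y0 a"
  "at_y0 var_x = var_x" "at_y0 var_y = 0" "at_y0 (const_xy c) = const_xy c"
  by (simp_all add: at_y0_def var_x_def var_y_def const_xy_def fps_const_add[symmetric] fps_const_mult[symmetric]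
      fps_const_sub[symmetric] del: fps_const_add fps_const_mult fps_const_sub)

lemma at_y0_sum: "at_y0 (\<Sum>k\<in>S. f k) = (\<Sum>k\<in>S. at_y0 (f k))"
  by (induction S rule: infinite_finite_induct) (auto simp: at_y0_hom)

lemma deriv_x_simps:
  "deriv_x 0 = 0" "deriv_x 1 = 0" "deriv_x (a + b) = deriv_x a + deriv_x b" "deriv_x (a - b) = deriv_x a - deriv_x b"
  "deriv_x var_x = 1" "deriv_x var_y = 0" "deriv_x (const_xy c) = 0"
  by (auto intro!: fps_ext simp: deriv_x_def var_x_def var_y_def const_xy_def fps_X_def)

lemma deriv_x_mult: "deriv_x (a * b) = deriv_x a * b + a * deriv_x b"
  by (rule fps_ext) (simp add: deriv_x_def fps_mult_nth fps_deriv_sum sum.distrib add.commute)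

lemma deriv_x_sum: "deriv_x (\<Sum>k\<in>S. f k) = (\<Sum>k\<in>S. deriv_x (f k))"
  by (induction S rule: infinite_finite_induct) (auto simp: deriv_x_simps)

lemma at_y0_decomp: "f = at_y0 f + var_y * quot_y f"
  unfolding var_y_def quot_y_def at_y0_def by (rule X_quot)

lemma at_y0_decomp': "at_y0 f = const_xy (ev_xy f) + var_x * quot_x f"
  using xy_decomp[of f] at_y0_decomp[of f] by (metis add_right_cancel)

lemma map_at_y0_mult: "dim_col A = dim_row B \<Longrightarrow> map_mat at_y0 (A * B) = map_mat at_y0 A * map_mat at_y0 B"
  by (rule eq_matI) (auto simp: index_mult_mat scalar_prod_def at_y0_sum at_y0_hom)

lemma map_deriv_x_mult:
  "dim_col A = dim_row B \<Longrightarrow> map_mat deriv_x (A * B) = map_mat deriv_x A * B + A * map_mat deriv_x B"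
  by (rule eq_matI) (auto simp: index_mult_mat scalar_prod_def deriv_x_sum deriv_x_mult sum.distrib)

lemma four_block_empty_col:
  "four_block_mat A (0\<^sub>m n 0) (0\<^sub>m 0 m) (0\<^sub>m 0 0) = A" if "dim_row A = n" "dim_col A = m"
  by (rule eq_matI) (use that in auto)

lemma four_block_empty_row_graded:
  fixes p0 p1 :: "'a::comm_ring_1 fps fps mat"
  assumes "p0 \<in> graded_maps True (mf_const M) N" "p1 \<in> graded_maps False (mf_const M) N" "rank N = n" "rank M = n"
  shows "four_block_mat p0 p1 (0\<^sub>m 0 n) (0\<^sub>m 0 n) \<in> graded_maps False (theta_mf M) N"
proof (rule gradedI)
  fix i j assume ij: "i < rank N" "j < rank (theta_mf M)" "four_block_mat p0 p1 (0\<^sub>m 0 n) (0\<^sub>m 0 n) $$ (i, j) \<noteq> 0"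
  show "(par N ! i \<noteq> par (theta_mf M) ! j) = False"
  proof (cases "j < n")
    case True
    then show ?thesis using ij gradedD[OF assms(1), of i j] assms by (auto simp: nth_append)
  next
    case False
    then show ?thesis using ij gradedD[OF assms(2), of i "j - n"] assms by (auto simp: nth_append)
  qed
qed (use assms in auto)

lemma four_block_empty_col_graded:
  fixes i0 i1 :: "'a::comm_ring_1 fps fps mat"
  assumes "i0 \<in> graded_maps True N (mf_const M)" "i1 \<in> graded_maps False N (mf_const M)" "rank N = n" "rank M = n"
  shows "four_block_mat i0 (0\<^sub>m n 0) i1 (0\<^sub>m n 0) \<in> graded_maps False N (theta_mf M)"
proof (rule gradedI)
  fix i j assume ij: "i < rank (theta_mf M)" "j < rank N" "four_block_mat i0 (0\<^sub>m n 0) i1 (0\<^sub>m n 0) $$ (i, j) \<noteq> 0"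
  show "(par (theta_mf M) ! i \<noteq> par N ! j) = False"
  proof (cases "i < n")
    case True
    then show ?thesis using ij gradedD[OF assms(1), of i j] assms by (auto simp: nth_append)
  next
    case False
    then show ?thesis using ij gradedD[OF assms(2), of "i - n" j] assms by (auto simp: nth_append)
  qed
qed (use assms in auto)

text \<open>
  The object $M$ is $N/(x, y)$, a factorization of $- \pi$, multiplied by the sign matrix in order to
  compensate the twist in $\theta$. The relations required by the preceding lemma follow from
  $Q^2 = x y - \pi$ by comparing with the values at $y = 0$ and at the origin and cancelling $x$ or $y$; the
  contraction $s$ comes from differentiating that equation with respect to $x$.
\<close>

theorem theta_retract:
  fixes N :: "'a::comm_ring_1 fps fps mf"
  assumes N: "is_mf (var_x * var_y - const_xy w) N"
  obtains M p i where "is_mf w M" "p \<in> chain_maps (theta_mf M) N" "i \<in> chain_maps N (theta_mf M)"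
    "htp N N (p * i) (1\<^sub>m (rank N))"
proof -
  define n where "n = rank N"
  note mf = is_mfD[OF N]
  define Q where "Q = opr N"
  have Qd [simp]: "dim_row Q = n" "dim_col Q = n" using mf by (auto simp: Q_def n_def)
  have QQ: "Q * Q = (var_x * var_y - const_xy w) \<cdot>\<^sub>m 1\<^sub>m n" using mf by (simp add: Q_def n_def)
  have Qg: "Q \<in> graded_maps True N N" using mf by (simp add: Q_def)
  let ?T = "sign_mat (par N)"
  define Q1 where "Q1 = map_mat at_y0 Q"
  define Q0 where "Q0 = cm (em Q)"
  define F where "F = map_mat quot_y Q"
  define G where "G = map_mat quot_x Q"
  define H where "H = map_mat at_y0 F"
  define J where "J = map_mat quot_y F"
  define s where "s = map_mat deriv_x Q"
  have d [simp]: "dim_row Q1 = n" "dim_col Q1 = n" "dim_row Q0 = n" "dim_col Q0 = n" "dim_row F = n" "dim_col F = n"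
    "dim_row G = n" "dim_col G = n" "dim_row H = n" "dim_col H = n" "dim_row J = n" "dim_col J = n"
    "dim_row s = n" "dim_col s = n"
    by (auto simp: Q1_def Q0_def F_def G_def H_def J_def s_def)
  have eQ: "Q = Q1 + var_y \<cdot>\<^sub>m F"
    by (rule eq_matI) (auto simp: Q1_def F_def at_y0_decomp[symmetric])
  have eF: "F = H + var_y \<cdot>\<^sub>m J"
    by (rule eq_matI) (auto simp: H_def J_def at_y0_decomp[symmetric])
  have eQ1: "Q1 = Q0 + var_x \<cdot>\<^sub>m G"
    by (rule eq_matI) (auto simp: Q1_def Q0_def G_def at_y0_decomp')
  have QQ1: "Q1 * Q1 = (- const_xy w) \<cdot>\<^sub>m 1\<^sub>m n"
  proof -
    have "Q1 * Q1 = map_mat at_y0 (Q * Q)" by (simp add: Q1_def map_at_y0_mult)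
    then show ?thesis unfolding QQ by (auto intro!: eq_matI simp: at_y0_hom)
  qed
  have em2: "em Q * em Q = (- w) \<cdot>\<^sub>m 1\<^sub>m n"
  proof -
    have "em Q * em Q = em (Q * Q)" by (simp add: em_mult)
    then show ?thesis unfolding QQ by (auto intro!: eq_matI simp: ev_xy_hom)
  qed
  have QQ0: "Q0 * Q0 = (- const_xy w) \<cdot>\<^sub>m 1\<^sub>m n"
  proof -
    have "Q0 * Q0 = cm (em Q * em Q)" by (simp add: Q0_def cm_mult)
    then show ?thesis unfolding em2 by (auto intro!: eq_matI simp: const_xy_hom)
  qed
  have e1: "Q1 * G + G * Q0 = 0\<^sub>m n n"
  proof (rule mat_var_x_cancel)
    have "Q1 * Q1 - Q0 * Q0 = Q1 * (Q0 + var_x \<cdot>\<^sub>m G) - Q0 * Q0" by (simp add: eQ1[symmetric])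
    also have "\<dots> = Q1 * Q0 + var_x \<cdot>\<^sub>m (Q1 * G) - Q0 * Q0" by (simp add: mat_ring)
    also have "Q1 * Q0 = Q0 * Q0 + var_x \<cdot>\<^sub>m (G * Q0)" by (subst eQ1) (simp add: mat_ring)
    finally have "var_x \<cdot>\<^sub>m (Q1 * G + G * Q0) = Q1 * Q1 - Q0 * Q0"
      by (auto intro!: eq_matI simp: algebra_simps)
    then show "var_x \<cdot>\<^sub>m (Q1 * G + G * Q0) = var_x \<cdot>\<^sub>m 0\<^sub>m n n"
      unfolding QQ1 QQ0 by (rule trans) (auto intro!: eq_matI)
  qed
  have e2: "Q * F + F * Q1 = var_x \<cdot>\<^sub>m 1\<^sub>m n"
  proof (rule mat_var_y_cancel)
    have "Q * Q - Q1 * Q1 = Q * (Q1 + var_y \<cdot>\<^sub>m F) - Q1 * Q1" by (simp add: eQ[symmetric])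
    also have "\<dots> = Q * Q1 + var_y \<cdot>\<^sub>m (Q * F) - Q1 * Q1" by (simp add: mat_ring)
    also have "Q * Q1 = Q1 * Q1 + var_y \<cdot>\<^sub>m (F * Q1)" by (subst eQ) (simp add: mat_ring)
    finally have "var_y \<cdot>\<^sub>m (Q * F + F * Q1) = Q * Q - Q1 * Q1"
      by (auto intro!: eq_matI simp: algebra_simps)
    then show "var_y \<cdot>\<^sub>m (Q * F + F * Q1) = var_y \<cdot>\<^sub>m (var_x \<cdot>\<^sub>m 1\<^sub>m n)"
      unfolding QQ1 QQ by (rule trans) (auto intro!: eq_matI)
  qed
  have e3: "Q1 * H + H * Q1 = var_x \<cdot>\<^sub>m 1\<^sub>m n"
  proof -
    have "map_mat at_y0 Q1 = Q1" by (auto intro!: eq_matI simp: Q1_def at_y0_hom)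
    then have "Q1 * H + H * Q1 = map_mat at_y0 (Q * F) + map_mat at_y0 (F * Q1)"
      by (simp add: H_def map_at_y0_mult) (simp add: Q1_def)
    also have "\<dots> = map_mat at_y0 (Q * F + F * Q1)"
      by (auto intro!: eq_matI simp: at_y0_hom)
    finally show ?thesis unfolding e2 by (auto intro!: eq_matI simp: at_y0_hom)
  qed
  have e4: "F * H + (Q * J + J * Q1) = 0\<^sub>m n n"
  proof (rule mat_var_y_cancel)
    have "Q * F = Q * H + var_y \<cdot>\<^sub>m (Q * J)" "F * Q1 = H * Q1 + var_y \<cdot>\<^sub>m (J * Q1)"
      by (subst eF, simp add: mat_ring)+
    moreover have "Q * H = Q1 * H + var_y \<cdot>\<^sub>m (F * H)" by (subst eQ) (simp add: mat_ring)
    ultimately have "Q * F + F * Q1 = (Q1 * H + H * Q1) + var_y \<cdot>\<^sub>m (F * H + (Q * J + J * Q1))"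
      by (auto intro!: eq_matI simp: algebra_simps)
    then have *: "var_x \<cdot>\<^sub>m 1\<^sub>m n + var_y \<cdot>\<^sub>m (F * H + (Q * J + J * Q1)) = var_x \<cdot>\<^sub>m 1\<^sub>m n"
      unfolding e2 e3 by simp
    show "var_y \<cdot>\<^sub>m (F * H + (Q * J + J * Q1)) = var_y \<cdot>\<^sub>m 0\<^sub>m n n"
    proof (rule eq_matI)
      fix i j assume "i < dim_row (var_y \<cdot>\<^sub>m 0\<^sub>m n n)" "j < dim_col (var_y \<cdot>\<^sub>m 0\<^sub>m n n)"
      then show "(var_y \<cdot>\<^sub>m (F * H + (Q * J + J * Q1))) $$ (i, j) = (var_y \<cdot>\<^sub>m 0\<^sub>m n n) $$ (i, j)"
        using arg_cong[OF *, of "\<lambda>M. M $$ (i, j)"] by (auto)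
    qed auto
  qed
  have e5: "s * Q + Q * s = var_y \<cdot>\<^sub>m 1\<^sub>m n"
  proof -
    have "s * Q + Q * s = map_mat deriv_x (Q * Q)" by (simp add: s_def map_deriv_x_mult)
    then show ?thesis unfolding QQ
      by (auto intro!: eq_matI simp: deriv_x_mult deriv_x_simps)
  qed
  define u where "u = 1\<^sub>m n - H * G"
  define i1 where "i1 = 1\<^sub>m n - F * s"
  define r where "r = s + G * i1"
  define k where "k = - (J * (G * (G * i1)) + J * (G * s))"
  note id = retract_identities[OF Qd d eQ eQ1 eF e1 e2 e3 e4 e5, folded u_def i1_def, folded r_def k_def]
  have dd [simp]: "dim_row u = n" "dim_col u = n" "dim_row i1 = n" "dim_col i1 = n"
    "dim_row r = n" "dim_col r = n" "dim_row k = n" "dim_col k = n"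
    by (auto simp: u_def i1_def r_def k_def)
  have gr: "F \<in> graded_maps True N N" "G \<in> graded_maps True N N" "J \<in> graded_maps True N N"
    "s \<in> graded_maps True N N" "H \<in> graded_maps True N N"
    unfolding F_def G_def J_def s_def H_def using Qg
    by (auto intro!: map_mat_graded[where M = N and M' = N] simp: quot_zero at_y0_hom deriv_x_simps)
  have one: "1\<^sub>m n \<in> graded_maps False N N" using graded_one[of N] by (simp add: n_def)
  have ug: "u \<in> graded_maps False N N" unfolding u_def
    using graded_minus[OF one graded_mult_odd[OF gr(2,5), simplified]] .
  have i1g: "i1 \<in> graded_maps False N N" unfolding i1_def
    using graded_minus[OF one graded_mult_odd[OF gr(4,1), simplified]] .
  have rg: "r \<in> graded_maps True N N" unfolding r_def
    using graded_add[OF gr(4) graded_mult_even[OF i1g gr(2)]] .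
  have kg: "k \<in> graded_maps True N N" unfolding k_def
    using graded_mult_even[OF graded_mult_odd[OF graded_mult_even[OF i1g gr(2)] gr(2), simplified] gr(3)]
      graded_mult_even[OF graded_mult_odd[OF gr(4,2), simplified] gr(3)]
    by (intro graded_uminus graded_add) simp_all
  \<comment> \<open>the factor \<open>?T\<close> is chosen so that \<open>swap_opr M = Q0\<close>\<close>
  define M where "M = MF (par N) (em Q * ?T)"
  have Mr: "rank M = n" by (simp add: M_def n_def)
  have eQg: "em Q \<in> graded_maps True M M"
    using Qg by (intro map_mat_graded[where M = N and M' = N]) (auto simp: M_def ev_xy_hom)
  have TM: "?T \<in> graded_maps False M M" using sign_mat_graded[of M] by (simp add: M_def)
  have M: "is_mf w M"
  proof -
    have To: "?T * em Q = - (em Q * ?T)" using sign_mat_odd[OF eQg] by (simp add: M_def)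
    have "em Q * ?T * (em Q * ?T) = em Q * ((?T * em Q) * ?T)" by (simp add: mat_assoc n_def[symmetric])
    also have "\<dots> = - (em Q * em Q)" unfolding To by (simp add: mat_assoc n_def[symmetric])
    also have "\<dots> = w \<cdot>\<^sub>m 1\<^sub>m n" unfolding em2 by (auto intro!: eq_matI)
    finally show ?thesis
      using graded_mult_even[OF TM eQg] by (simp add: is_mf_def Mr) (simp add: M_def)
  qed
  have sw: "swap_opr M = Q0"
    by (simp add: swap_opr_def M_def cm_mult cm_simps mat_assoc n_def[symmetric]) (simp add: Q0_def)
  have pM: "par M = par N" by (simp add: M_def)
  have Td [simp]: "dim_row ?T = n" "dim_col ?T = n" by (auto simp: n_def)
  have c: "A \<in> graded_maps p (mf_const M) N \<longleftrightarrow> A \<in> graded_maps p N N"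
     "A \<in> graded_maps p N (mf_const M) \<longleftrightarrow> A \<in> graded_maps p N N" for A p
    by (auto simp: graded_maps_def pM)
  have TQ0: "?T * Q0 = - (Q0 * ?T)" using swap_opr_simps(1)[OF M] by (simp add: sw pM)
  note ms = theta_is_mf[OF M]
  note oM = theta_opr'[OF M, unfolded sw pM]
  define p where "p = four_block_mat (F * u * ?T) u (0\<^sub>m 0 n) (0\<^sub>m 0 n)"
  define i where "i = four_block_mat (?T * r) (0\<^sub>m n 0) i1 (0\<^sub>m n 0)"
  note [simp] = n_def[symmetric]
  have TTr: "?T * (?T * r) = r" by (simp add: n_def[symmetric])
  have opN: "opr N = four_block_mat Q (0\<^sub>m n 0) (0\<^sub>m 0 n) (0\<^sub>m 0 0)"
    by (simp add: Q_def[symmetric] four_block_empty_col)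
  have p: "p \<in> chain_maps (theta_mf M) N"
  proof -
    have "F * u * ?T \<in> graded_maps True N N"
      using graded_mult_even[OF sign_mat_graded[of N] graded_mult_even[OF ug gr(1)]] .
    then have "p \<in> graded_maps False (theta_mf M) N"
      unfolding p_def using ug by (intro four_block_empty_row_graded) (auto simp: c Mr n_def[symmetric])
    moreover have "opr N * p = p * opr (theta_mf M)"
    proof -
      have a: "Q * (F * u * ?T) = F * u * ?T * Q0 + u * (var_x \<cdot>\<^sub>m ?T)"
      proof -
        have "Q * (F * u * ?T) = (Q * (F * u)) * ?T" by (simp add: mat_assoc)
        also have "\<dots> = var_x \<cdot>\<^sub>m (u * ?T) - F * (u * (Q0 * ?T))"
          unfolding id(2) by (simp add: mat_ring)
        also have "Q0 * ?T = - (?T * Q0)" unfolding TQ0 by simp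
        finally show ?thesis by (auto intro!: eq_matI simp: mat_ring)
      qed
      have b: "Q * u = F * u * ?T * (var_y \<cdot>\<^sub>m ?T) + u * Q0"
      proof -
        have "F * u * ?T * (var_y \<cdot>\<^sub>m ?T) = var_y \<cdot>\<^sub>m (F * (u * (?T * ?T)))" by (simp add: mat_ring del: sign_mat_sq)
        also have "\<dots> = var_y \<cdot>\<^sub>m (F * u)" by (simp add: n_def[symmetric])
        finally show ?thesis unfolding id(1) by (auto intro!: eq_matI simp: add.commute)
      qed
      show ?thesis
        unfolding oM p_def opN using a b by (simp add: four_mult)
    qed
    ultimately show ?thesis by (simp add: chain_iff[OF ms N])
  qed
  have i: "i \<in> chain_maps N (theta_mf M)"
  proof -
    have "?T * r \<in> graded_maps True N N"
      using graded_mult_odd[OF rg sign_mat_graded[of N]] by simp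
    then have "i \<in> graded_maps False N (theta_mf M)"
      unfolding i_def using i1g by (intro four_block_empty_col_graded) (auto simp: c Mr n_def[symmetric])
    moreover have "opr (theta_mf M) * i = i * opr N"
    proof -
      have a: "Q0 * (?T * r) + var_y \<cdot>\<^sub>m ?T * i1 = ?T * r * Q"
      proof -
        have "Q0 * (?T * r) = (Q0 * ?T) * r" by (simp add: mat_assoc)
        also have "Q0 * ?T = - (?T * Q0)" unfolding TQ0 by simp
        finally have "Q0 * (?T * r) = - (?T * (Q0 * r))" by (simp add: mat_assoc)
        moreover have "var_y \<cdot>\<^sub>m ?T * i1 = ?T * (var_y \<cdot>\<^sub>m i1)" by (simp add: mat_ring)
        ultimately show ?thesis unfolding id(3)[symmetric]
          by (auto intro!: eq_matI simp: mat_ring)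
      qed
      have b: "var_x \<cdot>\<^sub>m ?T * (?T * r) + Q0 * i1 = i1 * Q"
        unfolding id(4)[symmetric] by (simp add: mat_smultl TTr)
      show ?thesis
        unfolding oM i_def opN using a b by (simp add: four_mult)
    qed
    ultimately show ?thesis by (simp add: chain_iff[OF N ms])
  qed
  have pi: "p * i = F * u * r + u * i1"
  proof -
    have "F * u * ?T * (?T * r) = F * u * r" by (simp add: mat_assoc TTr)
    then show ?thesis unfolding p_def i_def by (simp add: four_mult four_block_empty_col)
  qed
  have o: "1\<^sub>m (rank N) \<in> chain_maps N N" by (rule chain_one[OF N])
  have "htp N N (1\<^sub>m (rank N)) (p * i)"
    by (rule htpI[OF N N o chain_mult[OF N ms N i p] kg]) (simp add: pi Q_def[symmetric] n_def[symmetric] id(5)[symmetric])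
  from htp_sym[OF N N this] show ?thesis using that M p i by blast
qed

section \<open>Power series in a topologically nilpotent matrix\<close>

definition mdeg :: "(nat \<Rightarrow>\<^sub>0 nat) \<Rightarrow> nat" where
  "mdeg m = (\<Sum>i\<in>Poly_Mapping.keys m. Poly_Mapping.lookup m i)"

lemma mdeg_superset:
  "finite S \<Longrightarrow> Poly_Mapping.keys m \<subseteq> S \<Longrightarrow> mdeg m = (\<Sum>i\<in>S. Poly_Mapping.lookup m i)"
  unfolding mdeg_def by (rule sum.mono_neutral_left) (auto simp: in_keys_iff)

lemma mdeg_add: "mdeg (a + b) = mdeg a + mdeg b"
  using mdeg_superset[of "Poly_Mapping.keys a \<union> Poly_Mapping.keys b" a]
    mdeg_superset[of "Poly_Mapping.keys a \<union> Poly_Mapping.keys b" b]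
    mdeg_superset[of "Poly_Mapping.keys a \<union> Poly_Mapping.keys b" "a + b"]
  by (simp add: keys_add_nat lookup_add sum.distrib)

lemma mdeg_eq_0_iff: "mdeg m = 0 \<longleftrightarrow> m = 0"
  by (auto simp: mdeg_def in_keys_iff poly_mapping_eq_iff fun_eq_iff)

text \<open>
  Membership in the $l$-th power of the maximal ideal.
\<close>

definition ord_ge :: "nat \<Rightarrow> ('n::len0, 'a::comm_ring_1) mvps \<Rightarrow> bool" where
  "ord_ge l f \<longleftrightarrow> (\<forall>m. mvps_coeff f m \<noteq> 0 \<longrightarrow> l \<le> mdeg m)"

lemma ord_ge_1_iff: "ord_ge 1 f \<longleftrightarrow> mvps_coeff f 0 = 0"
proof
  assume *: "ord_ge 1 f"
  show "mvps_coeff f 0 = 0"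
  proof (rule ccontr)
    assume "mvps_coeff f 0 \<noteq> 0"
    with * have "1 \<le> mdeg 0" unfolding ord_ge_def by blast
    then show False by (simp add: mdeg_def)
  qed
next
  assume *: "mvps_coeff f 0 = 0"
  show "ord_ge 1 f" unfolding ord_ge_def
  proof (intro allI impI)
    fix m assume "mvps_coeff f m \<noteq> 0"
    with * have "m \<noteq> 0" by metis
    then show "1 \<le> mdeg m" using mdeg_eq_0_iff[of m] by linarith
  qed
qed

lemma ord_ge_0: "ord_ge 0 f" by (simp add: ord_ge_def)

lemma ord_ge_mult:
  assumes "ord_ge k f" "ord_ge l g"
  shows "ord_ge (k + l) (f * g)"
  unfolding ord_ge_def
proof (intro allI impI)
  fix m assume "mvps_coeff (f * g) m \<noteq> 0"
  then have "(\<Sum>(a, b)\<in>{(a, b). a + b = m}. mvps_coeff f a * mvps_coeff g b) \<noteq> 0"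
    by (simp add: times_mvps.rep_eq)
  then obtain p where p: "p \<in> {(a, b). a + b = m}" "(case p of (a, b) \<Rightarrow> mvps_coeff f a * mvps_coeff g b) \<noteq> 0"
    by (rule sum.not_neutral_contains_not_neutral)
  obtain a b where "p = (a, b)" by (cases p)
  with p have ab: "a + b = m" "mvps_coeff f a \<noteq> 0" "mvps_coeff g b \<noteq> 0" by auto
  have "k \<le> mdeg a" "l \<le> mdeg b" using assms ab(2,3) unfolding ord_ge_def by blast+
  then show "k + l \<le> mdeg m" using ab(1) mdeg_add[of a b] by simp
qed

lemma mvps_coeff_sum: "mvps_coeff (\<Sum>k\<in>S. f k) m = (\<Sum>k\<in>S. mvps_coeff (f k) m)"
  by (induction S rule: infinite_finite_induct) (auto simp: zero_mvps.rep_eq plus_mvps.rep_eq)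

lemma ord_ge_sum:
  assumes "\<And>k. k \<in> S \<Longrightarrow> ord_ge l (f k)"
  shows "ord_ge l (\<Sum>k\<in>S. f k)"
  unfolding ord_ge_def
proof (intro allI impI)
  fix m assume "mvps_coeff (\<Sum>k\<in>S. f k) m \<noteq> 0"
  then obtain k where "k \<in> S" "mvps_coeff (f k) m \<noteq> 0"
    unfolding mvps_coeff_sum by (rule sum.not_neutral_contains_not_neutral)
  with assms show "l \<le> mdeg m" unfolding ord_ge_def by blast
qed

definition mat_ord :: "nat \<Rightarrow> ('n::len0, 'a::comm_ring_1) mvps mat \<Rightarrow> bool" where
  "mat_ord l A \<longleftrightarrow> (\<forall>i<dim_row A. \<forall>j<dim_col A. ord_ge l (A $$ (i, j)))"

lemma mat_ord_mult:
  assumes "mat_ord k A" "mat_ord l B" "dim_col A = dim_row B"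
  shows "mat_ord (k + l) (A * B)"
  unfolding mat_ord_def
proof (intro allI impI)
  fix i j assume "i < dim_row (A * B)" "j < dim_col (A * B)"
  then have "(A * B) $$ (i, j) = (\<Sum>p\<in>{0..<dim_row B}. A $$ (i, p) * B $$ (p, j))"
    using assms by (simp add: index_mult_mat scalar_prod_def)
  moreover have "ord_ge (k + l) (\<Sum>p\<in>{0..<dim_row B}. A $$ (i, p) * B $$ (p, j))"
    using assms \<open>i < _\<close> \<open>j < _\<close> by (intro ord_ge_sum ord_ge_mult) (auto simp: mat_ord_def)
  ultimately show "ord_ge (k + l) ((A * B) $$ (i, j))" by simp
qed

lemma mat_ord_pow:
  assumes "t \<in> carrier_mat n n" "mat_ord 1 t"
  shows "mat_ord l (t ^\<^sub>m l)"
proof (induction l)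
  case 0 then show ?case by (simp add: mat_ord_def ord_ge_0)
next
  case (Suc l)
  have "mat_ord (l + 1) (t ^\<^sub>m l * t)" using Suc assms by (intro mat_ord_mult) auto
  then show ?case by simp
qed

lemma coeff_pow_eq_0:
  assumes "t \<in> carrier_mat n n" "mat_ord 1 t" "i < n" "j < n" "mdeg m < l"
  shows "mvps_coeff ((t ^\<^sub>m l) $$ (i, j)) m = 0"
  using mat_ord_pow[OF assms(1,2), of l] assms unfolding mat_ord_def ord_ge_def
  by (metis carrier_matD leD pow_carrier_mat)

lemma pow_mat_add:
  fixes t :: "'a::comm_ring_1 mat"
  assumes "t \<in> carrier_mat n n"
  shows "t ^\<^sub>m k * t ^\<^sub>m l = t ^\<^sub>m (k + l)"
proof (induction l)
  case 0 then show ?case using assms by simp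
next
  case (Suc l)
  have "t ^\<^sub>m k * t ^\<^sub>m Suc l = t ^\<^sub>m k * t ^\<^sub>m l * t" using assms by (simp add: mat_assoc)
  then show ?case unfolding Suc by simp
qed

text \<open>
  The series $\sum_l F_l t^l$ for a matrix $t$ with entries in the maximal ideal. Terms with $l > \deg m$
  do not contribute to the coefficient of $m$, so that a finite sum defines it.
\<close>

definition fps_of_mat :: "('n::len0, 'a::comm_ring_1) mvps mat \<Rightarrow> 'a fps \<Rightarrow> ('n, 'a) mvps mat" where
  "fps_of_mat t F = mat (dim_row t) (dim_row t) (\<lambda>(i, j). Abs_mvps (\<lambda>m. \<Sum>l\<le>mdeg m. fps_nth F l * mvps_coeff ((t ^\<^sub>m l) $$ (i, j)) m))"

lemma fps_of_mat_dim [simp]: "dim_row (fps_of_mat t F) = dim_row t" "dim_col (fps_of_mat t F) = dim_row t"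
  by (auto simp: fps_of_mat_def)

lemma fps_of_mat_coeff:
  fixes t :: "('n::len0, 'a::comm_ring_1) mvps mat"
  assumes "i < dim_row t" "j < dim_row t"
  shows "mvps_coeff (fps_of_mat t F $$ (i, j)) m = (\<Sum>l\<le>mdeg m. fps_nth F l * mvps_coeff ((t ^\<^sub>m l) $$ (i, j)) m)"
proof -
  have "(\<lambda>m. \<Sum>l\<le>mdeg m. fps_nth F l * mvps_coeff ((t ^\<^sub>m l) $$ (i, j)) m)
    \<in> {f. \<forall>m. f m \<noteq> 0 \<longrightarrow> Poly_Mapping.keys m \<subseteq> {..<LENGTH('n)}}"
  proof (intro CollectI allI impI)
    fix m assume "(\<Sum>l\<le>mdeg m. fps_nth F l * mvps_coeff ((t ^\<^sub>m l) $$ (i, j)) m) \<noteq> 0"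
    then obtain l where "fps_nth F l * mvps_coeff ((t ^\<^sub>m l) $$ (i, j)) m \<noteq> 0"
      by (rule sum.not_neutral_contains_not_neutral)
    then have "mvps_coeff ((t ^\<^sub>m l) $$ (i, j)) m \<noteq> 0" by auto
    then show "Poly_Mapping.keys m \<subseteq> {..<LENGTH('n)}"
      using mvps_coeff[of "(t ^\<^sub>m l) $$ (i, j)"] by blast
  qed
  from Abs_mvps_inverse[OF this] show ?thesis using assms by (simp add: fps_of_mat_def)
qed

text \<open>The coefficient of $m$ in an entry of $t^l$ vanishes for $l > \deg m$.\<close>

lemma fps_of_mat_coeff_ge:
  assumes "t \<in> carrier_mat n n" "mat_ord 1 t" "i < n" "j < n" "mdeg m \<le> d"
  shows "mvps_coeff (fps_of_mat t F $$ (i, j)) m = (\<Sum>l\<le>d. fps_nth F l * mvps_coeff ((t ^\<^sub>m l) $$ (i, j)) m)"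
proof -
  have "(\<Sum>l\<le>mdeg m. fps_nth F l * mvps_coeff ((t ^\<^sub>m l) $$ (i, j)) m)
    = (\<Sum>l\<le>d. fps_nth F l * mvps_coeff ((t ^\<^sub>m l) $$ (i, j)) m)"
    by (rule sum.mono_neutral_left) (use assms coeff_pow_eq_0[OF assms(1-4)] in auto)
  then show ?thesis using assms by (simp add: fps_of_mat_coeff)
qed

lemma mvps_mat_mult_coeff:
  assumes "i < dim_row A" "j < dim_col B" "dim_col A = dim_row B"
  shows "mvps_coeff ((A * B) $$ (i, j)) m =
    (\<Sum>k\<in>{0..<dim_row B}. \<Sum>(a, b)\<in>{(a, b). a + b = m}. mvps_coeff (A $$ (i, k)) a * mvps_coeff (B $$ (k, j)) b)"
  using assms by (simp add: index_mult_mat scalar_prod_def mvps_coeff_sum times_mvps.rep_eq)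

lemma fps_of_mat_mult_right:
  assumes t: "t \<in> carrier_mat n n" "mat_ord 1 t" and X: "dim_row X = n" and ij: "i < n" "j < dim_col X"
  shows "mvps_coeff ((fps_of_mat t F * X) $$ (i, j)) m
    = (\<Sum>l\<le>mdeg m. fps_nth F l * mvps_coeff ((t ^\<^sub>m l * X) $$ (i, j)) m)"
proof -
  have pd: "dim_row (t ^\<^sub>m l) = n" "dim_col (t ^\<^sub>m l) = n" for l using t(1) by auto
  have "mvps_coeff ((fps_of_mat t F * X) $$ (i, j)) m
    = (\<Sum>k\<in>{0..<n}. \<Sum>(a, b)\<in>{(a, b). a + b = m}. mvps_coeff (fps_of_mat t F $$ (i, k)) a * mvps_coeff (X $$ (k, j)) b)"
    using t X ij by (subst mvps_mat_mult_coeff) auto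
  also have "\<dots> = (\<Sum>k\<in>{0..<n}. \<Sum>(a, b)\<in>{(a, b). a + b = m}. \<Sum>l\<le>mdeg m.
      fps_nth F l * (mvps_coeff ((t ^\<^sub>m l) $$ (i, k)) a * mvps_coeff (X $$ (k, j)) b))"
    by (intro sum.cong refl)
      (auto simp: fps_of_mat_coeff_ge[OF t ij(1) _, where d = "mdeg m"] mdeg_add sum_distrib_right mult.assoc)
  also have "\<dots> = (\<Sum>l\<le>mdeg m. \<Sum>k\<in>{0..<n}. \<Sum>p\<in>{(a, b). a + b = m}.
      fps_nth F l * (mvps_coeff ((t ^\<^sub>m l) $$ (i, k)) (fst p) * mvps_coeff (X $$ (k, j)) (snd p)))"
    by (simp add: case_prod_beta) (subst sum.swap[of _ "{..mdeg m}"], intro sum.cong refl sum.swap)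
  also have "\<dots> = (\<Sum>l\<le>mdeg m. fps_nth F l * mvps_coeff ((t ^\<^sub>m l * X) $$ (i, j)) m)"
    using pd X ij by (intro sum.cong refl, subst mvps_mat_mult_coeff) (auto simp: sum_distrib_left case_prod_beta)
  finally show ?thesis .
qed

lemma fps_of_mat_mult_left:
  assumes t: "t \<in> carrier_mat n n" "mat_ord 1 t" and X: "dim_col X = n" and ij: "i < dim_row X" "j < n"
  shows "mvps_coeff ((X * fps_of_mat t F) $$ (i, j)) m
    = (\<Sum>l\<le>mdeg m. fps_nth F l * mvps_coeff ((X * t ^\<^sub>m l) $$ (i, j)) m)"
proof -
  have pd: "dim_row (t ^\<^sub>m l) = n" "dim_col (t ^\<^sub>m l) = n" for l using t(1) by auto
  have "mvps_coeff ((X * fps_of_mat t F) $$ (i, j)) m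
    = (\<Sum>k\<in>{0..<n}. \<Sum>(a, b)\<in>{(a, b). a + b = m}. mvps_coeff (X $$ (i, k)) a * mvps_coeff (fps_of_mat t F $$ (k, j)) b)"
    using t X ij by (subst mvps_mat_mult_coeff) auto
  also have "\<dots> = (\<Sum>k\<in>{0..<n}. \<Sum>(a, b)\<in>{(a, b). a + b = m}. \<Sum>l\<le>mdeg m.
      fps_nth F l * (mvps_coeff (X $$ (i, k)) a * mvps_coeff ((t ^\<^sub>m l) $$ (k, j)) b))"
    by (intro sum.cong refl)
      (auto simp: fps_of_mat_coeff_ge[OF t _ ij(2), where d = "mdeg m"] mdeg_add sum_distrib_left mult.left_commute)
  also have "\<dots> = (\<Sum>l\<le>mdeg m. \<Sum>k\<in>{0..<n}. \<Sum>p\<in>{(a, b). a + b = m}.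
      fps_nth F l * (mvps_coeff (X $$ (i, k)) (fst p) * mvps_coeff ((t ^\<^sub>m l) $$ (k, j)) (snd p)))"
    by (simp add: case_prod_beta) (subst sum.swap[of _ "{..mdeg m}"], intro sum.cong refl sum.swap)
  also have "\<dots> = (\<Sum>l\<le>mdeg m. fps_nth F l * mvps_coeff ((X * t ^\<^sub>m l) $$ (i, j)) m)"
    using pd X ij by (intro sum.cong refl, subst mvps_mat_mult_coeff) (auto simp: sum_distrib_left case_prod_beta)
  finally show ?thesis .
qed

lemma mvps_mat_eqI:
  assumes "dim_row A = dim_row B" "dim_col A = dim_col B"
    and "\<And>i j m. i < dim_row B \<Longrightarrow> j < dim_col B \<Longrightarrow> mvps_coeff (A $$ (i, j)) m = mvps_coeff (B $$ (i, j)) m"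
  shows "A = B"
  using assms by (auto intro!: eq_matI mvps_eqI)

lemma fps_of_mat_mult:
  assumes t: "t \<in> carrier_mat n n" "mat_ord 1 t"
  shows "fps_of_mat t (F * G) = fps_of_mat t F * fps_of_mat t G"
proof (rule mvps_mat_eqI)
  have pd: "dim_row (t ^\<^sub>m l) = n" "dim_col (t ^\<^sub>m l) = n" for l using t(1) by auto
  fix i j m assume "i < dim_row (fps_of_mat t F * fps_of_mat t G)" "j < dim_col (fps_of_mat t F * fps_of_mat t G)"
  then have ij: "i < n" "j < n" using t by auto
  let ?c = "\<lambda>l. mvps_coeff ((t ^\<^sub>m l) $$ (i, j)) m" and ?D = "mdeg m"
  have "mvps_coeff ((fps_of_mat t F * fps_of_mat t G) $$ (i, j)) m
    = (\<Sum>l\<le>?D. fps_nth F l * mvps_coeff ((t ^\<^sub>m l * fps_of_mat t G) $$ (i, j)) m)"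
    by (rule fps_of_mat_mult_right[OF t]) (use t ij in auto)
  also have "\<dots> = (\<Sum>l\<le>?D. fps_nth F l * (\<Sum>l'\<le>?D. fps_nth G l' * ?c (l + l')))"
    using pd ij by (intro sum.cong refl, subst fps_of_mat_mult_left[OF t]) (auto simp: pow_mat_add[OF t(1)])
  also have "\<dots> = (\<Sum>(l, l')\<in>{..?D} \<times> {..?D}. fps_nth F l * (fps_nth G l' * ?c (l + l')))"
    by (simp add: sum_distrib_left sum.cartesian_product)
  also have "\<dots> = (\<Sum>(l, l')\<in>{(l, l'). l + l' \<le> ?D}. fps_nth F l * (fps_nth G l' * ?c (l + l')))"
    by (rule sum.mono_neutral_right) (auto, metis coeff_pow_eq_0[OF t ij] mult_zero_right not_le)
  also have "\<dots> = (\<Sum>s\<le>?D. \<Sum>l\<le>s. fps_nth F l * (fps_nth G (s - l) * ?c (l + (s - l))))"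
    by (rule sum.triangle_reindex_eq)
  also have "\<dots> = (\<Sum>s\<le>?D. fps_nth (F * G) s * ?c s)"
    by (simp add: fps_mult_nth sum_distrib_right mult.assoc atLeast0AtMost)
  finally show "mvps_coeff (fps_of_mat t (F * G) $$ (i, j)) m = mvps_coeff ((fps_of_mat t F * fps_of_mat t G) $$ (i, j)) m"
    using ij t by (simp add: fps_of_mat_coeff)
qed auto

lemma fps_of_mat_add: "fps_of_mat t (F + G) = fps_of_mat t F + fps_of_mat t G"
  by (rule mvps_mat_eqI) (auto simp: fps_of_mat_coeff plus_mvps.rep_eq distrib_right sum.distrib)

lemma fps_of_mat_minus: "fps_of_mat t (F - G) = fps_of_mat t F - fps_of_mat t G"
  by (rule mvps_mat_eqI) (auto simp: fps_of_mat_coeff minus_mvps.rep_eq left_diff_distrib sum_subtractf)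

lemma fps_of_mat_zero: "fps_of_mat t 0 = 0\<^sub>m (dim_row t) (dim_row t)"
  by (rule mvps_mat_eqI) (auto simp: fps_of_mat_coeff zero_mvps.rep_eq)

lemma fps_of_mat_one:
  fixes t :: "('n::len0, 'a::comm_ring_1) mvps mat"
  shows "fps_of_mat t 1 = 1\<^sub>m (dim_row t)"
proof (rule mvps_mat_eqI)
  fix i j m assume ij: "i < dim_row (1\<^sub>m (dim_row t) :: ('n, 'a) mvps mat)" "j < dim_col (1\<^sub>m (dim_row t) :: ('n, 'a) mvps mat)"
  have "(\<Sum>l\<le>mdeg m. fps_nth 1 l * mvps_coeff ((t ^\<^sub>m l) $$ (i, j)) m)
    = (\<Sum>l\<le>mdeg m. if l = 0 then mvps_coeff ((t ^\<^sub>m 0) $$ (i, j)) m else 0)"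
    by (rule sum.cong) auto
  also have "\<dots> = mvps_coeff ((t ^\<^sub>m 0) $$ (i, j)) m" by (subst sum.delta) auto
  finally show "mvps_coeff (fps_of_mat t 1 $$ (i, j)) m = mvps_coeff ((1\<^sub>m (dim_row t) :: ('n, 'a) mvps mat) $$ (i, j)) m"
    using ij by (simp add: fps_of_mat_coeff)
qed auto

lemma fps_of_mat_X:
  assumes t: "t \<in> carrier_mat n n" "mat_ord 1 t"
  shows "fps_of_mat t fps_X = t"
proof (rule mvps_mat_eqI)
  fix i j m assume ij: "i < dim_row t" "j < dim_col t"
  have "mvps_coeff (fps_of_mat t fps_X $$ (i, j)) m
     = (\<Sum>l\<le>Suc (mdeg m). fps_nth fps_X l * mvps_coeff ((t ^\<^sub>m l) $$ (i, j)) m)"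
    by (rule fps_of_mat_coeff_ge[OF t]) (use ij t in auto)
  also have "\<dots> = (\<Sum>l\<le>Suc (mdeg m). if l = 1 then mvps_coeff ((t ^\<^sub>m 1) $$ (i, j)) m else 0)"
    by (rule sum.cong) (auto simp: fps_X_def)
  also have "\<dots> = mvps_coeff ((t ^\<^sub>m 1) $$ (i, j)) m" by (subst sum.delta) auto
  finally show "mvps_coeff (fps_of_mat t fps_X $$ (i, j)) m = mvps_coeff (t $$ (i, j)) m"
    using ij t by simp
qed (use t in auto)

lemma fps_of_mat_commute:
  assumes t: "t \<in> carrier_mat n n" "mat_ord 1 t" and X: "dim_row X = n" "dim_col X = n" "X * t = t * X"
  shows "X * fps_of_mat t F = fps_of_mat t F * X"
proof (rule mvps_mat_eqI)
  have pd: "dim_row (t ^\<^sub>m l) = n" "dim_col (t ^\<^sub>m l) = n" for l using t(1) by auto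
  have *: "X * t ^\<^sub>m l = t ^\<^sub>m l * X" for l
  proof (induction l)
    case 0 then show ?case using t X by simp
  next
    case (Suc l)
    have "X * t ^\<^sub>m Suc l = X * t ^\<^sub>m l * t" using t X pd by (simp add: mat_assoc)
    also have "\<dots> = t ^\<^sub>m l * (t * X)" unfolding Suc using t X pd by (simp add: mat_assoc)
    finally show ?case using t X pd by (simp add: mat_assoc)
  qed
  fix i j m assume "i < dim_row (fps_of_mat t F * X)" "j < dim_col (fps_of_mat t F * X)"
  then show "mvps_coeff ((X * fps_of_mat t F) $$ (i, j)) m = mvps_coeff ((fps_of_mat t F * X) $$ (i, j)) m"
    using t X by (subst fps_of_mat_mult_left[OF t], simp, simp, simp, subst fps_of_mat_mult_right[OF t]) (auto simp: *)
qed (use t X in auto)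

lemma fps_of_mat_graded:
  assumes t: "t \<in> graded_maps False M M"
  shows "fps_of_mat t F \<in> graded_maps False M M"
proof (rule gradedI)
  have p: "t ^\<^sub>m l \<in> graded_maps False M M" for l
  proof (induction l)
    case 0 then show ?case using t graded_one[of M] by simp
  next
    case (Suc l) then show ?case using graded_mult_even[OF t Suc] by simp
  qed
  fix i j assume ij: "i < rank M" "j < rank M" and nz: "fps_of_mat t F $$ (i, j) \<noteq> 0"
  then obtain m where "mvps_coeff (fps_of_mat t F $$ (i, j)) m \<noteq> 0"
    by (metis mvps_eqI zero_mvps.rep_eq)
  then have "(\<Sum>l\<le>mdeg m. fps_nth F l * mvps_coeff ((t ^\<^sub>m l) $$ (i, j)) m) \<noteq> 0"
    using t ij by (simp add: fps_of_mat_coeff)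
  then obtain l where "fps_nth F l * mvps_coeff ((t ^\<^sub>m l) $$ (i, j)) m \<noteq> 0"
    by (rule sum.not_neutral_contains_not_neutral)
  then have "(t ^\<^sub>m l) $$ (i, j) \<noteq> 0" by (auto simp: zero_mvps.rep_eq)
  then show "(par M ! i \<noteq> par M ! j) = False" using gradedD[OF p ij] by blast
qed (use t in auto)

subsection \<open>Inverses and idempotents\<close>

lemma one_minus_nilpotent_inverse:
  fixes t :: "('n::len0, 'a::field) mvps mat"
  assumes t: "t \<in> carrier_mat n n" "mat_ord 1 t"
  obtains r where "r \<in> carrier_mat n n" "(1\<^sub>m n - t) * r = 1\<^sub>m n" "r * (1\<^sub>m n - t) = 1\<^sub>m n"
    "\<And>M. t \<in> graded_maps False M M \<Longrightarrow> r \<in> graded_maps False M M"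
proof
  let ?F = "inverse (1 - fps_X :: 'a fps)"
  have e: "(1 - fps_X) * ?F = 1" "?F * (1 - fps_X) = 1" by (auto intro: inverse_mult_eq_1 inverse_mult_eq_1')
  have d: "fps_of_mat t (1 - fps_X) = 1\<^sub>m n - t"
    using t by (simp add: fps_of_mat_minus fps_of_mat_one fps_of_mat_X[OF t])
  show "fps_of_mat t ?F \<in> carrier_mat n n" using t by auto
  show "fps_of_mat t ?F \<in> graded_maps False M M" if "t \<in> graded_maps False M M" for M
    by (rule fps_of_mat_graded[OF that])
  show "(1\<^sub>m n - t) * fps_of_mat t ?F = 1\<^sub>m n" "fps_of_mat t ?F * (1\<^sub>m n - t) = 1\<^sub>m n"
    unfolding d[symmetric] fps_of_mat_mult[OF t, symmetric] e using t by (simp_all add: fps_of_mat_one)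
qed

lemma mvps_coeff_0_mult: "mvps_coeff (f * g) 0 = mvps_coeff f 0 * mvps_coeff g 0"
proof -
  have "{(a, b). a + b = (0 :: nat \<Rightarrow>\<^sub>0 nat)} = {(0, 0)}"
    by (auto simp: poly_mapping_eq_iff fun_eq_iff lookup_add)
  then show ?thesis by (simp add: times_mvps.rep_eq)
qed

lemma mvps_unit:
  fixes f :: "('n::len0, 'a::field) mvps"
  assumes "mvps_coeff f 0 \<noteq> 0"
  obtains g where "f * g = 1"
proof -
  define c :: "('n, 'a) mvps" where "c = Abs_mvps (\<lambda>m. if m = 0 then inverse (mvps_coeff f 0) else 0)"
  have "mvps_coeff c 0 = inverse (mvps_coeff f 0)"
    unfolding c_def by (subst Abs_mvps_inverse) auto
  then have *: "mvps_coeff (1 - f * c) 0 = 0"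
    using assms by (simp add: minus_mvps.rep_eq one_mvps.rep_eq mvps_coeff_0_mult)
  define t where "t = mat 1 1 (\<lambda>_. 1 - f * c)"
  have t: "t \<in> carrier_mat 1 1" "mat_ord 1 t"
    using * by (auto simp: t_def mat_ord_def ord_ge_1_iff[simplified])
  obtain r where r: "r \<in> carrier_mat 1 1" "(1\<^sub>m 1 - t) * r = 1\<^sub>m 1"
    using one_minus_nilpotent_inverse[OF t] by metis
  have "((1\<^sub>m 1 - t) * r) $$ (0, 0) = f * c * r $$ (0, 0)"
    using r(1) by (simp add: t_def index_mult_mat scalar_prod_def)
  then have "f * (c * r $$ (0, 0)) = 1" unfolding r(2) by (simp add: mult.assoc)
  then show ?thesis by (rule that)
qed

text \<open>
  If $t = g^2 - g$ then $(1 - 2 g)^2 = 1 + 4 t$, so that $g + (1 - 2 g) c(t)$ is idempotent as soon as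
  $t + (1 + 4 t) (c(t)^2 - c(t)) = 0$. The solution is $c = \frac12 (1 - (1 + 4 X)^{-1/2})$; its
  divisibility by $X$ makes the correction of $g$ a multiple of $t$.
\<close>

lemma idempotent_series:
  obtains c c1 :: "'a::field_char_0 fps"
  where "c = fps_X * c1" "fps_X + (c * c - c) + (fps_X * (c * c - c) + fps_X * (c * c - c) + fps_X * (c * c - c) + fps_X * (c * c - c)) = 0"
proof -
  let ?b = "fps_binomial (- (1/2) :: 'a)"
  define b where "b = ?b oo (fps_const 4 * fps_X)"
  have "?b * ?b = fps_binomial (- 1)" by (simp add: fps_binomial_add_mult[symmetric])
  also have "\<dots> * (1 + fps_X) = 1" unfolding fps_binomial_minus_one by (rule inverse_mult_eq_1) simp
  finally have "?b * ?b * (1 + fps_X) = 1" .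
  from arg_cong[OF this, of "\<lambda>f. f oo (fps_const 4 * fps_X)"]
  have b: "b * b * (1 + fps_const 4 * fps_X) = 1"
    by (simp add: b_def fps_compose_mult_distrib fps_compose_add_distrib)
  have b0: "fps_nth b 0 = 1" by (simp add: b_def fps_compose_nth)
  define c where "c = fps_const (1/2) * (1 - b)"
  define c1 where "c1 = fps_shift 1 c"
  have "c = fps_X * c1" using X_quot[of c] b0 by (simp add: c_def c1_def)
  moreover have "fps_X + (c * c - c) + (fps_X * (c * c - c) + fps_X * (c * c - c) + fps_X * (c * c - c) + fps_X * (c * c - c)) = 0"
  proof -
    have q: "c * c - c = fps_const (1/4) * (b * b - 1)"
    proof -
      have "c * c - c = (fps_const (1/2) * (1 - b)) * (fps_const (1/2) * (1 - b)) - fps_const (1/2) * (1 - b)"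
        by (simp only: c_def)
      also have "\<dots> = (fps_const (1/2) * fps_const (1/2)) * ((1 - b) * (1 - b)) - (fps_const (1/2) * fps_const (1/2)) * fps_const 2 * (1 - b)"
        by (simp add: algebra_simps)
      also have "fps_const (1/2) * fps_const (1/2) = fps_const (1/4 :: 'a)" by simp
      also have "fps_const (2 :: 'a) = 2" by (simp add: numeral_fps_const)
      finally show ?thesis by (simp add: algebra_simps)
    qed
    have f4: "fps_const 4 = (4 :: 'a fps)" by (simp add: numeral_fps_const)
    have "fps_X + (c * c - c) + (fps_X * (c * c - c) + fps_X * (c * c - c) + fps_X * (c * c - c) + fps_X * (c * c - c))
      = fps_X + (c * c - c) * (1 + fps_const 4 * fps_X)" unfolding f4 by (simp add: algebra_simps)
    also have "\<dots> = fps_X + fps_const (1/4) * (b * b * (1 + fps_const 4 * fps_X) - (1 + fps_const 4 * fps_X))"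
      unfolding q by (simp only: algebra_simps mult_1_left mult_1_right)
    also have "\<dots> = fps_X - (fps_const (1/4) * fps_const 4) * fps_X" unfolding b by (simp only: algebra_simps diff_add_cancel)
    finally show ?thesis by simp
  qed
  ultimately show ?thesis by (rule that)
qed

section \<open>Splitting idempotents\<close>

text \<open>
  If $r > n$, padding with zeros gives square matrices whose product is still the identity, although
  the second one has a zero row.
\<close>

lemma left_inverse_rank_le:
  fixes U V :: "'a::comm_ring_1 mat"
  assumes "V * U = 1\<^sub>m r" "V \<in> carrier_mat r n" "U \<in> carrier_mat n r"
  shows "r \<le> n"
proof (rule ccontr)
  assume "\<not> r \<le> n"
  then obtain d where r: "r = n + Suc d" by (metis less_imp_Suc_add not_le add_Suc_right)
  define V' where "V' = four_block_mat V (0\<^sub>m r (Suc d)) (0\<^sub>m 0 n) (0\<^sub>m 0 (Suc d))"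
  define U' where "U' = four_block_mat U (0\<^sub>m n 0) (0\<^sub>m (Suc d) r) (0\<^sub>m (Suc d) 0)"
  have c: "V' \<in> carrier_mat r r" "U' \<in> carrier_mat r r" using assms r by (auto simp: V'_def U'_def)
  have "V' * U' = V * U" unfolding V'_def U'_def using assms(2,3)
    by (subst four_mult) (auto simp: four_block_empty_col)
  then have "det V' * det U' = 1" using assms(1) det_mult[OF c] by simp
  moreover have "det U' = 0"
  proof -
    have "det U' = det (multrow n 0 U')"
    proof (rule arg_cong[of _ _ det], rule eq_matI)
      fix i j assume "i < dim_row (multrow n 0 U')" "j < dim_col (multrow n 0 U')"
      then show "U' $$ (i, j) = multrow n 0 U' $$ (i, j)" using assms r by (auto simp: U'_def)
    qed auto
    also have "\<dots> = 0 * det U'" by (rule det_multrow[OF _ c(2)]) (use r in simp)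
    finally show ?thesis by simp
  qed
  ultimately show False by simp
qed

lemma near_one_inverse:
  fixes B :: "('n::len0, 'k::field) mvps mat"
  assumes B: "B \<in> graded_maps False M M" "mat_ord 1 (1\<^sub>m (rank M) - B)"
  obtains r where "r \<in> graded_maps False M M" "B * r = 1\<^sub>m (rank M)" "r * B = 1\<^sub>m (rank M)"
proof -
  have e: "1\<^sub>m (rank M) - (1\<^sub>m (rank M) - B) = B" using B(1) by (auto intro!: eq_matI)
  have g: "1\<^sub>m (rank M) - B \<in> graded_maps False M M" by (intro graded_minus graded_one B(1))
  obtain r where "B * r = 1\<^sub>m (rank M)" "r * B = 1\<^sub>m (rank M)"
    and "1\<^sub>m (rank M) - B \<in> graded_maps False M M \<Longrightarrow> r \<in> graded_maps False M M"
    by (rule one_minus_nilpotent_inverse[OF graded_carrier[OF g] B(2), unfolded e]) blast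
  with g show ?thesis using that by blast
qed

lemma not_mat_ord_1:
  assumes "\<not> mat_ord 1 (A :: ('n::len0, 'k::field) mvps mat)"
  obtains i j g where "i < dim_row A" "j < dim_col A" "g * A $$ (i, j) = 1"
proof -
  obtain i j where ij: "i < dim_row A" "j < dim_col A" "\<not> ord_ge 1 (A $$ (i, j))"
    using assms unfolding mat_ord_def by blast
  then have "mvps_coeff (A $$ (i, j)) 0 \<noteq> 0" unfolding ord_ge_1_iff by blast
  then obtain g where "A $$ (i, j) * g = 1" by (rule mvps_unit)
  then have "g * A $$ (i, j) = 1" by (simp add: mult.commute)
  with ij(1,2) show ?thesis by (rule that)
qed

text \<open>
  A factorization $e = U V$ with $V U = 1$ is built up one rank at a time: as long as $e - U V$ is not
  zero it has a unit among its entries, because an idempotent with entries in the maximal ideal vanishes.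
\<close>

lemma split_idempotent:
  fixes e :: "('n::len0, 'k::field) mvps mat"
  assumes e: "e \<in> graded_maps False M M" "e * e = e"
  obtains ps U V where "U \<in> graded_maps False (MF ps (opr M)) M" "V \<in> graded_maps False M (MF ps (opr M))"
    "V * U = 1\<^sub>m (length ps)" "U * V = e"
proof -
  define n where "n = rank M"
  have ed [simp]: "dim_row e = n" "dim_col e = n" using e by (auto simp: n_def)
  define R where "R r \<longleftrightarrow> (\<exists>ps U V. length ps = r \<and> U \<in> graded_maps False (MF ps (opr M)) M \<and>
    V \<in> graded_maps False M (MF ps (opr M)) \<and> V * U = 1\<^sub>m r \<and> e * U = U \<and> V * e = V)" for r
  have "R 0" unfolding R_def
  proof (rule exI[of _ "[]"], rule exI[of _ "0\<^sub>m n 0"], rule exI[of _ "0\<^sub>m 0 n"], intro conjI)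
    show "0\<^sub>m n 0 \<in> graded_maps False (MF [] (opr M)) M" "0\<^sub>m 0 n \<in> graded_maps False M (MF [] (opr M))"
      by (auto simp: graded_maps_def n_def)
  qed (auto intro!: eq_matI)
  moreover have bound: "r \<le> n" if "R r" for r
  proof -
    from that obtain ps U V where *: "length ps = r" "U \<in> graded_maps False (MF ps (opr M)) M"
      "V \<in> graded_maps False M (MF ps (opr M))" "V * U = 1\<^sub>m r" unfolding R_def by blast
    show ?thesis by (rule left_inverse_rank_le[OF *(4)]) (use graded_carrier[OF *(2)] graded_carrier[OF *(3)] *(1) in \<open>auto simp: n_def\<close>)
  qed
  ultimately have "R (GREATEST r. R r)" by (rule GreatestI_nat)
  then obtain r where r: "R r" and max: "r = (GREATEST r. R r)" by simp
  from r obtain ps U V where rps: "length ps = r" and U: "U \<in> graded_maps False (MF ps (opr M)) M"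
    and V: "V \<in> graded_maps False M (MF ps (opr M))" and VU: "V * U = 1\<^sub>m r" and eU: "e * U = U" and Ve: "V * e = V"
    unfolding R_def by blast
  note r_def = rps[symmetric]
  have d [simp]: "dim_row U = n" "dim_col U = r" "dim_row V = r" "dim_col V = n"
    using U V by (auto simp: n_def r_def)
  define e1 where "e1 = e - U * V"
  have e1d [simp]: "dim_row e1 = n" "dim_col e1 = n" by (auto simp: e1_def)
  have e1g: "e1 \<in> graded_maps False M M" unfolding e1_def
    using graded_minus[OF e(1) graded_mult_even[OF V U]] .
  have eUV: "e * (U * V) = U * V" by (simp add: mat_assoc[symmetric] eU)
  have VUV: "V * (U * V) = V" by (simp add: mat_assoc[symmetric] VU)
  have ee1: "e * e1 = e1" "e1 * e = e1"
    by (simp_all add: e1_def mat_ring e(2) Ve eUV)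
  have Ve1: "V * e1 = 0\<^sub>m r n"
    by (simp add: e1_def mat_ring Ve VUV) (auto intro!: eq_matI)
  have e1U: "e1 * U = 0\<^sub>m n r"
    by (simp add: e1_def mat_ring VU eU) (auto intro!: eq_matI)
  have e1e1: "e1 * e1 = e1"
  proof -
    have "e1 * e1 = e1 * e - (e1 * U) * V" by (simp add: e1_def mat_ring)
    then show ?thesis unfolding e1U ee1 by (auto intro!: eq_matI)
  qed
  have "mat_ord 1 e1"
  proof (rule ccontr)
    assume "\<not> mat_ord 1 e1"
    then obtain i j g where ij: "i < n" "j < n" "g * e1 $$ (i, j) = 1"
      using not_mat_ord_1[of e1] by (metis e1d)
    have "e1 $$ (i, j) \<noteq> 0" using ij(3) by auto
    then have pij: "par M ! i = par M ! j"
      using gradedD[OF e1g, of i j] ij by (auto simp: n_def)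
    define E where "E = mat n 1 (\<lambda>(a, b). if a = j then 1 else 0 :: ('n, 'k) mvps)"
    define D where "D = mat 1 n (\<lambda>(a, b). if b = i then g else 0 :: ('n, 'k) mvps)"
    have Ed [simp]: "dim_row E = n" "dim_col E = 1" "dim_row D = 1" "dim_col D = n" by (auto simp: E_def D_def)
    have AE: "(A * E) $$ (a, 0) = A $$ (a, j)" if "dim_col A = n" "a < dim_row A" for A a
    proof -
      have "(A * E) $$ (a, 0) = (\<Sum>k\<in>{0..<n}. A $$ (a, k) * (if k = j then 1 else 0))"
        using that by (simp add: index_mult_mat scalar_prod_def E_def)
      also have "\<dots> = A $$ (a, j)" using ij by (simp add: if_distrib[of "(*) _"] cong: if_cong)
      finally show ?thesis .
    qed
    have DA: "(D * A) $$ (0, b) = g * A $$ (i, b)" if "dim_row A = n" "b < dim_col A" for A b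
    proof -
      have "(D * A) $$ (0, b) = (\<Sum>k\<in>{0..<n}. (if k = i then g else 0) * A $$ (k, b))"
        using that by (simp add: index_mult_mat scalar_prod_def D_def)
      also have "\<dots> = g * A $$ (i, b)" using ij by (simp add: if_distrib[of "\<lambda>x. x * _"] cong: if_cong)
      finally show ?thesis .
    qed
    define c where "c = e1 * E"
    define v where "v = D * e1"
    have cd [simp]: "dim_row c = n" "dim_col c = 1" "dim_row v = 1" "dim_col v = n" by (auto simp: c_def v_def)
    have vc: "v * c = 1\<^sub>m 1"
    proof -
      have "v * c = D * ((e1 * e1) * E)" by (simp add: v_def c_def mat_assoc)
      then have "v * c = D * (e1 * E)" unfolding e1e1 .
      moreover have "(D * (e1 * E)) $$ (0, 0) = 1" using ij by (subst DA) (auto simp: AE)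
      ultimately show ?thesis by (auto intro!: eq_matI)
    qed
    have Vc: "V * c = 0\<^sub>m r 1" by (simp add: c_def mat_assoc[symmetric] Ve1)
    have vU: "v * U = 0\<^sub>m 1 r" by (simp add: v_def mat_assoc e1U)
    have ec: "e * c = c" by (simp add: c_def mat_assoc[symmetric] ee1)
    have ve: "v * e = v" by (simp add: v_def mat_assoc ee1)
    define U' where "U' = four_block_mat U c (0\<^sub>m 0 r) (0\<^sub>m 0 1)"
    define V' where "V' = four_block_mat V (0\<^sub>m r 0) v (0\<^sub>m 1 0)"
    let ?ps = "ps @ [par M ! j]"
    have "R (Suc r)" unfolding R_def
    proof (rule exI[of _ ?ps], rule exI[of _ U'], rule exI[of _ V'], intro conjI)
      show "length ?ps = Suc r" by (simp add: r_def)
      show "V' * U' = 1\<^sub>m (Suc r)"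
        unfolding V'_def U'_def using VU vc Vc vU
        by (simp add: four_mult)
      have e4: "e = four_block_mat e (0\<^sub>m n 0) (0\<^sub>m 0 n) (0\<^sub>m 0 0)" by (simp add: four_block_empty_col)
      show "e * U' = U'" unfolding U'_def by (subst e4) (simp add: four_mult eU ec)
      show "V' * e = V'" unfolding V'_def by (subst e4) (simp add: four_mult Ve ve)
      show "U' \<in> graded_maps False (MF ?ps (opr M)) M"
      proof (rule gradedI)
        fix a b assume ab: "a < rank M" "b < rank (MF ?ps (opr M))" "U' $$ (a, b) \<noteq> 0"
        show "(par M ! a \<noteq> par (MF ?ps (opr M)) ! b) = False"
        proof (cases "b < r")
          case True
          then show ?thesis using ab gradedD[OF U, of a b] by (auto simp: U'_def nth_append r_def[symmetric] n_def[symmetric])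
        next
          case False
          then have "b = r" using ab by (simp add: r_def)
          then have "c $$ (a, 0) \<noteq> 0" using ab by (auto simp: U'_def n_def[symmetric])
          then have "e1 $$ (a, j) \<noteq> 0" using ab AE[of e1 a] by (simp add: c_def n_def[symmetric])
          then show ?thesis using gradedD[OF e1g, of a j] ab ij \<open>b = r\<close> by (auto simp: n_def r_def)
        qed
      qed (auto simp: U'_def n_def r_def)
      show "V' \<in> graded_maps False M (MF ?ps (opr M))"
      proof (rule gradedI)
        fix a b assume ab: "a < rank (MF ?ps (opr M))" "b < rank M" "V' $$ (a, b) \<noteq> 0"
        show "(par (MF ?ps (opr M)) ! a \<noteq> par M ! b) = False"
        proof (cases "a < r")
          case True
          then show ?thesis using ab gradedD[OF V, of a b] by (auto simp: V'_def nth_append r_def[symmetric] n_def[symmetric])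
        next
          case False
          then have "a = r" using ab by (simp add: r_def)
          then have "v $$ (0, b) \<noteq> 0" using ab by (auto simp: V'_def n_def[symmetric])
          then have "e1 $$ (i, b) \<noteq> 0" using ab DA[of e1 b] by (auto simp add: v_def n_def[symmetric])
          then show ?thesis using gradedD[OF e1g, of i b] ab ij pij \<open>a = r\<close> by (auto simp: n_def r_def)
        qed
      qed (auto simp: V'_def n_def r_def)
    qed
    then have "Suc r \<le> (GREATEST r. R r)" by (rule Greatest_le_nat) (use bound in auto)
    then show False using max by simp
  qed
  then obtain q where q: "q \<in> carrier_mat n n" "(1\<^sub>m n - e1) * q = 1\<^sub>m n"
    using one_minus_nilpotent_inverse[of e1 n] by (metis carrier_matI e1d)
  have "e1 * (1\<^sub>m n - e1) = 0\<^sub>m n n" by (simp add: mat_ring e1e1) (auto intro!: eq_matI)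
  then have "e1 * ((1\<^sub>m n - e1) * q) = 0\<^sub>m n n" using q(1) by (simp add: mat_assoc[symmetric])
  then have "e1 = 0\<^sub>m n n" unfolding q(2) by simp
  then have "U * V = e" using minus_mat_eq_0_iff[of e "U * V" n n] by (simp add: e1_def)
  with U V VU[folded rps] show ?thesis by (rule that)
qed

lemma split_mf:
  fixes M :: "('n::len0, 'k::field) mvps mf"
  assumes M: "is_mf w M" and e: "e \<in> chain_maps M M" "e * e = e"
  obtains M' U V where "is_mf w M'" "U \<in> chain_maps M' M" "V \<in> chain_maps M M'"
    "V * U = 1\<^sub>m (rank M')" "U * V = e" "opr M' = V * opr M * U"
proof -
  note mf = is_mfD[OF M]
  have eQ: "opr M * e = e * opr M" using e M by (simp add: chain_iff)
  obtain ps U V where U: "U \<in> graded_maps False (MF ps (opr M)) M" and V: "V \<in> graded_maps False M (MF ps (opr M))"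
    and VU: "V * U = 1\<^sub>m (length ps)" and UV: "U * V = e"
    using split_idempotent[OF chainD(1)[OF e(1)] e(2)] .
  define M' where "M' = MF ps (V * opr M * U)"
  have g: "U \<in> graded_maps False M' M" "V \<in> graded_maps False M M'"
    using U V by (auto simp: M'_def graded_maps_def)
  have d [simp]: "dim_row U = rank M" "dim_col U = rank M'" "dim_row V = rank M'" "dim_col V = rank M"
    using g by auto
  note [simp] = mf(3,4)
  have VU': "V * U = 1\<^sub>m (rank M')" using VU by (simp add: M'_def)
  have "V * opr M * U * (V * opr M * U) = V * (opr M * (e * (opr M * U)))" unfolding UV[symmetric] by (simp add: mat_assoc)
  also have "\<dots> = V * (opr M * opr M * (e * U))"
  proof -
    have "e * (opr M * U) = opr M * (e * U)"
      using chainD[OF e(1)] by (simp add: mat_assoc[symmetric] eQ)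
    then show ?thesis using chainD[OF e(1)] by (simp add: mat_assoc)
  qed
  also have "e * U = U" unfolding UV[symmetric] by (simp add: mat_assoc VU')
  also have "V * (opr M * opr M * U) = w \<cdot>\<^sub>m 1\<^sub>m (rank M')" unfolding mf(2) by (simp add: mat_ring VU')
  finally have "is_mf w M'"
    using graded_mult_even[OF g(1) graded_mult_odd[OF mf(1) g(2)]]
    by (simp add: is_mf_def) (simp add: M'_def)
  moreover have "U \<in> chain_maps M' M"
  proof -
    have "U * opr M' = e * (opr M * U)" unfolding UV[symmetric] by (simp add: M'_def mat_assoc)
    also have "\<dots> = opr M * (e * U)"
      using chainD[OF e(1)] by (simp add: mat_assoc[symmetric] eQ)
    also have "e * U = U" unfolding UV[symmetric] by (simp add: mat_assoc VU')
    finally show ?thesis using g by (simp add: chain_iff[OF \<open>is_mf w M'\<close> M])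
  qed
  moreover have "V \<in> chain_maps M M'"
  proof -
    have "opr M' * V = V * (opr M * e)" unfolding UV[symmetric] by (simp add: M'_def mat_assoc)
    also have "\<dots> = V * e * opr M"
      using chainD[OF e(1)] by (simp add: mat_assoc eQ)
    also have "V * e = V" unfolding UV[symmetric] by (simp add: mat_assoc[symmetric] VU')
    finally show ?thesis using g by (simp add: chain_iff[OF M \<open>is_mf w M'\<close>])
  qed
  ultimately show ?thesis using VU' UV by (intro that) (auto simp: M'_def)
qed

section \<open>Minimal matrix factorizations\<close>

text \<open>
  Homotopies then change maps only by matrices with entries in the maximal ideal; this is what makes
  power series in boundaries converge and homotopy equivalences invertible.
\<close>

definition minimal :: "('n::len0, 'k::comm_ring_1) mvps mf \<Rightarrow> bool" where
  "minimal M \<longleftrightarrow> mat_ord 1 (opr M)"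

lemma htp_equiv_refl: "is_mf w M \<Longrightarrow> htp_equiv M M (1\<^sub>m (rank M)) (1\<^sub>m (rank M))"
  using chain_one[of w M] htp_refl[of w M w M] by (simp add: htp_equiv_def)

text \<open>
  A representative of least rank is minimal. Otherwise its operator has a unit entry $Q_{ij}$, and
  $h = E_{ji} / Q_{ij}$ satisfies $h^2 = 0$ and $h Q h = h$. Therefore $e = Q h + h Q$ is a nonzero
  idempotent chain map that is homotopic to zero, and the image of $1 - e$ is a homotopy equivalent
  factorization of smaller rank.
\<close>

lemma minimal_model:
  fixes M :: "('n::len0, 'k::field) mvps mf"
  assumes M: "is_mf w M"
  obtains M' f g where "is_mf w M'" "minimal M'" "htp_equiv M' M f g"
proof -
  define P where "P r \<longleftrightarrow> (\<exists>M' f g. is_mf w M' \<and> htp_equiv M' M f g \<and> rank M' = r)" for r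
  have "P (rank M)" using M htp_equiv_refl unfolding P_def by blast
  then have "P (LEAST r. P r)" by (rule LeastI)
  then obtain M' f g where M': "is_mf w M'" and fg: "htp_equiv M' M f g" and r: "rank M' = (LEAST r. P r)"
    unfolding P_def by blast
  have "minimal M'"
  proof (rule ccontr)
    assume "\<not> minimal M'"
    define n where "n = rank M'"
    define Q where "Q = opr M'"
    note mf = is_mfD[OF M', folded n_def Q_def]
    note [simp] = mf(3,4)
    obtain i j c where ij: "i < n" "j < n" "c * Q $$ (i, j) = 1"
      using not_mat_ord_1[of Q] \<open>\<not> minimal M'\<close> unfolding minimal_def Q_def[symmetric] by (metis mf(3,4))
    have "Q $$ (i, j) \<noteq> 0" using ij(3) by auto
    then have pij: "par M' ! i \<noteq> par M' ! j" using gradedD[OF mf(1), of i j] ij by (auto simp: n_def)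
    define h where "h = mat n n (\<lambda>(a, b). if a = j \<and> b = i then c else 0 :: ('n, 'k) mvps)"
    have hd [simp]: "dim_row h = n" "dim_col h = n" by (auto simp: h_def)
    have hg: "h \<in> graded_maps True M' M'"
      by (rule gradedI) (use pij in \<open>auto simp: h_def n_def split: if_splits\<close>)
    have hA: "(h * A) $$ (a, b) = (if a = j then c * A $$ (i, b) else 0)" if "dim_row A = n" "a < n" "b < dim_col A" for A a b
    proof -
      have "(h * A) $$ (a, b) = (\<Sum>k\<in>{0..<n}. (if a = j \<and> k = i then c else 0) * A $$ (k, b))"
        using that by (simp add: index_mult_mat scalar_prod_def h_def)
      also have "\<dots> = (\<Sum>k\<in>{0..<n}. if k = i then (if a = j then c * A $$ (i, b) else 0) else 0)"
        by (rule sum.cong) auto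
      also have "\<dots> = (if a = j then c * A $$ (i, b) else 0)" using ij by (subst sum.delta) auto
      finally show ?thesis .
    qed
    have Ah: "(A * h) $$ (a, b) = (if b = i then c * A $$ (a, j) else 0)" if "dim_col A = n" "a < dim_row A" "b < n" for A a b
    proof -
      have "(A * h) $$ (a, b) = (\<Sum>k\<in>{0..<n}. A $$ (a, k) * (if k = j \<and> b = i then c else 0))"
        using that by (simp add: index_mult_mat scalar_prod_def h_def)
      also have "\<dots> = (\<Sum>k\<in>{0..<n}. if k = j then (if b = i then c * A $$ (a, j) else 0) else 0)"
        by (rule sum.cong) auto
      also have "\<dots> = (if b = i then c * A $$ (a, j) else 0)" using ij by (subst sum.delta) auto
      finally show ?thesis .
    qed
    have inj: "i \<noteq> j" using pij by auto
    have hh: "h * h = 0\<^sub>m n n"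
      by (rule eq_matI) (use ij inj in \<open>auto simp: hA\<close>, auto simp: h_def)
    have hQh: "h * (Q * h) = h"
      by (rule eq_matI) (use ij in \<open>auto simp: hA Ah\<close>, auto simp: h_def mult.assoc)
    define e where "e = Q * h + h * Q"
    have ed [simp]: "dim_row e = n" "dim_col e = n" by (auto simp: e_def)
    have hhQ: "h * (h * Q) = 0\<^sub>m n n" by (simp add: mat_assoc[symmetric] hh)
    have he: "h * e = h" by (simp add: e_def mat_ring hQh hhQ)
    have eh: "e * h = h" by (simp add: e_def mat_ring hQh hh)
    have Qe: "Q * e = e * Q"
    proof -
      have "Q * (Q * h) = w \<cdot>\<^sub>m h" by (simp add: mat_assoc[symmetric] mf(2) mat_smultl)
      then show ?thesis
        by (simp add: e_def mat_ring mf(2)) (auto intro!: eq_matI)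
    qed
    have ee: "e * e = e"
    proof -
      have "e * e = e * (Q * h) + e * (h * Q)" by (subst (2) e_def) (simp add: mat_ring)
      also have "e * (Q * h) = Q * (e * h)" by (simp add: mat_assoc[symmetric] Qe)
      also have "e * (h * Q) = h * Q" by (simp add: mat_assoc[symmetric] eh)
      finally show ?thesis unfolding eh by (simp add: e_def)
    qed
    have eg: "e \<in> graded_maps False M' M'"
      using graded_mult_odd[OF hg mf(1)] graded_mult_odd[OF mf(1) hg] by (simp add: e_def graded_add)
    let ?e = "1\<^sub>m n - e"
    have o: "1\<^sub>m n \<in> chain_maps M' M'" using chain_one[OF M'] by (simp add: n_def)
    have ec: "e \<in> chain_maps M' M'" using eg Qe by (simp add: chain_iff[OF M' M'] Q_def)
    have 1: "?e \<in> chain_maps M' M'" by (rule chain_minus[OF M' M' o ec])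
    have 2: "?e * ?e = ?e" by (simp add: mat_ring ee) (auto intro!: eq_matI)
    obtain M'' U V where s: "is_mf w M''" "U \<in> chain_maps M'' M'" "V \<in> chain_maps M' M''"
      "V * U = 1\<^sub>m (rank M'')" "U * V = ?e"
      using split_mf[OF M' 1 2] by metis
    note sd = chainD[OF s(2)] chainD[OF s(3)]
    have "htp M' M' (1\<^sub>m n) ?e"
    proof (rule htpI[OF M' M' o 1 hg])
      have "1\<^sub>m n = ?e + e" by (auto intro!: eq_matI)
      then show "1\<^sub>m n = ?e + (opr M' * h + h * opr M')" by (simp add: e_def Q_def)
    qed
    then have "htp_equiv M'' M' U V"
      using s htp_sym[OF M' M'] htp_refl[OF s(1) s(1) chain_one[OF s(1)]] by (auto simp: htp_equiv_def n_def)
    then have "htp_equiv M'' M (f * U) (V * g)" by (rule htp_equiv_trans[OF s(1) M' M _ fg])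
    then have "P (rank M'')" using s(1) unfolding P_def by blast
    then have "rank M' \<le> rank M''" unfolding r by (rule Least_le)
    moreover have "rank M'' \<le> rank M'"
      by (rule left_inverse_rank_le[OF s(4) graded_carrier[OF sd(4)] graded_carrier[OF sd(1)]])
    ultimately have rr: "rank M'' = n" by (simp add: n_def)
    have c: "U \<in> carrier_mat n n" "V \<in> carrier_mat n n" using sd rr by (auto simp: n_def)
    have "U * V = 1\<^sub>m n"
    proof -
      have du: "det V * det U = 1" using det_mult[OF c(2,1)] s(4) rr by simp
      have "U * adj_mat U = det U \<cdot>\<^sub>m 1\<^sub>m n" "adj_mat U \<in> carrier_mat n n"
        using adj_mat[OF c(1)] by auto
      then have "V * (U * adj_mat U) = det U \<cdot>\<^sub>m V" using c by (simp add: mat_smultr)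
      moreover have "V * (U * adj_mat U) = adj_mat U"
        using c \<open>adj_mat U \<in> _\<close> s(4) rr by (simp add: mat_assoc[symmetric])
      ultimately have "U * (det U \<cdot>\<^sub>m V) = det U \<cdot>\<^sub>m 1\<^sub>m n" using \<open>U * adj_mat U = _\<close> by simp
      then have "det V \<cdot>\<^sub>m (det U \<cdot>\<^sub>m (U * V)) = det V \<cdot>\<^sub>m (det U \<cdot>\<^sub>m 1\<^sub>m n)" using c by (simp add: mat_smultr)
      then show ?thesis by (simp add: mat_smult_smult du)
    qed
    then have "h * (1\<^sub>m n - e) = h" using s(5) by simp
    moreover have "h * (1\<^sub>m n - e) = 0\<^sub>m n n" by (simp add: mat_ring he) (auto intro!: eq_matI)
    ultimately have "h = 0\<^sub>m n n" by metis
    then have "h $$ (j, i) = 0" using ij by simp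
    then have "c = 0" using ij by (simp add: h_def)
    then show False using ij(3) by simp
  qed
  with M' fg show ?thesis using that by blast
qed

lemma minimal_htp_ord:
  assumes mfs: "is_mf w M" "is_mf w M'" and m: "minimal M" "minimal M'" and f: "htp M M' f g"
  shows "mat_ord 1 (g - f)"
proof -
  note mf = is_mfD[OF mfs(1)] is_mfD[OF mfs(2)]
  note d = chainD[OF htpD(1)[OF f]] chainD[OF htpD(2)[OF f]]
  obtain h where h: "h \<in> graded_maps True M M'" "g = f + (opr M' * h + h * opr M)"
    using htpE[OF mfs htp_sym[OF mfs f]] .
  have "mat_ord 0 h" by (simp add: mat_ord_def ord_ge_0)
  then have "mat_ord 1 (opr M' * h)" "mat_ord 1 (h * opr M)"
    using mat_ord_mult[of 1 "opr M'" 0 h] mat_ord_mult[of 0 h 1 "opr M"] m mf h by (simp_all add: minimal_def)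
  then show ?thesis
    unfolding h(2) using mf h d
    by (auto simp: mat_ord_def ord_ge_1_iff[simplified] plus_mvps.rep_eq minus_mvps.rep_eq)
qed

text \<open>
  The obstruction $t = g^2 - g$ is a boundary with entries in the maximal ideal. The correction
  $(1 - 2 g) c(t)$ is the product of $t$ with a chain map, hence again a boundary.
\<close>

lemma idempotent_lift:
  fixes M :: "('n::len0, 'k::field_char_0) mvps mf"
  assumes M: "is_mf w M" "minimal M" and g: "g \<in> chain_maps M M" "htp M M (g * g) g"
  obtains e where "e \<in> chain_maps M M" "e * e = e" "htp M M e g"
proof -
  define n where "n = rank M"
  define Q where "Q = opr M"
  note mf = is_mfD[OF M(1), folded n_def Q_def]
  note [simp] = mf(3,4)
  have gd [simp]: "dim_row g = n" "dim_col g = n" using chainD[OF g(1)] by (auto simp: n_def)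
  have gQ: "Q * g = g * Q" using g(1) by (simp add: chain_iff[OF M(1) M(1)] Q_def)
  obtain h where h: "h \<in> graded_maps True M M" "g * g = g + (Q * h + h * Q)"
    using htpE[OF M(1) M(1) g(2)] by (metis Q_def)
  have hd [simp]: "dim_row h = n" "dim_col h = n" using h by (auto simp: n_def)
  define t where "t = Q * h + h * Q"
  have gg: "g * g = g + t" using h by (simp add: t_def)
  have td [simp]: "dim_row t = n" "dim_col t = n" by (auto simp: t_def)
  have te: "t = g * g - g" unfolding gg by (auto intro!: eq_matI)
  have gt: "g * t = t * g" unfolding te by (simp add: mat_ring)
  have Qt: "Q * t = t * Q"
  proof -
    have "Q * (g * g) = (Q * g) * g" by (simp add: mat_assoc)
    also have "\<dots> = g * (Q * g)" by (subst gQ) (simp add: mat_assoc)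
    finally have "Q * (g * g) = g * (Q * g)" .
    then show ?thesis unfolding te by (simp add: mat_ring gQ)
  qed
  have tg: "t \<in> graded_maps False M M" unfolding te
    using graded_minus[OF graded_mult_even[OF chainD(1)[OF g(1)] chainD(1)[OF g(1)]] chainD(1)[OF g(1)]] .
  have "mat_ord 1 (g - g * g)" by (rule minimal_htp_ord[OF M(1,1,2,2) g(2)])
  then have to: "mat_ord 1 t"
    by (auto simp: te mat_ord_def ord_ge_1_iff[simplified] minus_mvps.rep_eq)
  have tc: "t \<in> carrier_mat n n" by auto
  obtain c c1 :: "'k fps" where c: "c = fps_X * c1"
    "fps_X + (c * c - c) + (fps_X * (c * c - c) + fps_X * (c * c - c) + fps_X * (c * c - c) + fps_X * (c * c - c)) = 0"
    by (rule idempotent_series)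
  define K where "K = fps_of_mat t c"
  define C where "C = fps_of_mat t c1"
  have Kd [simp]: "dim_row K = n" "dim_col K = n" "dim_row C = n" "dim_col C = n" by (auto simp: K_def C_def)
  have KC: "K = t * C" unfolding K_def c(1) fps_of_mat_mult[OF tc to] fps_of_mat_X[OF tc to] C_def ..
  define L where "L = K * K - K"
  have Ld [simp]: "dim_row L = n" "dim_col L = n" by (auto simp: L_def)
  have rel: "t + L + (t * L + t * L + t * L + t * L) = 0\<^sub>m n n"
    using arg_cong[OF c(2), of "fps_of_mat t"]
    unfolding fps_of_mat_add fps_of_mat_minus fps_of_mat_mult[OF tc to] fps_of_mat_X[OF tc to] fps_of_mat_zero
    by (simp add: K_def L_def)
  note com = fps_of_mat_commute[OF tc to]
  have gK: "g * K = K * g" and gC: "g * C = C * g" and QC: "Q * C = C * Q" and tK: "t * K = K * t"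
    unfolding K_def C_def by (auto intro!: com simp: gt Qt)
  have CM: "C \<in> graded_maps False M M" unfolding C_def by (rule fps_of_mat_graded[OF tg])
  define P where "P = 1\<^sub>m n - (g + g)"
  have Pd [simp]: "dim_row P = n" "dim_col P = n" by (auto simp: P_def)
  have Pt: "P * t = t * P" by (simp add: P_def mat_ring gt)
  have QP: "Q * P = P * Q" by (simp add: P_def mat_ring gQ)
  have Pc: "P \<in> graded_maps False M M" unfolding P_def
    using graded_minus[OF _ graded_add[OF chainD(1)[OF g(1)] chainD(1)[OF g(1)]]] graded_one[of M] by (simp add: n_def)
  define e where "e = g + P * K"
  have ed [simp]: "dim_row e = n" "dim_col e = n" by (auto simp: e_def)
  have e2: "e * e = e"
  proof -
    have "e * e = g * g + (g * K - (g * g) * K - (g * g) * K) + (K * g - (g * K) * g - (g * K) * g) + (P * K) * (P * K)"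
      unfolding e_def P_def by (auto intro!: eq_matI simp: mat_ring)
    also have "(P * K) * (P * K) = (P * P) * (K * K)"
    proof -
      have "K * P = P * K" by (simp add: P_def mat_ring gK)
      then have "K * (P * K) = P * (K * K)" by (simp add: mat_assoc[symmetric])
      then show ?thesis by (simp add: mat_assoc)
    qed
    also have "P * P = 1\<^sub>m n + (t + t + t + t)"
      unfolding P_def by (auto intro!: eq_matI simp: mat_ring gg algebra_simps)
    also have "(g * K) * g = (g * g) * K" by (simp add: mat_assoc gK[symmetric])
    also have "K * g = g * K" by (simp add: gK)
    also have "g * g = g + t" by (rule gg)
    finally have ee: "e * e = g + t + (g * K - (g + t) * K - (g + t) * K) + (g * K - (g + t) * K - (g + t) * K)
      + (1\<^sub>m n + (t + t + t + t)) * (K * K)" .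
    have LL: "K * K = L + K" by (auto intro!: eq_matI simp: L_def)
    have tL: "t * (K * K) = t * L + t * K" unfolding LL by (simp add: mat_ring)
    show ?thesis
    proof (rule eq_matI)
      fix i j assume "i < dim_row e" "j < dim_col e"
      then have ij: "i < n" "j < n" by auto
      have "(e * e) $$ (i, j) = (g + P * K) $$ (i, j) + (t + L + (t * L + t * L + t * L + t * L)) $$ (i, j)"
        unfolding ee P_def using ij
        by (simp add: mat_ring tL) (simp add: LL)
      then show "(e * e) $$ (i, j) = e $$ (i, j)" unfolding rel using ij by (simp add: e_def)
    qed auto
  qed
  define z where "z = P * C"
  have zd [simp]: "dim_row z = n" "dim_col z = n" by (auto simp: z_def)
  have zc: "z \<in> graded_maps False M M" unfolding z_def by (rule graded_mult_even[OF CM Pc])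
  have Qz: "z * Q = Q * z"
  proof -
    have "z * Q = P * (Q * C)" by (simp add: z_def mat_assoc QC)
    also have "\<dots> = (Q * P) * C" by (simp add: QP mat_assoc)
    finally show ?thesis by (simp add: z_def mat_assoc)
  qed
  have PK: "P * K = t * z"
  proof -
    have "P * K = (P * t) * C" by (simp add: KC mat_assoc)
    then show ?thesis unfolding Pt by (simp add: z_def mat_assoc)
  qed
  have tz: "t * z = Q * (h * z) + (h * z) * Q"
    unfolding t_def by (simp add: mat_ring Qz)
  have ec: "e \<in> chain_maps M M"
  proof -
    have "e \<in> graded_maps False M M" unfolding e_def PK
      by (intro graded_add chainD(1)[OF g(1)] graded_mult_even[OF zc tg])
    moreover have "Q * e = e * Q"
    proof -
      have "Q * (t * z) = t * (Q * z)" by (simp add: mat_assoc[symmetric] Qt)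
      then show ?thesis unfolding e_def PK by (simp add: mat_ring gQ Qz)
    qed
    ultimately show ?thesis by (simp add: chain_iff[OF M(1) M(1)] Q_def)
  qed
  moreover have "htp M M e g"
    by (rule htpI[OF M(1) M(1) ec g(1), of "h * z"]) (use graded_mult_even[OF zc h(1)] in \<open>auto simp: e_def PK tz Q_def[symmetric]\<close>)
  ultimately show ?thesis using e2 that by blast
qed

section \<open>Essential surjectivity\<close>

text \<open>
  For a homotopy retract $N$ of $\theta(M)$ with inclusion $i$ and retraction $p$, the map $i p$ is
  idempotent up to homotopy. It comes from a map with the same property on $M$, which may be taken
  minimal; there the idempotent can be lifted and split, and $\theta$ of its image is $N$.
\<close>

theorem theta_essentially_surjective:
  fixes \<pi> :: "('n::len0, 'k::field_char_0) mvps"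
  assumes N: "is_mf (var_x * var_y - const_xy \<pi>) N"
  obtains M f g where "is_mf \<pi> M" "minimal M" "htp_equiv (theta_mf M) N f g"
proof -
  obtain M0 p i where M0: "is_mf \<pi> M0" and p: "p \<in> chain_maps (theta_mf M0) N" and i: "i \<in> chain_maps N (theta_mf M0)"
    and pi: "htp N N (p * i) (1\<^sub>m (rank N))"
    using theta_retract[OF N] .
  obtain M a b where M: "is_mf \<pi> M" "minimal M" and ab: "htp_equiv M M0 a b"
    using minimal_model[OF M0] .
  note t0 = theta_is_mf[OF M0] and t = theta_is_mf[OF M(1)]
  have a: "a \<in> chain_maps M M0" and b: "b \<in> chain_maps M0 M" and hab: "htp M0 M0 (a * b) (1\<^sub>m (rank M0))"
    using ab by (auto simp: htp_equiv_def)
  note da = chainD[OF a] chainD[OF b]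
  define p1 where "p1 = p * theta_map M a"
  define i1 where "i1 = theta_map M0 b * i"
  have p1: "p1 \<in> chain_maps (theta_mf M) N" unfolding p1_def
    by (rule chain_mult[OF t t0 N theta_map_chain[OF M(1) M0 a] p])
  have i1: "i1 \<in> chain_maps N (theta_mf M)" unfolding i1_def
    by (rule chain_mult[OF N t0 t i theta_map_chain[OF M0 M(1) b]])
  note dp = chainD[OF p] chainD[OF i] chainD[OF p1] chainD[OF i1]
  have pi1: "htp N N (p1 * i1) (1\<^sub>m (rank N))"
  proof -
    have "htp (theta_mf M0) (theta_mf M0) (theta_map M0 (a * b)) (1\<^sub>m (rank (theta_mf M0)))"
      using theta_htp[OF M0 M0 hab] by (simp only: theta_map_one)
    then have "htp N (theta_mf M0) (theta_map M0 (a * b) * i) (1\<^sub>m (rank (theta_mf M0)) * i)"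
      by (rule htp_mult_right[OF N t0 t0 i])
    then have "htp N N (p * (theta_map M0 (a * b) * i)) (p * (1\<^sub>m (rank (theta_mf M0)) * i))"
      by (rule htp_mult_left[OF N t0 N _ p])
    moreover have "p * (theta_map M0 (a * b) * i) = p1 * i1"
      using da dp by (simp add: p1_def i1_def theta_map_mult[of b M0 M a] mat_assoc)
    moreover have "p * (1\<^sub>m (rank (theta_mf M0)) * i) = p * i" using dp by simp
    ultimately show ?thesis using htp_trans[OF N N _ pi] by simp
  qed
  have ip: "i1 * p1 \<in> chain_maps (theta_mf M) (theta_mf M)" by (rule chain_mult[OF t N t p1 i1])
  obtain g where g: "g \<in> chain_maps M M" and ipg: "htp (theta_mf M) (theta_mf M) (i1 * p1) (theta_map M g)"
    using theta_full[OF M(1) M(1) ip] .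
  note dg = chainD[OF g]
  have ipip: "htp (theta_mf M) (theta_mf M) ((i1 * p1) * (i1 * p1)) (i1 * p1)"
  proof -
    have "htp (theta_mf M) N (p1 * i1 * p1) (1\<^sub>m (rank N) * p1)" by (rule htp_mult_right[OF t N N p1 pi1])
    from htp_mult_left[OF t N t this i1] show ?thesis using dp by (simp add: mat_assoc)
  qed
  have gg: "htp M M (g * g) g"
  proof (rule theta_faithful[OF M(1) M(1) chain_mult[OF M(1) M(1) M(1) g g] g])
    have "htp (theta_mf M) (theta_mf M) (theta_map M (g * g)) ((i1 * p1) * (i1 * p1))"
      using htp_sym[OF t t htp_mult[OF t t t ipg ipg]] dg by (simp add: theta_map_mult[of g M M g])
    then show "htp (theta_mf M) (theta_mf M) (theta_map M (g * g)) (theta_map M g)"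
      using htp_trans[OF t t htp_trans[OF t t _ ipip] ipg] by blast
  qed
  obtain e where e: "e \<in> chain_maps M M" "e * e = e" "htp M M e g"
    using idempotent_lift[OF M g gg] .
  have ipe: "htp (theta_mf M) (theta_mf M) (i1 * p1) (theta_map M e)"
    by (rule htp_trans[OF t t ipg htp_sym[OF t t theta_htp[OF M(1) M(1) e(3)]]])
  obtain M' U V where M': "is_mf \<pi> M'" and U: "U \<in> chain_maps M' M" and V: "V \<in> chain_maps M M'"
    and VU: "V * U = 1\<^sub>m (rank M')" and UV: "U * V = e" and oM': "opr M' = V * opr M * U"
    using split_mf[OF M(1) e(1,2)] .
  note du = chainD[OF U] chainD[OF V] and t' = theta_is_mf[OF M'] and mM = is_mfD[OF M(1)]
  have m': "minimal M'"
  proof -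
    have "mat_ord (0 + 1 + 0) (V * opr M * U)"
      by (intro mat_ord_mult M(2)[unfolded minimal_def]) (use du mM in \<open>auto simp: mat_ord_def ord_ge_0\<close>)
    then show ?thesis by (simp add: minimal_def oM')
  qed
  define f where "f = p1 * theta_map M' U"
  define k where "k = theta_map M V * i1"
  note tU = theta_map_chain[OF M' M(1) U] and tV = theta_map_chain[OF M(1) M' V]
  have f: "f \<in> chain_maps (theta_mf M') N" unfolding f_def by (rule chain_mult[OF t' t N tU p1])
  have k: "k \<in> chain_maps N (theta_mf M')" unfolding k_def by (rule chain_mult[OF N t t' i1 tV])
  have "htp (theta_mf M') (theta_mf M') (k * f) (1\<^sub>m (rank (theta_mf M')))"
  proof -
    have "htp (theta_mf M') (theta_mf M) ((i1 * p1) * theta_map M' U) (theta_map M e * theta_map M' U)"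
      by (rule htp_mult_right[OF t' t t tU ipe])
    then have "htp (theta_mf M') (theta_mf M') (theta_map M V * ((i1 * p1) * theta_map M' U)) (theta_map M V * (theta_map M e * theta_map M' U))"
      by (rule htp_mult_left[OF t' t t' _ tV])
    moreover have "theta_map M V * ((i1 * p1) * theta_map M' U) = k * f"
      using du dp by (simp add: k_def f_def mat_assoc)
    moreover have "theta_map M V * (theta_map M e * theta_map M' U) = 1\<^sub>m (rank (theta_mf M'))"
    proof -
      have "theta_map M V * (theta_map M e * theta_map M' U) = theta_map M' (V * (e * U))"
        using du chainD[OF e(1)] by (simp add: theta_map_mult[of "e * U" M' M V] theta_map_mult[of U M' M e])
      also have "V * (e * U) = (V * U) * (V * U)" unfolding UV[symmetric] using du by (simp add: mat_assoc)
      also have "\<dots> = 1\<^sub>m (rank M')" by (simp add: VU)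
      finally show ?thesis by (simp only: theta_map_one)
    qed
    ultimately show ?thesis by simp
  qed
  moreover have "htp N N (f * k) (1\<^sub>m (rank N))"
  proof -
    have "htp N (theta_mf M) (theta_map M e * i1) (i1 * p1 * i1)"
      by (rule htp_mult_right[OF N t t i1 htp_sym[OF t t ipe]])
    then have "htp N N (p1 * (theta_map M e * i1)) (p1 * (i1 * p1 * i1))"
      by (rule htp_mult_left[OF N t N _ p1])
    moreover have "p1 * (theta_map M e * i1) = f * k"
      using du dp unfolding UV[symmetric] by (simp add: k_def f_def theta_map_mult[of V M M' U] mat_assoc)
    moreover have "p1 * (i1 * p1 * i1) = (p1 * i1) * (p1 * i1)" using dp by (simp add: mat_assoc)
    moreover have "htp N N ((p1 * i1) * (p1 * i1)) (1\<^sub>m (rank N))"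
      using htp_mult[OF N N N pi1 pi1] by simp
    ultimately show ?thesis using htp_trans[OF N N] by metis
  qed
  ultimately have "htp_equiv (theta_mf M') N f k" using f k by (simp add: htp_equiv_def)
  with M' m' show ?thesis by (rule that)
qed

section \<open>Duality\<close>

text \<open>Both kinds of forms are isomorphisms to a dual; the flag distinguishes the two dualities.\<close>

definition dual :: "bool \<Rightarrow> 'a::comm_ring_1 mf \<Rightarrow> 'a mf" where
  "dual \<delta> M = (if \<delta> then mf_dual M else mf_transpose M)"

definition dsign :: "bool \<Rightarrow> 'a::comm_ring_1" where
  "dsign \<delta> = (if \<delta> then - 1 else 1)"

lemma dsign_sq [simp]: "dsign \<delta> * dsign \<delta> = 1" "dsign \<delta> * (dsign \<delta> * a) = a" by (simp_all add: dsign_def)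

lemma dual_simps [simp]:
  "i < rank M \<Longrightarrow> par (dual \<delta> M) ! i = (\<delta> \<noteq> par M ! i)" "rank (dual \<delta> M) = rank M"
  "opr (dual \<delta> M) = dsign \<delta> \<cdot>\<^sub>m transpose_mat (opr M)"
  by (auto simp: dual_def mf_dual_def mf_transpose_def dsign_def)

lemma sign_mat_dual: "sign_mat (par (dual \<delta> M)) = (if \<delta> then - sign_mat (par M) else sign_mat (par M))"
  by (auto simp: dual_def mf_dual_def mf_transpose_def sign_mat_Not)

lemma uminus_zero_mat [simp]: "- 0\<^sub>m m n = (0\<^sub>m m n :: 'a::comm_ring_1 mat)"
  by (rule eq_matI) auto

lemma smult_uminus_mat [simp]: "c \<cdot>\<^sub>m - A = - (c \<cdot>\<^sub>m (A :: 'a::comm_ring_1 mat))"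
  by (rule eq_matI) auto

lemma dual_dual: "dual \<delta> (dual \<delta> M) = M"
  by (rule mf.expand) (auto simp: comp_def transpose_uminus dual_def mf_dual_def mf_transpose_def)

lemma transpose_smult: "transpose_mat (c \<cdot>\<^sub>m A) = c \<cdot>\<^sub>m transpose_mat A"
  by (rule eq_matI) auto

lemma transpose_mult': "dim_col A = dim_row B \<Longrightarrow> transpose_mat (A * B) = transpose_mat B * transpose_mat (A :: 'a::comm_ring_1 mat)"
  by (rule transpose_mult[of A "dim_row A" "dim_col A" B "dim_col B"]) auto

lemma transpose_add': "dim_row A = dim_row B \<Longrightarrow> dim_col A = dim_col B \<Longrightarrow> transpose_mat (A + B) = transpose_mat A + transpose_mat B"
  by (rule eq_matI) auto

lemma dual_graded:
  assumes "f \<in> graded_maps p X Y"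
  shows "transpose_mat f \<in> graded_maps p (dual \<delta> Y) (dual \<delta> X)"
proof (rule gradedI)
  fix i j assume "i < rank (dual \<delta> X)" "j < rank (dual \<delta> Y)" "transpose_mat f $$ (i, j) \<noteq> 0"
  then show "(par (dual \<delta> X) ! i \<noteq> par (dual \<delta> Y) ! j) = p"
    using gradedD[OF assms, of j i] assms by auto
qed (use assms in auto)

lemma dual_is_mf:
  assumes "is_mf w M"
  shows "is_mf w (dual \<delta> M)"
proof -
  note mf = is_mfD[OF assms]
  have "opr (dual \<delta> M) \<in> graded_maps True (dual \<delta> M) (dual \<delta> M)"
    using dual_graded[OF mf(1), of \<delta>] by (simp add: graded_smult)
  moreover have "opr (dual \<delta> M) * opr (dual \<delta> M) = w \<cdot>\<^sub>m 1\<^sub>m (rank M)"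
    using mf by (simp add: mat_smultl mat_smultr mat_smult_smult transpose_mult'[symmetric] transpose_smult)
  ultimately show ?thesis by (simp add: is_mf_def)
qed

lemma dual_chain:
  assumes mfs: "is_mf w X" "is_mf w Y" and f: "f \<in> chain_maps X Y"
  shows "transpose_mat f \<in> chain_maps (dual \<delta> Y) (dual \<delta> X)"
proof -
  note mf = is_mfD[OF mfs(1)] is_mfD[OF mfs(2)] and d = chainD[OF f]
  have "transpose_mat (opr Y * f) = transpose_mat (f * opr X)" using f mfs by (simp add: chain_iff)
  then have "transpose_mat f * transpose_mat (opr Y) = transpose_mat (opr X) * transpose_mat f"
    using mf d by (simp add: transpose_mult')
  then show ?thesis
    using mf d dual_graded[OF d(1), of \<delta>]
    by (simp add: chain_iff[OF dual_is_mf[OF mfs(2)] dual_is_mf[OF mfs(1)]] mat_smultl mat_smultr)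
qed

lemma dual_htp:
  assumes mfs: "is_mf w X" "is_mf w Y" and f: "htp X Y f g"
  shows "htp (dual \<delta> Y) (dual \<delta> X) (transpose_mat f) (transpose_mat g)"
proof -
  note mf = is_mfD[OF mfs(1)] is_mfD[OF mfs(2)] and d = chainD[OF htpD(1)[OF f]] chainD[OF htpD(2)[OF f]]
  obtain h where h: "h \<in> graded_maps True X Y" "f = g + (opr Y * h + h * opr X)"
    using htpE[OF mfs f] .
  let ?h = "dsign \<delta> \<cdot>\<^sub>m transpose_mat h"
  show ?thesis
  proof (rule htpI[OF dual_is_mf[OF mfs(2)] dual_is_mf[OF mfs(1)] dual_chain[OF mfs htpD(1)[OF f]] dual_chain[OF mfs htpD(2)[OF f]]])
    show "?h \<in> graded_maps True (dual \<delta> Y) (dual \<delta> X)" by (intro graded_smult dual_graded h)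
    show "transpose_mat f = transpose_mat g + (opr (dual \<delta> X) * ?h + ?h * opr (dual \<delta> Y))"
      unfolding h(2) using mf h(1) d
      by (simp add: transpose_add' transpose_mult' mat_smultl mat_smultr mat_smult_smult)
        (rule eq_matI; simp add: add.commute)
  qed
qed

lemma dual_htp_equiv:
  assumes mfs: "is_mf w X" "is_mf w Y" and f: "htp_equiv X Y f g"
  shows "htp_equiv (dual \<delta> Y) (dual \<delta> X) (transpose_mat f) (transpose_mat g)"
proof -
  note c = f[unfolded htp_equiv_def]
  have d: "dim_row f = rank Y" "dim_col f = rank X" "dim_row g = rank X" "dim_col g = rank Y"
    using c chainD by blast+
  show ?thesis
    using c dual_chain[OF mfs, of f \<delta>] dual_chain[OF mfs(2,1), of g \<delta>] d
      dual_htp[OF mfs(2,2), of "f * g" "1\<^sub>m (rank Y)" \<delta>] dual_htp[OF mfs(1,1), of "g * f" "1\<^sub>m (rank X)" \<delta>]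
    unfolding htp_equiv_def by (simp add: transpose_mult')
qed

definition is_gform :: "bool \<Rightarrow> int \<Rightarrow> 'a::comm_ring_1 mf \<Rightarrow> 'a mat \<Rightarrow> bool" where
  "is_gform \<delta> s M q \<longleftrightarrow> mf_iso M (dual \<delta> M) q \<and> transpose_mat q = of_int s \<cdot>\<^sub>m q"

lemma mf_isoE:
  assumes M: "is_mf w M" and q: "mf_iso M (dual \<delta> M) q"
  obtains c where "q \<in> chain_maps M (dual \<delta> M)" "c \<in> chain_maps (dual \<delta> M) M" "c * q = 1\<^sub>m (rank M)" "q * c = 1\<^sub>m (rank M)"
    "c * transpose_mat (opr M) * q = dsign \<delta> \<cdot>\<^sub>m opr M"
proof -
  obtain c where c: "q \<in> chain_maps M (dual \<delta> M)" "c \<in> chain_maps (dual \<delta> M) M" "c * q = 1\<^sub>m (rank M)" "q * c = 1\<^sub>m (rank M)"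
    using q by (auto simp: mf_iso_def)
  note d = chainD[OF c(1)] chainD[OF c(2)] and mf = is_mfD[OF M]
  have "dsign \<delta> \<cdot>\<^sub>m (transpose_mat (opr M) * q) = q * opr M"
    using c(1) mf d by (simp add: chain_iff[OF M dual_is_mf[OF M]] mat_smultl)
  then have "dsign \<delta> \<cdot>\<^sub>m (dsign \<delta> \<cdot>\<^sub>m (transpose_mat (opr M) * q)) = dsign \<delta> \<cdot>\<^sub>m (q * opr M)" by simp
  then have "transpose_mat (opr M) * q = dsign \<delta> \<cdot>\<^sub>m (q * opr M)" by (simp add: mat_smult_smult)
  then have "c * transpose_mat (opr M) * q = dsign \<delta> \<cdot>\<^sub>m ((c * q) * opr M)"
    using mf d by (simp add: mat_assoc mat_smultr)
  then have "c * transpose_mat (opr M) * q = dsign \<delta> \<cdot>\<^sub>m opr M" using mf by (simp add: c(3))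
  with c show ?thesis by (rule that)
qed

lemma is_form_iff:
  assumes M: "is_mf w M"
  shows "is_form \<epsilon> M b \<longleftrightarrow> is_gform True (- \<epsilon>) M b"
proof -
  have s: "- (of_int \<epsilon> \<cdot>\<^sub>m b) = of_int (- \<epsilon>) \<cdot>\<^sub>m b" by (rule eq_matI) auto
  have "\<exists>c\<in>carrier_mat (rank M) (rank M). c * b = 1\<^sub>m (rank M) \<and> b * c = 1\<^sub>m (rank M) \<and>
      c * transpose_mat (opr M) * b = - opr M" if "mf_iso M (dual True M) b"
    using mf_isoE[OF M that] by (metis carrier_matI chainD(2,3) dsign_def dual_simps(2) minus_one_smult_mat)
  then show ?thesis by (auto simp: is_form_def is_gform_def s dual_def)
qed

lemma is_twisted_form_iff:
  assumes M: "is_mf w M"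
  shows "is_twisted_form \<epsilon> M b \<longleftrightarrow> is_gform False \<epsilon> M b"
proof -
  have "\<exists>c\<in>carrier_mat (rank M) (rank M). c * b = 1\<^sub>m (rank M) \<and> b * c = 1\<^sub>m (rank M) \<and>
      c * transpose_mat (opr M) * b = opr M" if "mf_iso M (dual False M) b"
    using mf_isoE[OF M that] by (metis carrier_matI chainD(2,3) dsign_def dual_simps(2) one_smult_mat)
  then show ?thesis by (auto simp: is_twisted_form_def is_gform_def dual_def)
qed

section \<open>\<open>\<theta>\<close> exchanges the two dualities\<close>

text \<open>
  The form $\beta$ of $(x, y)$, tensored with the identity of the dual of $M$, seen as an isomorphism
  from $\theta$ of the dual of $M$ to the other dual of $\theta(M)$. Since $\beta$ is odd, it exchanges the two
  dualities, and the Koszul rule produces the sign matrix when the dual of $M$ has the opposite grading.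
\<close>

definition dual_iso :: "bool \<Rightarrow> 'a::comm_ring_1 mf \<Rightarrow> 'a fps fps mat" where
  "dual_iso \<delta> M = (let E = if \<delta> then - sign_mat (par M) else 1\<^sub>m (rank M) in
     four_block_mat (0\<^sub>m (rank M) (rank M)) (- E) E (0\<^sub>m (rank M) (rank M)))"

definition dual_iso_inv :: "bool \<Rightarrow> 'a::comm_ring_1 mf \<Rightarrow> 'a fps fps mat" where
  "dual_iso_inv \<delta> M = - dual_iso \<delta> M"

definition theta_gform :: "bool \<Rightarrow> 'a::comm_ring_1 mf \<Rightarrow> 'a mat \<Rightarrow> 'a fps fps mat" where
  "theta_gform \<delta> M f = (if \<delta> then theta_form M f else theta_twisted_form M f)"

lemma dual_iso_dim [simp]:
  "dim_row (dual_iso \<delta> M) = 2 * rank M" "dim_col (dual_iso \<delta> M) = 2 * rank M"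
  "dim_row (dual_iso_inv \<delta> M) = 2 * rank M" "dim_col (dual_iso_inv \<delta> M) = 2 * rank M"
  by (auto simp: dual_iso_def dual_iso_inv_def Let_def)

lemma dual_iso_inverse:
  "dual_iso_inv \<delta> M * dual_iso \<delta> M = 1\<^sub>m (2 * rank M)" "dual_iso \<delta> M * dual_iso_inv \<delta> M = 1\<^sub>m (2 * rank M)"
proof -
  have "dual_iso \<delta> M * dual_iso \<delta> M = - 1\<^sub>m (2 * rank M)"
    unfolding dual_iso_def Let_def
    by (cases \<delta>) (simp_all add: four_mult, (rule eq_matI; auto)+)
  moreover have "dim_col (dual_iso \<delta> M) = dim_row (dual_iso \<delta> M)" by simp
  ultimately show "dual_iso_inv \<delta> M * dual_iso \<delta> M = 1\<^sub>m (2 * rank M)" "dual_iso \<delta> M * dual_iso_inv \<delta> M = 1\<^sub>m (2 * rank M)"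
    unfolding dual_iso_inv_def
    by (simp_all only: uminus_mult_left_mat uminus_mult_right_mat uminus_uminus_mat)
qed

lemma dual_iso_chain:
  assumes M: "is_mf w M"
  shows "dual_iso \<delta> M \<in> chain_maps (theta_mf (dual \<delta> M)) (dual (\<not> \<delta>) (theta_mf M))"
proof -
  note mf = is_mfD[OF M] and D = dual_is_mf[OF M, of \<delta>]
  have g: "dual_iso \<delta> M \<in> graded_maps False (theta_mf (dual \<delta> M)) (dual (\<not> \<delta>) (theta_mf M))"
    by (rule gradedI) (auto simp: dual_iso_def Let_def nth_append sign_mat_index split: if_splits)
  have o: "sign_mat (par M) * cm (opr M) = - (cm (opr M) * sign_mat (par M))"
    using sign_mat_odd[OF cm_graded[OF mf(1)]] by simp
  from arg_cong[OF o, of transpose_mat]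
  have o': "cm (transpose_mat (opr M)) * sign_mat (par M) = - (sign_mat (par M) * cm (transpose_mat (opr M)))"
    using mf by (simp add: transpose_mult' transpose_uminus cm_simps)
  have sw: "transpose_mat (swap_opr M) = sign_mat (par M) * cm (transpose_mat (opr M))"
    using mf by (simp add: swap_opr_def transpose_mult' cm_simps)
  have sD: "swap_opr (dual \<delta> M) = - (sign_mat (par M) * cm (transpose_mat (opr M)))"
    using mf o' by (cases \<delta>) (simp_all add: swap_opr_def dsign_def cm_simps sign_mat_dual)
  have oT: "opr (dual (\<not> \<delta>) (theta_mf M)) = dsign (\<not> \<delta>) \<cdot>\<^sub>m four_block_mat (sign_mat (par M) * cm (transpose_mat (opr M)))
      (var_x \<cdot>\<^sub>m sign_mat (par M)) (var_y \<cdot>\<^sub>m sign_mat (par M)) (sign_mat (par M) * cm (transpose_mat (opr M)))"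
    using M mf by (simp add: theta_opr'[OF M] four_transpose transpose_smult sw)
  have "opr (dual (\<not> \<delta>) (theta_mf M)) * dual_iso \<delta> M = dual_iso \<delta> M * opr (theta_mf (dual \<delta> M))"
    unfolding oT theta_opr'[OF D] sD dual_iso_def Let_def
    using mf o'
    by (cases \<delta>) (simp_all add: dsign_def sign_mat_dual four_uminus four_mult mat_smultl mat_smultr mat_assoc)
  with g show ?thesis by (simp add: chain_iff[OF theta_is_mf[OF D] dual_is_mf[OF theta_is_mf[OF M]]])
qed

lemma dual_iso_inv_chain:
  assumes M: "is_mf w M"
  shows "dual_iso_inv \<delta> M \<in> chain_maps (dual (\<not> \<delta>) (theta_mf M)) (theta_mf (dual \<delta> M))"
proof -
  have "dual_iso_inv \<delta> M \<in> graded_maps False (dual (\<not> \<delta>) (theta_mf M)) (theta_mf (dual \<delta> M))"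
    by (rule gradedI) (auto simp: dual_iso_inv_def dual_iso_def Let_def nth_append sign_mat_index split: if_splits)
  then show ?thesis
    by (rule chain_inverse[OF theta_is_mf[OF dual_is_mf[OF M]] dual_is_mf[OF theta_is_mf[OF M]] dual_iso_chain[OF M]])
      (simp_all add: dual_iso_inverse mult_2[symmetric])
qed

lemma theta_gform_eq:
  assumes f: "f \<in> graded_maps False M (dual \<delta> M)"
  shows "theta_gform \<delta> M f = dual_iso \<delta> M * theta_map M f"
proof -
  have d: "dim_row f = rank M" "dim_col f = rank M" using graded_dim[OF f] by simp_all
  have "sign_mat (par (dual \<delta> M)) * cm f = cm f * sign_mat (par M)"
    using sign_mat_even[OF cm_graded[OF f]] by simp
  then have "- (sign_mat (par M) * cm f) = cm f * sign_mat (par M)" if \<delta>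
    using that d by (simp add: sign_mat_dual)
  then have e: "sign_mat (par M) * cm f = - (cm f * sign_mat (par M))" if \<delta>
    using that uminus_uminus_mat by metis
  show ?thesis
    unfolding theta_gform_def dual_iso_def Let_def theta_map_eq[OF d(2)]
    using d e by (cases \<delta>) (simp_all add: theta_form_eq theta_twisted_form_eq four_mult)
qed

text \<open>
  The transpose of $\beta$ is $- \beta$; for forms in the proper sense this sign is cancelled by moving the
  sign matrix past the form, which is odd on the underlying module of $M$.
\<close>

lemma theta_gform_transpose:
  assumes f: "f \<in> graded_maps False M (dual \<delta> M)"
  shows "transpose_mat (theta_gform \<delta> M f) = (- dsign \<delta>) \<cdot>\<^sub>m theta_gform \<delta> M (transpose_mat f)"
proof -
  have d: "dim_row f = rank M" "dim_col f = rank M" using graded_dim[OF f] by simp_all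
  have "sign_mat (par (dual \<delta> M)) * cm f = cm f * sign_mat (par M)"
    using sign_mat_even[OF cm_graded[OF f]] by simp
  then have "- (sign_mat (par M) * cm f) = cm f * sign_mat (par M)" if \<delta>
    using that d by (simp add: sign_mat_dual)
  then have "transpose_mat (- (sign_mat (par M) * cm f)) = transpose_mat (cm f * sign_mat (par M))" if \<delta>
    using that by simp
  then have e: "- (cm (transpose_mat f) * sign_mat (par M)) = sign_mat (par M) * cm (transpose_mat f)" if \<delta>
    using that d by (simp add: transpose_mult' transpose_uminus cm_simps)
  show ?thesis
    using d e[symmetric]
    by (cases \<delta>) (simp_all add: theta_gform_def theta_form_eq theta_twisted_form_eq dsign_def four_transpose four_uminus
      transpose_mult' transpose_uminus cm_simps)
qed

lemma theta_gform_chain: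
  assumes M: "is_mf w M" and f: "f \<in> chain_maps M (dual \<delta> M)"
  shows "theta_gform \<delta> M f \<in> chain_maps (theta_mf M) (dual (\<not> \<delta>) (theta_mf M))"
  unfolding theta_gform_eq[OF chainD(1)[OF f]]
  by (rule chain_mult[OF theta_is_mf[OF M] theta_is_mf[OF dual_is_mf[OF M]] dual_is_mf[OF theta_is_mf[OF M]]
      theta_map_chain[OF M dual_is_mf[OF M] f] dual_iso_chain[OF M]])

lemma theta_gform_is_gform:
  assumes M: "is_mf w M" and q: "is_gform \<delta> s M q"
  shows "is_gform (\<not> \<delta>) (if \<delta> then s else - s) (theta_mf M) (theta_gform \<delta> M q)"
proof -
  note D = dual_is_mf[OF M, of \<delta>]
  note tM = theta_is_mf[OF M] and tD = theta_is_mf[OF D] and Dt = dual_is_mf[OF theta_is_mf[OF M], of "\<not> \<delta>"]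
  have iso: "mf_iso M (dual \<delta> M) q" and sq: "transpose_mat q = of_int s \<cdot>\<^sub>m q" using q by (auto simp: is_gform_def)
  obtain c where c: "q \<in> chain_maps M (dual \<delta> M)" "c \<in> chain_maps (dual \<delta> M) M" "c * q = 1\<^sub>m (rank M)" "q * c = 1\<^sub>m (rank M)"
    using mf_isoE[OF M iso] .
  note d = chainD[OF c(1)] chainD[OF c(2)]
  have dd: "dim_row q = rank M" "dim_col q = rank M" "dim_row c = rank M" "dim_col c = rank M" using d by auto
  let ?b = "theta_gform \<delta> M q" and ?c = "theta_map (dual \<delta> M) c * dual_iso_inv \<delta> M"
  have b: "?b = dual_iso \<delta> M * theta_map M q" by (rule theta_gform_eq[OF d(1)])
  have cq: "theta_map (dual \<delta> M) c * theta_map M q = 1\<^sub>m (2 * rank M)"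
    using theta_map_mult[of q M "dual \<delta> M" c] d c(3) theta_map_one[of M] by (simp add: mult_2)
  have qc: "theta_map M q * theta_map (dual \<delta> M) c = 1\<^sub>m (2 * rank M)"
    using theta_map_mult[of c "dual \<delta> M" M q] d c(4) theta_map_one[of "dual \<delta> M"] by (simp add: mult_2)
  have "?c * ?b = theta_map (dual \<delta> M) c * ((dual_iso_inv \<delta> M * dual_iso \<delta> M) * theta_map M q)"
    unfolding b using dd by (simp add: mat_assoc)
  then have 1: "?c * ?b = 1\<^sub>m (rank (theta_mf M))" using dd by (simp add: dual_iso_inverse cq mult_2)
  have "?b * ?c = dual_iso \<delta> M * ((theta_map M q * theta_map (dual \<delta> M) c) * dual_iso_inv \<delta> M)"
    unfolding b using dd by (simp add: mat_assoc)
  then have 2: "?b * ?c = 1\<^sub>m (rank (theta_mf M))" using dd by (simp add: dual_iso_inverse qc mult_2)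
  have "?c \<in> chain_maps (dual (\<not> \<delta>) (theta_mf M)) (theta_mf M)"
    by (rule chain_mult[OF Dt tD tM dual_iso_inv_chain[OF M] theta_map_chain[OF D M c(2)]])
  then have "mf_iso (theta_mf M) (dual (\<not> \<delta>) (theta_mf M)) ?b"
    unfolding mf_iso_def using theta_gform_chain[OF M c(1)] 1 2 by auto
  moreover have "transpose_mat ?b = of_int (if \<delta> then s else - s) \<cdot>\<^sub>m ?b"
  proof -
    have "theta_gform \<delta> M (of_int s \<cdot>\<^sub>m q) = of_int s \<cdot>\<^sub>m ?b"
    proof -
      have o: "const_xy (of_int s) = of_int s"
        by (metis const_xy_def fps_of_int)
      have g: "of_int s \<cdot>\<^sub>m q \<in> graded_maps False M (dual \<delta> M)" by (rule graded_smult[OF d(1)])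
      have "theta_map M (of_int s \<cdot>\<^sub>m q) = of_int s \<cdot>\<^sub>m theta_map M q"
        using dd by (simp add: theta_map_eq cm_simps o four_smult)
      then show ?thesis unfolding theta_gform_eq[OF g] b using dd by (simp add: mat_smultr)
    qed
    then show ?thesis unfolding theta_gform_transpose[OF d(1)] sq
      by (auto simp: dsign_def mat_smult_smult)
  qed
  ultimately show ?thesis by (simp add: is_gform_def)
qed

section \<open>Descending forms along \<open>\<theta>\<close>\<close>

lemma mvps_half:
  obtains h :: "('n::len0, 'k::field_char_0) mvps" where "h + h = 1"
proof -
  have "mvps_coeff (1 + 1 :: ('n, 'k) mvps) 0 \<noteq> 0"
    unfolding plus_mvps.rep_eq one_mvps.rep_eq by simp
  then obtain h :: "('n, 'k) mvps" where "(1 + 1) * h = 1" by (rule mvps_unit)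
  then show ?thesis by (intro that[of h]) (simp add: distrib_right)
qed

text \<open>
  Homotopic maps of minimal factorizations agree modulo the maximal ideal, so both composites of a
  homotopy equivalence with its inverse are invertible.
\<close>

lemma minimal_htp_equiv_iso:
  fixes M :: "('n::len0, 'k::field) mvps mf"
  assumes mfs: "is_mf w M" "is_mf w M'" and m: "minimal M" "minimal M'" and q: "htp_equiv M M' q r"
  shows "mf_iso M M' q"
proof -
  have c: "q \<in> chain_maps M M'" "r \<in> chain_maps M' M" "htp M M (r * q) (1\<^sub>m (rank M))" "htp M' M' (q * r) (1\<^sub>m (rank M'))"
    using q by (auto simp: htp_equiv_def)
  note d = chainD[OF c(1)] chainD[OF c(2)] and mf = is_mfD[OF mfs(1)] is_mfD[OF mfs(2)]
  obtain a where a: "a \<in> graded_maps False M M" "a * (r * q) = 1\<^sub>m (rank M)"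
    using near_one_inverse[OF graded_mult_even[OF d(1,4)] minimal_htp_ord[OF mfs(1,1) m(1,1) c(3)]] by metis
  obtain b where b: "b \<in> graded_maps False M' M'" "(q * r) * b = 1\<^sub>m (rank M')"
    using near_one_inverse[OF graded_mult_even[OF d(4,1)] minimal_htp_ord[OF mfs(2,2) m(2,2) c(4)]] by metis
  have l: "(a * r) * q = 1\<^sub>m (rank M)" using a d by (simp add: mat_assoc)
  have "a * r = (a * r) * ((q * r) * b)" unfolding b(2) using a(1) d by simp
  also have "\<dots> = ((a * r) * q) * (r * b)" using a(1) b(1) d by (simp add: mat_assoc)
  also have "\<dots> = r * b" unfolding l using b(1) d by simp
  finally have "q * (a * r) = q * (r * b)" by simp
  then have rr: "q * (a * r) = 1\<^sub>m (rank M')" using b d by (simp add: mat_assoc)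
  have "a * r \<in> chain_maps M' M"
    by (rule chain_inverse[OF mfs c(1) graded_mult_even[OF d(4) a(1)] l rr])
  then show ?thesis unfolding mf_iso_def using c(1) l rr by blast
qed

lemma dual_minimal:
  assumes "is_mf w M" "minimal M"
  shows "minimal (dual \<delta> M)"
  using assms is_mfD(3,4)[OF assms(1)]
  by (auto simp: minimal_def mat_ord_def ord_ge_1_iff[simplified] mvps_coeff_0_mult)

lemma htp_equiv_iso:
  assumes mfs: "is_mf w X" "is_mf w Y" and "f \<in> chain_maps X Y" "g \<in> chain_maps Y X" "g * f = 1\<^sub>m (rank X)" "f * g = 1\<^sub>m (rank Y)"
  shows "htp_equiv X Y f g"
  using assms htp_refl[OF mfs(1,1) chain_one[OF mfs(1)]] htp_refl[OF mfs(2,2) chain_one[OF mfs(2)]]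
  by (simp add: htp_equiv_def)

text \<open>
  A form on $N$ gives a homotopy equivalence from $\theta(M)$ to its dual, hence by full faithfulness a
  homotopy equivalence $q_0$ from $M$ to its dual. The form is symmetric up to sign, so $q_0$ is so up to
  homotopy, and its symmetrization $q$, which exists because 2 is invertible, is homotopic to it. For a
  minimal $M$ the map $q$ is an isomorphism and therefore a form. It need not correspond to the given
  form on $N$, but morphisms do not see the forms.
\<close>

theorem gform_descends:
  fixes \<pi> :: "('n::len0, 'k::field_char_0) mvps"
  assumes N: "is_mf (var_x * var_y - const_xy \<pi>) N"
    and b: "is_gform (\<not> \<delta>) (if \<delta> then s else - s) N b" and s: "s * s = 1"
  obtains M q f g where "is_mf \<pi> M" "is_gform \<delta> s M q" "htp_equiv (theta_mf M) N f g"
proof -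
  let ?S = "of_int s :: ('n, 'k) mvps fps fps" and ?c = "- dsign \<delta> :: ('n, 'k) mvps fps fps"
  obtain M f g where M: "is_mf \<pi> M" "minimal M" and fg: "htp_equiv (theta_mf M) N f g"
    using theta_essentially_surjective[OF N] .
  note D = dual_is_mf[OF M(1), of \<delta>]
  note t = theta_is_mf[OF M(1)] and tD = theta_is_mf[OF D] and DN = dual_is_mf[OF N, of "\<not> \<delta>"]
  note Dt = dual_is_mf[OF t, of "\<not> \<delta>"]
  obtain bi where bi: "b \<in> chain_maps N (dual (\<not> \<delta>) N)" "bi \<in> chain_maps (dual (\<not> \<delta>) N) N"
    "bi * b = 1\<^sub>m (rank N)" "b * bi = 1\<^sub>m (rank N)"
    using mf_isoE[OF N, of "\<not> \<delta>" b] b by (auto simp: is_gform_def)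
  have bT: "transpose_mat b = (of_int (if \<delta> then s else - s) :: ('n, 'k) mvps fps fps) \<cdot>\<^sub>m b"
    using b by (auto simp: is_gform_def)
  \<comment> \<open>the form transported to \<open>\<theta>(M)\<close>\<close>
  have fc: "f \<in> chain_maps (theta_mf M) N" using fg by (simp add: htp_equiv_def)
  note d = chainD[OF fc] chainD[OF bi(1)]
  let ?b = "transpose_mat f * (b * f)"
  have e1: "htp_equiv (theta_mf M) (dual (\<not> \<delta>) N) (b * f) (g * bi)"
    by (rule htp_equiv_trans[OF t N DN fg]) (rule htp_equiv_iso[OF N DN bi(1,2)], use bi in simp_all)
  have e2: "htp_equiv (theta_mf M) (dual (\<not> \<delta>) (theta_mf M)) ?b (g * bi * transpose_mat g)"
    by (rule htp_equiv_trans[OF t DN Dt e1 dual_htp_equiv[OF t N fg]])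
  obtain F G where FG: "htp_equiv (theta_mf M) (theta_mf (dual \<delta> M)) F G" and F: "F = dual_iso_inv \<delta> M * ?b"
    using htp_equiv_trans[OF t Dt tD e2 htp_equiv_iso[OF Dt tD dual_iso_inv_chain[OF M(1)] dual_iso_chain[OF M(1)]]]
    by (simp add: dual_iso_inverse mult_2[symmetric])
  have Fc: "F \<in> chain_maps (theta_mf M) (theta_mf (dual \<delta> M))" "G \<in> chain_maps (theta_mf (dual \<delta> M)) (theta_mf M)"
    using FG by (auto simp: htp_equiv_def)
  obtain q0 where q0: "q0 \<in> chain_maps M (dual \<delta> M)" and hq: "htp (theta_mf M) (theta_mf (dual \<delta> M)) F (theta_map M q0)"
    using theta_full[OF M(1) D Fc(1)] .
  obtain r0 where r0: "r0 \<in> chain_maps (dual \<delta> M) M" and hr: "htp (theta_mf (dual \<delta> M)) (theta_mf M) G (theta_map (dual \<delta> M) r0)"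
    using theta_full[OF D M(1) Fc(2)] .
  note dq = chainD[OF q0] chainD[OF r0]
  have q0r0: "htp_equiv M (dual \<delta> M) q0 r0"
  proof -
    have "htp M M (r0 * q0) (1\<^sub>m (rank M))"
    proof (rule theta_faithful[OF M(1) M(1) chain_mult[OF M(1) D M(1) q0 r0] chain_one[OF M(1)]])
      have "htp (theta_mf M) (theta_mf M) (theta_map M (r0 * q0)) (G * F)"
        using htp_sym[OF t t htp_mult[OF t tD t hq hr]] dq by (simp add: theta_map_mult[of q0 M "dual \<delta> M" r0])
      then show "htp (theta_mf M) (theta_mf M) (theta_map M (r0 * q0)) (theta_map M (1\<^sub>m (rank M)))"
        using FG htp_trans[OF t t] unfolding htp_equiv_def theta_map_one by blast
    qed
    moreover have "htp (dual \<delta> M) (dual \<delta> M) (q0 * r0) (1\<^sub>m (rank (dual \<delta> M)))"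
    proof (rule theta_faithful[OF D D chain_mult[OF D M(1) D r0 q0] chain_one[OF D]])
      have "htp (theta_mf (dual \<delta> M)) (theta_mf (dual \<delta> M)) (theta_map (dual \<delta> M) (q0 * r0)) (F * G)"
        using htp_sym[OF tD tD htp_mult[OF tD t tD hr hq]] dq by (simp add: theta_map_mult[of r0 "dual \<delta> M" M q0])
      then show "htp (theta_mf (dual \<delta> M)) (theta_mf (dual \<delta> M)) (theta_map (dual \<delta> M) (q0 * r0)) (theta_map (dual \<delta> M) (1\<^sub>m (rank (dual \<delta> M))))"
        using FG htp_trans[OF tD tD] unfolding htp_equiv_def theta_map_one by blast
    qed
    ultimately show ?thesis using q0 r0 by (simp add: htp_equiv_def)
  qed
  have q0T: "transpose_mat q0 \<in> chain_maps M (dual \<delta> M)"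
    using dual_chain[OF M(1) D q0, of \<delta>] by (simp add: dual_dual)
  \<comment> \<open>$q_0$ is symmetric up to homotopy\<close>
  have bq: "htp (theta_mf M) (dual (\<not> \<delta>) (theta_mf M)) ?b (theta_gform \<delta> M q0)"
  proof -
    have "dual_iso \<delta> M * F = (dual_iso \<delta> M * dual_iso_inv \<delta> M) * ?b" unfolding F using d by (simp add: mat_assoc mult_2)
    then have "dual_iso \<delta> M * F = ?b" unfolding dual_iso_inverse using d by (simp add: mult_2)
    then show ?thesis
      using htp_mult_left[OF t tD Dt hq dual_iso_chain[OF M(1)]] theta_gform_eq[OF dq(1)] by simp
  qed
  have sym: "htp M (dual \<delta> M) (transpose_mat q0) (of_int s \<cdot>\<^sub>m q0)"
  proof -
    let ?X = "theta_mf M" and ?Y = "dual (\<not> \<delta>) (theta_mf M)"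
    have bb: "transpose_mat ?b = (?c * ?S) \<cdot>\<^sub>m ?b"
      using d by (simp add: transpose_mult' bT mat_smultl mat_smultr mat_assoc) (auto simp: dsign_def)
    have tT: "transpose_mat (theta_gform \<delta> M q0) = ?c \<cdot>\<^sub>m theta_gform \<delta> M (transpose_mat q0)"
      by (rule theta_gform_transpose[OF dq(1)])
    have "htp ?X ?Y (transpose_mat ?b) (transpose_mat (theta_gform \<delta> M q0))"
      using dual_htp[OF t Dt bq, of "\<not> \<delta>"] by (simp add: dual_dual)
    then have "htp ?X ?Y ((?c * ?S) \<cdot>\<^sub>m ?b) (?c \<cdot>\<^sub>m theta_gform \<delta> M (transpose_mat q0))"
      unfolding bb tT .
    then have "htp ?X ?Y (?c \<cdot>\<^sub>m ((?c * ?S) \<cdot>\<^sub>m ?b)) (?c \<cdot>\<^sub>m (?c \<cdot>\<^sub>m theta_gform \<delta> M (transpose_mat q0)))"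
      by (rule htp_smult[OF t Dt])
    then have "htp ?X ?Y (?S \<cdot>\<^sub>m ?b) (theta_gform \<delta> M (transpose_mat q0))"
      by (simp add: mat_smult_smult mult.assoc[symmetric])
    then have "htp ?X ?Y (theta_gform \<delta> M (transpose_mat q0)) (?S \<cdot>\<^sub>m theta_gform \<delta> M q0)"
      using htp_trans[OF t Dt htp_sym[OF t Dt] htp_smult[OF t Dt bq]] by blast
    then have "htp ?X (theta_mf (dual \<delta> M)) (dual_iso_inv \<delta> M * theta_gform \<delta> M (transpose_mat q0)) (dual_iso_inv \<delta> M * (?S \<cdot>\<^sub>m theta_gform \<delta> M q0))"
      by (rule htp_mult_left[OF t Dt tD _ dual_iso_inv_chain[OF M(1)]])
    moreover have "dual_iso_inv \<delta> M * theta_gform \<delta> M (transpose_mat q0) = theta_map M (transpose_mat q0)"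
      unfolding theta_gform_eq[OF chainD(1)[OF q0T]] using dq
      by (simp add: mat_assoc[symmetric] dual_iso_inverse)
    moreover have "dual_iso_inv \<delta> M * (?S \<cdot>\<^sub>m theta_gform \<delta> M q0) = theta_map M (of_int s \<cdot>\<^sub>m q0)"
    proof -
      have o: "const_xy (of_int s) = ?S" by (metis const_xy_def fps_of_int)
      have "dual_iso_inv \<delta> M * (?S \<cdot>\<^sub>m theta_gform \<delta> M q0) = ?S \<cdot>\<^sub>m ((dual_iso_inv \<delta> M * dual_iso \<delta> M) * theta_map M q0)"
        unfolding theta_gform_eq[OF dq(1)] using dq by (simp add: mat_assoc mat_smultr)
      also have "\<dots> = ?S \<cdot>\<^sub>m theta_map M q0" unfolding dual_iso_inverse using dq by simp
      finally show ?thesis using dq by (simp add: theta_map_eq cm_simps o four_smult)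
    qed
    ultimately show ?thesis
      using theta_faithful[OF M(1) D q0T chain_smult[OF M(1) D q0]] by simp
  qed
  obtain h :: "('n, 'k) mvps" where h: "h + h = 1" by (rule mvps_half)
  define q where "q = h \<cdot>\<^sub>m (q0 + of_int s \<cdot>\<^sub>m transpose_mat q0)"
  have ss: "of_int s * of_int s = (1 :: ('n, 'k) mvps)" using s by (metis of_int_mult of_int_1)
  have dd: "dim_row q0 = rank M" "dim_col q0 = rank M" using dq by auto
  have qT: "transpose_mat q = of_int s \<cdot>\<^sub>m q"
    unfolding q_def using dd
    by (auto intro!: eq_matI simp: ss mult.left_commute[of "of_int s" h] mult.assoc[symmetric] distrib_left add.commute)
      (simp add: ss mult.commute mult.left_commute mult.assoc[symmetric])
  have qq0: "htp M (dual \<delta> M) q q0"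
  proof -
    have "htp M (dual \<delta> M) (of_int s \<cdot>\<^sub>m transpose_mat q0) (of_int s \<cdot>\<^sub>m (of_int s \<cdot>\<^sub>m q0))"
      by (rule htp_smult[OF M(1) D sym])
    then have "htp M (dual \<delta> M) (of_int s \<cdot>\<^sub>m transpose_mat q0) q0" by (simp add: mat_smult_smult ss)
    then have "htp M (dual \<delta> M) q (h \<cdot>\<^sub>m (q0 + q0))"
      unfolding q_def by (intro htp_smult[OF M(1) D] htp_add[OF M(1) D] htp_refl[OF M(1) D q0])
    moreover have "h \<cdot>\<^sub>m (q0 + q0) = q0"
    proof -
      have "h * (2 * a) = (h + h) * a" for a by (simp add: algebra_simps)
      then show ?thesis by (auto intro!: eq_matI simp: h)
    qed
    ultimately show ?thesis by simp
  qed
  have "htp_equiv M (dual \<delta> M) q r0"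
    using q0r0 htpD(1)[OF qq0] htp_trans[OF M(1) M(1) htp_mult_left[OF M(1) D M(1) qq0 r0]]
      htp_trans[OF D D htp_mult_right[OF D M(1) D r0 qq0]]
    by (auto simp: htp_equiv_def)
  then have "mf_iso M (dual \<delta> M) q"
    by (rule minimal_htp_equiv_iso[OF M(1) D M(2) dual_minimal[OF M]])
  then have "is_gform \<delta> s M q" using qT by (simp add: is_gform_def)
  with M(1) show ?thesis using fg by (rule that)
qed

section \<open>The equivalences\<close>

text \<open>
  Morphisms ignore the additional structure, which therefore only matters for essential surjectivity.
\<close>

lemma lift_equivalence:
  assumes F: "is_functor C D F"
    and inj: "\<And>X Y f g. X \<in> Obj C \<Longrightarrow> Y \<in> Obj C \<Longrightarrow> f \<in> Hom C X Y \<Longrightarrow> g \<in> Hom C X Y \<Longrightarrow>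
      on_mor F X Y f = on_mor F X Y g \<Longrightarrow> f = g"
    and full: "\<And>X Y k. X \<in> Obj C \<Longrightarrow> Y \<in> Obj C \<Longrightarrow> k \<in> Hom D (on_obj F X) (on_obj F Y) \<Longrightarrow>
      \<exists>f\<in>Hom C X Y. on_mor F X Y f = k"
    and t: "\<And>X s. X \<in> Obj C \<Longrightarrow> S X s \<Longrightarrow> S' (on_obj F X) (t X s)"
    and surj: "\<And>Z s. Z \<in> Obj D \<Longrightarrow> S' Z s \<Longrightarrow> \<exists>X\<in>Obj C. \<exists>s. S X s \<and> (\<exists>k. isomorphism D (on_obj F X) Z k)"
  shows "equivalence_of_categories (with_structure C S) (with_structure D S') (lift_functor F t)"
proof (rule equivalenceI)
  interpret is_functor C D F by (rule F)
  have cat: "category (with_structure C' T)" if "category C'" for C' :: "('u, 'v) cat" and T :: "'u \<Rightarrow> 'w \<Rightarrow> bool"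
  proof -
    interpret c: category C' by (rule that)
    show ?thesis
      by unfold_locales (auto simp: with_structure_def c.ident_in c.comp_in c.comp_ident_left c.comp_ident_right c.comp_assoc)
  qed
  show "is_functor (with_structure C S) (with_structure D S') (lift_functor F t)"
  proof (intro is_functor.intro is_functor_axioms.intro cat)
    show "category C" "category D" by unfold_locales
  qed (auto simp: with_structure_def lift_functor_def on_obj_in on_mor_in on_mor_ident on_mor_comp t)
  show "f = g" if "X \<in> Obj (with_structure C S)" "Y \<in> Obj (with_structure C S)" "f \<in> Hom (with_structure C S) X Y"
    "g \<in> Hom (with_structure C S) X Y" "on_mor (lift_functor F t) X Y f = on_mor (lift_functor F t) X Y g" for X Y f g
    using that inj[of "fst X" "fst Y" f g] by (auto simp: with_structure_def lift_functor_def)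
  show "\<exists>f\<in>Hom (with_structure C S) X Y. on_mor (lift_functor F t) X Y f = k"
    if "X \<in> Obj (with_structure C S)" "Y \<in> Obj (with_structure C S)"
      "k \<in> Hom (with_structure D S') (on_obj (lift_functor F t) X) (on_obj (lift_functor F t) Y)" for X Y k
    using that full[of "fst X" "fst Y" k] by (auto simp: with_structure_def lift_functor_def)
  show "\<exists>X\<in>Obj (with_structure C S). \<exists>k. isomorphism (with_structure D S') (on_obj (lift_functor F t) X) Z k"
    if Z: "Z \<in> Obj (with_structure D S')" for Z
  proof -
    obtain Z0 s where "Z = (Z0, s)" "Z0 \<in> Obj D" "S' Z0 s" using Z by (auto simp: with_structure_def)
    with surj obtain X s' k where "X \<in> Obj C" "S X s'" "isomorphism D (on_obj F X) Z0 k" by blast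
    then show ?thesis using \<open>Z = _\<close>
      by (intro bexI[of _ "(X, s')"] exI[of _ k]) (auto simp: with_structure_def lift_functor_def isomorphism_def)
  qed
qed

lemma theta_mor_inj:
  assumes "X \<in> Obj (MF_cat w)" "Y \<in> Obj (MF_cat w)" "f \<in> Hom (MF_cat w) X Y" "g \<in> Hom (MF_cat w) X Y"
    and e: "on_mor theta X Y f = on_mor theta X Y g"
  shows "f = g"
proof -
  have m: "is_mf w X" "is_mf w Y" using assms by (auto simp: MF_cat_simps)
  obtain f' g' where *: "f' \<in> chain_maps X Y" "f = mor_class X Y f'" "g' \<in> chain_maps X Y" "g = mor_class X Y g'"
    using assms(3,4) by (auto simp: MF_cat_simps Ext_iff)
  have "mor_class (theta_mf X) (theta_mf Y) (theta_map X f') = mor_class (theta_mf X) (theta_mf Y) (theta_map X g')"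
    using e by (simp add: theta_def *(2,4) theta_mor_class[OF m *(1)] theta_mor_class[OF m *(3)])
  then have "htp (theta_mf X) (theta_mf Y) (theta_map X f') (theta_map X g')"
    using mor_class_eq_iff[OF theta_is_mf[OF m(1)] theta_is_mf[OF m(2)] theta_map_chain[OF m *(1)] theta_map_chain[OF m *(3)]] by simp
  then have "htp X Y f' g'" by (rule theta_faithful[OF m *(1,3)])
  then show ?thesis using mor_class_eq_iff[OF m *(1,3)] *(2,4) by simp
qed

lemma theta_mor_surj:
  assumes "X \<in> Obj (MF_cat w)" "Y \<in> Obj (MF_cat w)"
    and k: "k \<in> Hom (MF_cat (var_x * var_y - const_xy w)) (on_obj theta X) (on_obj theta Y)"
  shows "\<exists>f\<in>Hom (MF_cat w) X Y. on_mor theta X Y f = k"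
proof -
  have m: "is_mf w X" "is_mf w Y" using assms by (auto simp: MF_cat_simps)
  obtain k' where k': "k' \<in> chain_maps (theta_mf X) (theta_mf Y)" "k = mor_class (theta_mf X) (theta_mf Y) k'"
    using k by (auto simp: MF_cat_simps Ext_iff theta_def)
  obtain g where g: "g \<in> chain_maps X Y" "htp (theta_mf X) (theta_mf Y) k' (theta_map X g)"
    using theta_full[OF m k'(1)] .
  have "on_mor theta X Y (mor_class X Y g) = k"
    using mor_class_eq_iff[OF theta_is_mf[OF m(1)] theta_is_mf[OF m(2)] k'(1) theta_map_chain[OF m g(1)]] g(2)
    by (simp add: theta_def theta_mor_class[OF m g(1)] k'(2))
  then show ?thesis using g(1) by (intro bexI[of _ "mor_class X Y g"]) (auto simp: MF_cat_simps Ext_iff)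
qed

theorem mainTheorem3:
  fixes \<pi> :: "('n::len0, 'k::{alg_closed_field, field_char_0}) mvps"
  assumes "mvps_coeff \<pi> 0 = 0"
  shows "equivalence_of_categories
           (MF_cat \<pi>) (MF_cat (var_x * var_y - const_xy \<pi>)) theta \<and>
         (\<forall>\<epsilon>\<in>{1, - 1}.
           equivalence_of_categories
             (MF_twisted_form_cat \<epsilon> \<pi>) (MF_form_cat \<epsilon> (var_x * var_y - const_xy \<pi>))
             (lift_functor theta theta_twisted_form) \<and>
           equivalence_of_categories
             (MF_form_cat \<epsilon> \<pi>) (MF_twisted_form_cat (- \<epsilon>) (var_x * var_y - const_xy \<pi>))
             (lift_functor theta theta_form))"
proof (intro conjI ballI)
  let ?w = "var_x * var_y - const_xy \<pi>"
  have iso: "\<exists>k. isomorphism (MF_cat ?w) (on_obj theta M) N k"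
    if "is_mf \<pi> M" "is_mf ?w N" "htp_equiv (theta_mf M) N f g" for M N f g
    using isomorphism_MF_iff[OF theta_is_mf[OF that(1)] that(2)] that(3) by (auto simp: theta_def)
  show "equivalence_of_categories (MF_cat \<pi>) (MF_cat ?w) theta"
  proof (rule equivalenceI[OF theta_functor theta_mor_inj theta_mor_surj])
    fix N assume "N \<in> Obj (MF_cat ?w)"
    then have N: "is_mf ?w N" by (simp add: MF_cat_simps)
    obtain M f g where M: "is_mf \<pi> M" and e: "htp_equiv (theta_mf M) N f g"
      using theta_essentially_surjective[OF N] .
    show "\<exists>M\<in>Obj (MF_cat \<pi>). \<exists>k. isomorphism (MF_cat ?w) (on_obj theta M) N k"
      using iso[OF M N e] M by (intro bexI[of _ M]) (simp_all add: MF_cat_simps)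
  qed
  fix \<epsilon> :: int assume "\<epsilon> \<in> {1, - 1}"
  then have ss: "\<epsilon> * \<epsilon> = 1" "- \<epsilon> * - \<epsilon> = 1" by auto
  show "equivalence_of_categories (MF_twisted_form_cat \<epsilon> \<pi>) (MF_form_cat \<epsilon> ?w) (lift_functor theta theta_twisted_form)"
    unfolding MF_twisted_form_cat_def MF_form_cat_def
  proof (rule lift_equivalence[OF theta_functor theta_mor_inj theta_mor_surj])
    fix M q assume "M \<in> Obj (MF_cat \<pi>)" "is_twisted_form \<epsilon> M q"
    then show "is_form \<epsilon> (on_obj theta M) (theta_twisted_form M q)"
      using theta_gform_is_gform[of \<pi> M False \<epsilon> q]
      by (simp add: MF_cat_simps theta_def is_twisted_form_iff is_form_iff[OF theta_is_mf] theta_gform_def)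
  next
    fix N b assume "N \<in> Obj (MF_cat ?w)" and b: "is_form \<epsilon> N b"
    then have N: "is_mf ?w N" by (simp add: MF_cat_simps)
    obtain M q f g where M: "is_mf \<pi> M" and q: "is_gform False \<epsilon> M q" and e: "htp_equiv (theta_mf M) N f g"
      by (rule gform_descends[OF N, of False \<epsilon> b]) (use b ss in \<open>auto simp: is_form_iff[OF N]\<close>)
    show "\<exists>M\<in>Obj (MF_cat \<pi>). \<exists>q. is_twisted_form \<epsilon> M q \<and> (\<exists>k. isomorphism (MF_cat ?w) (on_obj theta M) N k)"
      using iso[OF M N e] M q by (intro bexI[of _ M] exI[of _ q]) (simp_all add: MF_cat_simps is_twisted_form_iff[OF M])
  qed
  show "equivalence_of_categories (MF_form_cat \<epsilon> \<pi>) (MF_twisted_form_cat (- \<epsilon>) ?w) (lift_functor theta theta_form)"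
    unfolding MF_twisted_form_cat_def MF_form_cat_def
  proof (rule lift_equivalence[OF theta_functor theta_mor_inj theta_mor_surj])
    fix M q assume "M \<in> Obj (MF_cat \<pi>)" "is_form \<epsilon> M q"
    then show "is_twisted_form (- \<epsilon>) (on_obj theta M) (theta_form M q)"
      using theta_gform_is_gform[of \<pi> M True "- \<epsilon>" q]
      by (simp add: MF_cat_simps theta_def is_form_iff is_twisted_form_iff[OF theta_is_mf] theta_gform_def)
  next
    fix N b assume "N \<in> Obj (MF_cat ?w)" and b: "is_twisted_form (- \<epsilon>) N b"
    then have N: "is_mf ?w N" by (simp add: MF_cat_simps)
    obtain M q f g where M: "is_mf \<pi> M" and q: "is_gform True (- \<epsilon>) M q" and e: "htp_equiv (theta_mf M) N f g"
      by (rule gform_descends[OF N, of True "- \<epsilon>" b]) (use b ss in \<open>auto simp: is_twisted_form_iff[OF N]\<close>)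
    show "\<exists>M\<in>Obj (MF_cat \<pi>). \<exists>q. is_form \<epsilon> M q \<and> (\<exists>k. isomorphism (MF_cat ?w) (on_obj theta M) N k)"
      using iso[OF M N e] M q by (intro bexI[of _ M] exI[of _ q]) (simp_all add: MF_cat_simps is_form_iff[OF M])
  qed
qed

end
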